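(* Let the sequences be generated by Algorithm iMBA, suppose Assumptions 2, 3 and 4 hold, and let $D$, $f_i,h_i$ and $\Phi$ be as in the context. Let $\widetilde c>0$ and $\widehat k\in\mathbb{N}$ be such that $F(x^{k+1})-\widetilde c\|x^{k+1}-x^k\|^2\le\Phi(z^k)\le F(x^k)$ for all $k\ge\widehat k$, where $z^k:=(\overline x^k,x^k,V^k,L^k,\xi^k)$ (such constants exist). Define $\Phi_{\widetilde c}(z,d):=\Phi(z)+\widetilde c\|d\|^2$ on $\mathbb Z\times\mathbb{R}^n$, let $w^k:=(z^k,x^{k+1}-x^k)$, and let $\mathcal W^*$ be the set of cluster points of $\{w^k\}$. If $\Phi_{\widetilde c}$ has the KL property at every point of $\mathcal W^*$, then $\sum_{k=0}^\infty\|x^{k+1}-x^k\|<\infty$, and consequently $\{x^k\}$ converges to some $x^*\in\omega(x^0)\subset\Gamma^*$.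
   Context: Problem (P): $\min_{x\in\mathbb{R}^n}F(x):=g_0(x)+\delta_{\mathbb{R}^m_-}(g(x))+\phi(x)$, where $g=(g_1,\dots,g_m)^\top$ and $\delta_{\mathbb{R}^m_-}$ is the indicator of the nonpositive orthant. Assumption 1 (standing): (i) $g_0:\mathbb{R}^n\to(-\infty,\infty]$ is locally Lipschitz and upper-$\mathcal C^2$ at every point of an open convex set $\mathcal O\supset\Gamma:=\{x:g(x)\in\mathbb{R}^m_-\}\neq\emptyset$, and each $g_i:\mathbb{R}^n\to\mathbb{R}$, $i\in[m]$, is locally Lipschitz and upper-$\mathcal C^2$ at every point of $\mathbb{R}^n$; (ii) $\phi:\mathbb{R}^n\to\mathbb{R}$ is convex and $F$ is bounded below on $\Gamma$. $\partial$ denotes the limiting subdifferential; $\partial g(x):=\{V\in\mathbb{R}^{n\times m}: V_i\in\partial g_i(x)\ \forall i\}$. A point $x\in\Gamma$ is stationary for (P) if $0\in\partial g_0(x)+\partial\phi(x)+\bigcup_{\zeta\in\mathcal N_{\mathbb{R}^m_-}(g(x))}\sum_{i=1}^m\zeta_i\partial g_i(x)$; $\Gamma^*$ is the set of stationary points. Define $G(x,s,V,L):=g(s)+V^\top(x-s)+\tfrac12\|x-s\|^2L$. Algorithm iMBA (parameters $0<\mu_{\min}\le\mu_{\max}$, $0<L_{\min}\le L_{\max}$, $M,\beta_C,\beta_S,\alpha>0$, $\tau>1$, $x^0\in\Gamma$): at iteration $k$ choose $\xi^k\in\partial g_0(x^k)$, $V^k\in\partial g(x^k)$, $\mu_{k,0}\in[\mu_{\min},\mu_{\max}]$,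 $L^{k,0}\in[L_{\min},L_{\max}]^m$; for $j=0,1,\dots$ choose self-adjoint $\mathcal Q_{k,j}$ with $\mu_{k,j}\mathcal I\preceq\mathcal Q_{k,j}\preceq(\mu_{k,j}+M)\mathcal I$, let $F_{k,j}(x):=g_0(x^k)+\langle\xi^k,x-x^k\rangle+\frac12\langle x-x^k,\mathcal Q_{k,j}(x-x^k)\rangle+\phi(x)$, $\Gamma_{k,j}:=\{x:G(x,x^k,V^k,L^{k,j})\in\mathbb{R}^m_-\}$, $\overline x^{k,j}$ the unique minimizer of $F_{k,j}$ on $\Gamma_{k,j}$, and compute $y^{k,j}$, $v^{k,j}\in\partial\phi(y^{k,j})$, $\lambda^{k,j}\in\mathbb{R}^m_+$ with $F_{k,j}(y^{k,j})\le F_{k,j}(x^k)$, $(-\langle\lambda^{k,j},G(y^{k,j},x^k,V^k,L^{k,j})\rangle)_++\|[G(y^{k,j},x^k,V^k,L^{k,j})]_+\|_\infty\le\frac{\beta_C}2\|y^{k,j}-x^k\|^2$ and $\|\xi^k+\mathcal Q_{k,j}(y^{k,j}-x^k)+v^{k,j}+V^k\lambda^{k,j}+\langle L^{k,j},\lambda^{k,j}\rangle(y^{k,j}-x^k)\|\le\beta_S\|y^{k,j}-x^k\|$. If $g(y^{k,j})\in\mathbb{R}^m_-$ and $F(y^{k,j})\le F(x^k)-\frac\alpha2\|y^{k,j}-x^k\|^2$, accept ($j_k:=j$); else if $g(y^{k,j})\notin\mathbb{R}^m_-$ set $L^{k,j+1}=\tau L^{k,j}$, $\mu_{k,j+1}=\mu_{k,j}$;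 else $L^{k,j+1}=L^{k,j}$, $\mu_{k,j+1}=\tau\mu_{k,j}$. Then $x^{k+1}:=y^{k,j_k}$, $(\mu_k,\mathcal Q_k,L^k,v^{k+1},\lambda^{k+1}):=(\mu_{k,j_k},\mathcal Q_{k,j_k},L^{k,j_k},v^{k,j_k},\lambda^{k,j_k})$, $\overline x^k:=\overline x^{k,j_k}$. Assumption 2: for each $k,j$, the multifunction $x\mapsto G(x,x^k,V^k,L^{k,j})-\mathbb{R}^m_-$ is metrically subregular at $(\overline x^{k,j},0)$. Assumption 3: $\{x^k\}$ is bounded; $\omega(x^0)$ denotes its set of cluster points. Parametric data: $\mathbb U:=\mathbb{R}^n\times\mathbb{R}^m_+\times\mathbb{R}^{n\times m}\times\mathbb{R}^n\times\mathbb S_+$ ($\mathbb S_+$ = positive semidefinite self-adjoint linear maps on $\mathbb{R}^n$); for $u=(s,L,V,\xi,\mathcal Q)$: $H(u,x):=G(x,s,V,L)$, so $\nabla_xH(u,x)\lambda=V\lambda+\langle L,\lambda\rangle(x-s)$; $\mathcal S(u):=\{x:H(u,x)\in\mathbb{R}^m_-\}$; $\Lambda(u,x,y):=\{\lambda\in\mathcal N_{\mathbb{R}^m_-}(H(u,x)):\nabla_xH(u,x)\lambda=y\}$. The partial bounded multiplier property (BMP) w.r.t. $x$ holds at $(u^*,x^* )$ with $x^*\in\mathcal S(u^* )$ if there exist $\kappa>0$ and a neighborhood $\mathcal U\times\mathcal V$ of $(u^*,x^* )$ such that for all $u\in\mathcal U$, $x\in\mathcal V\cap\mathcal S(u)$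 and $y\in\mathcal N_{\mathcal S(u)}(x)$, $\Lambda(u,x,y)\cap\{\lambda:\|\lambda\|\le\kappa\|y\|\}\neq\emptyset$. Let $u^k:=(x^k,L^k,V^k,\xi^k,\mathcal Q_k)$. Assumption 4: the partial BMP w.r.t. $x$ holds at every cluster point of $\{(u^k,\overline x^k)\}_{k\in\mathbb{N}}$. Potential function: let $D\subset\mathcal O$ be a compact convex set containing $\{x^k\}$, and for each $i=0,1,\dots,m$ let $g_i=f_i-h_i$ on $D$, where $f_i:\mathbb{R}^n\to\mathbb{R}$ is a strongly convex quadratic function and $h_i:\mathbb{R}^n\to\mathbb{R}$ is strongly convex (such a decomposition exists). Write $f=(f_1,\dots,f_m)^\top$, $h^*(Z):=(h_1^*(Z_1),\dots,h_m^*(Z_m))^\top$ for $Z\in\mathbb{R}^{n\times m}$ ($h_i^*$ = Fenchel conjugate), $\mathcal Jf$ the Jacobian and $\nabla f=(\mathcal Jf)^\top$. Set $\mathbb Z:=\mathbb{R}^n\times\mathbb{R}^n\times\mathbb{R}^{n\times m}\times\mathbb{R}^m_+\times\mathbb{R}^n$ and $T_0(x,s,\xi):=\langle\xi,x\rangle+f_0(s)-\langle\nabla f_0(s),s\rangle+h_0^*(-\xi+\nabla f_0(s))$, $T(x,s,V,L):=V^\top x+f(s)-\mathcal Jf(s)s+h^*(-V+\nabla f(s))+\frac12\|x-s\|^2L$, $\Phi(z):=\phi(x)+T_0(x,s,\xi)+\delta_{\mathbb{R}^m_-}(T(x,s,V,L))$ for $z=(x,s,V,L,\xi)\in\mathbb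 Z$. KL property: for $\eta>0$ let $\Upsilon_\eta$ be the set of continuous concave $\varphi:[0,\eta)\to\mathbb{R}_+$, continuously differentiable on $(0,\eta)$, with $\varphi(0)=0$ and $\varphi'>0$ on $(0,\eta)$. A proper function $h$ has the KL property at $\overline w\in\mathrm{dom}\,\partial h$ if there exist $\delta>0$, $\eta\in(0,\infty]$, $\varphi\in\Upsilon_\eta$ with $\varphi'(h(w)-h(\overline w))\,\mathrm{dist}(0,\partial h(w))\ge1$ for all $w\in\mathbb{B}(\overline w,\delta)$ with $h(\overline w)<h(w)<h(\overline w)+\eta$. *)

theory Defs
  imports "HOL-Analysis.Analysis"
begin

definition frechet_subdiff :: "('b::real_inner \<Rightarrow> ereal) \<Rightarrow> 'b \<Rightarrow> 'b set" where
  "frechet_subdiff f x = {v. \<bar>f x\<bar> \<noteq> \<infinity> \<and>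
     (\<forall>e>0. \<exists>d>0. \<forall>y. dist y x < d \<longrightarrow>
        f y \<ge> f x + ereal (inner v (y - x) - e * norm (y - x)))}"

definition limiting_subdiff :: "('b::real_inner \<Rightarrow> ereal) \<Rightarrow> 'b \<Rightarrow> 'b set" where
  "limiting_subdiff f x = {v. \<bar>f x\<bar> \<noteq> \<infinity> \<and>
     (\<exists>xs vs. xs \<longlonglongrightarrow> x \<and> (\<lambda>k. f (xs k)) \<longlonglongrightarrow> f x \<and>
        (\<forall>k. vs k \<in> frechet_subdiff f (xs k)) \<and> vs \<longlonglongrightarrow> v)}"

definition ind :: "'b set \<Rightarrow> 'b \<Rightarrow> ereal" where
  "ind C x = (if x \<in> C then 0 else \<infinity>)"

definition normal_cone :: "'b::real_inner set \<Rightarrow> 'b \<Rightarrow> 'b set" where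
  "normal_cone C x = limiting_subdiff (ind C) x"

definition nonpos :: "(real^'m) set" where
  "nonpos = {w. \<forall>i. w $ i \<le> 0}"

definition nonneg :: "(real^'m) set" where
  "nonneg = {w. \<forall>i. w $ i \<ge> 0}"

definition loc_lipschitz_at :: "('b::real_normed_vector \<Rightarrow> real) \<Rightarrow> 'b \<Rightarrow> bool" where
  "loc_lipschitz_at f x = (\<exists>d>0. \<exists>K. \<forall>y\<in>ball x d. \<forall>z\<in>ball x d. \<bar>f y - f z\<bar> \<le> K * dist y z)"

text \<open>Upper-C^2 at a point, via the local characterization of Rockafellar--Wets
  (Thm. 10.33): some (rho/2)||.||^2 - f is convex near the point.\<close>
definition upper_C2_at :: "('b::real_normed_vector \<Rightarrow> real) \<Rightarrow> 'b \<Rightarrow> bool" where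
  "upper_C2_at f x = (\<exists>\<rho>>0. \<exists>d>0. convex_on (ball x d) (\<lambda>y. \<rho> / 2 * (norm y)\<^sup>2 - f y))"

definition strongly_convex :: "('b::real_normed_vector \<Rightarrow> real) \<Rightarrow> bool" where
  "strongly_convex h = (\<exists>\<sigma>>0. convex_on UNIV (\<lambda>x. h x - \<sigma> / 2 * (norm x)\<^sup>2))"

definition self_adjoint :: "('b::real_inner \<Rightarrow>\<^sub>L 'b) \<Rightarrow> bool" where
  "self_adjoint Q = (\<forall>x y. inner (blinfun_apply Q x) y = inner x (blinfun_apply Q y))"

definition psd :: "('b::real_inner \<Rightarrow>\<^sub>L 'b) \<Rightarrow> bool" where
  "psd Q = (self_adjoint Q \<and> (\<forall>x. inner x (blinfun_apply Q x) \<ge> 0))"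

definition strongly_convex_quadratic :: "('b::real_inner \<Rightarrow> real) \<Rightarrow> bool" where
  "strongly_convex_quadratic f = (\<exists>A b c. self_adjoint A \<and>
      (\<exists>\<sigma>>0. \<forall>x. inner x (blinfun_apply A x) \<ge> \<sigma> * (norm x)\<^sup>2) \<and>
      (\<forall>x. f x = inner x (blinfun_apply A x) / 2 + inner b x + c))"

definition grad :: "('b::real_inner \<Rightarrow> real) \<Rightarrow> 'b \<Rightarrow> 'b" where
  "grad f x = (SOME v. (f has_derivative (\<lambda>d. inner v d)) (at x))"

definition fconj :: "('b::real_inner \<Rightarrow> real) \<Rightarrow> 'b \<Rightarrow> ereal" where
  "fconj h y = (SUP x. ereal (inner y x - h x))"

definition cluster_points :: "(nat \<Rightarrow> 'b::topological_space) \<Rightarrow> 'b set" where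
  "cluster_points s = {p. \<exists>r. strict_mono r \<and> (s \<circ> r) \<longlonglongrightarrow> p}"

definition Upsilon :: "ereal \<Rightarrow> (real \<Rightarrow> real) \<Rightarrow> (real \<Rightarrow> real) \<Rightarrow> bool" where
  "Upsilon \<eta> \<phi> \<phi>' =
     (continuous_on {t. 0 \<le> t \<and> ereal t < \<eta>} \<phi> \<and>
      concave_on {t. 0 \<le> t \<and> ereal t < \<eta>} \<phi> \<and>
      (\<forall>t. 0 \<le> t \<and> ereal t < \<eta> \<longrightarrow> \<phi> t \<ge> 0) \<and> \<phi> 0 = 0 \<and>
      (\<forall>t. 0 < t \<and> ereal t < \<eta> \<longrightarrow> (\<phi> has_real_derivative \<phi>' t) (at t) \<and> \<phi>' t > 0) \<and>
      continuous_on {t. 0 < t \<and> ereal t < \<eta>} \<phi>')"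

definition proper :: "('b \<Rightarrow> ereal) \<Rightarrow> bool" where
  "proper h = ((\<forall>w. h w \<noteq> -\<infinity>) \<and> (\<exists>w. h w \<noteq> \<infinity>))"

definition KL_at :: "('b::real_inner \<Rightarrow> ereal) \<Rightarrow> 'b \<Rightarrow> bool" where
  "KL_at h wb = (proper h \<and> limiting_subdiff h wb \<noteq> {} \<and>
     (\<exists>\<delta>>0. \<exists>\<eta>>0. \<exists>\<phi> \<phi>'. Upsilon \<eta> \<phi> \<phi>' \<and>
        (\<forall>w. dist w wb < \<delta> \<and> h wb < h w \<and> h w < h wb + \<eta> \<longrightarrow>
           limiting_subdiff h w \<noteq> {} \<longrightarrow>
           \<phi>' (real_of_ereal (h w - h wb)) * infdist 0 (limiting_subdiff h w) \<ge> 1)))"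

definition gvec :: "('m \<Rightarrow> 'b \<Rightarrow> real) \<Rightarrow> 'b \<Rightarrow> (real^'m)" where
  "gvec g x = (\<chi> i. g i x)"

definition Fobj :: "('b \<Rightarrow> ereal) \<Rightarrow> ('m::finite \<Rightarrow> 'b \<Rightarrow> real) \<Rightarrow> ('b \<Rightarrow> real) \<Rightarrow> 'b \<Rightarrow> ereal" where
  "Fobj g0 g \<phi> x = g0 x + ind nonpos (gvec g x) + ereal (\<phi> x)"

definition feas :: "('m::finite \<Rightarrow> 'b \<Rightarrow> real) \<Rightarrow> 'b set" where
  "feas g = {x. gvec g x \<in> nonpos}"

text \<open>Matrix V in R^{n x m} stored by columns: V $ i is the i-th column.\<close>
definition matvec :: "('b::real_vector^'m::finite) \<Rightarrow> (real^'m) \<Rightarrow> 'b" where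
  "matvec V lam = (\<Sum>i\<in>UNIV. lam $ i *\<^sub>R V $ i)"

definition Gfun :: "('m::finite \<Rightarrow> 'b::real_inner \<Rightarrow> real) \<Rightarrow> 'b \<Rightarrow> 'b \<Rightarrow> ('b^'m) \<Rightarrow> (real^'m) \<Rightarrow> (real^'m)" where
  "Gfun g x s V L = (\<chi> i. g i s + inner (V $ i) (x - s) + (norm (x - s))\<^sup>2 / 2 * L $ i)"

definition stationary_set :: "('b::real_inner \<Rightarrow> ereal) \<Rightarrow> ('m::finite \<Rightarrow> 'b \<Rightarrow> real) \<Rightarrow> ('b \<Rightarrow> real) \<Rightarrow> 'b set" where
  "stationary_set g0 g \<phi> = {x. x \<in> feas g \<and>
     (\<exists>a\<in>limiting_subdiff g0 x. \<exists>b\<in>limiting_subdiff (\<lambda>y. ereal (\<phi> y)) x.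
       \<exists>\<zeta>\<in>normal_cone nonpos (gvec g x). \<exists>c. (\<forall>i. c i \<in> limiting_subdiff (\<lambda>y. ereal (g i y)) x) \<and>
        a + b + (\<Sum>i\<in>UNIV. \<zeta> $ i *\<^sub>R c i) = 0)}"

definition in_U :: "'b::real_inner \<times> (real^'m::finite) \<times> ('b^'m) \<times> 'b \<times> ('b \<Rightarrow>\<^sub>L 'b) \<Rightarrow> bool" where
  "in_U u = (case u of (s, L, V, \<xi>, Q) \<Rightarrow> L \<in> nonneg \<and> psd Q)"

definition S_param :: "('m::finite \<Rightarrow> 'b::real_inner \<Rightarrow> real) \<Rightarrow>
     'b \<times> (real^'m) \<times> ('b^'m) \<times> 'b \<times> ('b \<Rightarrow>\<^sub>L 'b) \<Rightarrow> 'b set" where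
  "S_param g u = (case u of (s, L, V, \<xi>, Q) \<Rightarrow> {x. Gfun g x s V L \<in> nonpos})"

definition Lambda_param :: "('m::finite \<Rightarrow> 'b::real_inner \<Rightarrow> real) \<Rightarrow>
     'b \<times> (real^'m) \<times> ('b^'m) \<times> 'b \<times> ('b \<Rightarrow>\<^sub>L 'b) \<Rightarrow> 'b \<Rightarrow> 'b \<Rightarrow> (real^'m) set" where
  "Lambda_param g u x y = (case u of (s, L, V, \<xi>, Q) \<Rightarrow>
     {lam. lam \<in> normal_cone nonpos (Gfun g x s V L) \<and>
           matvec V lam + inner L lam *\<^sub>R (x - s) = y})"

definition partial_BMP :: "('m::finite \<Rightarrow> 'b::real_inner \<Rightarrow> real) \<Rightarrow>
     'b \<times> (real^'m) \<times> ('b^'m) \<times> 'b \<times> ('b \<Rightarrow>\<^sub>L 'b) \<Rightarrow> 'b \<Rightarrow> bool" where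
  "partial_BMP g us xs = (xs \<in> S_param g us \<and>
     (\<exists>\<kappa>>0. \<exists>UU VV. open UU \<and> us \<in> UU \<and> open VV \<and> xs \<in> VV \<and>
        (\<forall>u\<in>UU. in_U u \<longrightarrow> (\<forall>x\<in>VV \<inter> S_param g u. \<forall>y\<in>normal_cone (S_param g u) x.
           (\<exists>lam\<in>Lambda_param g u x y. norm lam \<le> \<kappa> * norm y)))))"

definition T0fun :: "('b::real_inner \<Rightarrow> real) \<Rightarrow> ('b \<Rightarrow> real) \<Rightarrow> 'b \<Rightarrow> 'b \<Rightarrow> 'b \<Rightarrow> ereal" where
  "T0fun f0 h0 x s \<xi> = ereal (inner \<xi> x + f0 s - inner (grad f0 s) s) + fconj h0 (- \<xi> + grad f0 s)"

text \<open>The m components of T(x,s,V,L); note (Jf(s) s)_i = <grad f_i(s), s>.\<close>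
definition Tfun :: "('m::finite \<Rightarrow> 'b::real_inner \<Rightarrow> real) \<Rightarrow> ('m \<Rightarrow> 'b \<Rightarrow> real) \<Rightarrow>
     'b \<Rightarrow> 'b \<Rightarrow> ('b^'m) \<Rightarrow> (real^'m) \<Rightarrow> 'm \<Rightarrow> ereal" where
  "Tfun f h x s V L i = ereal (inner (V $ i) x + f i s - inner (grad (f i) s) s)
      + fconj (h i) (- (V $ i) + grad (f i) s) + ereal ((norm (x - s))\<^sup>2 / 2 * L $ i)"

text \<open>Phi on Z = R^n x R^n x R^{n x m} x R^m_+ x R^n, extended by +infinity outside Z.\<close>
definition Phi :: "('b::real_inner \<Rightarrow> real) \<Rightarrow> ('b \<Rightarrow> real) \<Rightarrow> ('b \<Rightarrow> real) \<Rightarrow>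
     ('m::finite \<Rightarrow> 'b \<Rightarrow> real) \<Rightarrow> ('m \<Rightarrow> 'b \<Rightarrow> real) \<Rightarrow>
     'b \<times> 'b \<times> ('b^'m) \<times> (real^'m) \<times> 'b \<Rightarrow> ereal" where
  "Phi \<phi> f0 h0 f h z = (case z of (x, s, V, L, \<xi>) \<Rightarrow>
     if L \<in> nonneg then
       ereal (\<phi> x) + T0fun f0 h0 x s \<xi> + (if \<forall>i. Tfun f h x s V L i \<le> 0 then 0 else \<infinity>)
     else \<infinity>)"

definition Phi_c :: "('b::real_inner \<Rightarrow> real) \<Rightarrow> ('b \<Rightarrow> real) \<Rightarrow> ('b \<Rightarrow> real) \<Rightarrow>
     ('m::finite \<Rightarrow> 'b \<Rightarrow> real) \<Rightarrow> ('m \<Rightarrow> 'b \<Rightarrow> real) \<Rightarrow> real \<Rightarrow>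
     ('b \<times> 'b \<times> ('b^'m) \<times> (real^'m) \<times> 'b) \<times> 'b \<Rightarrow> ereal" where
  "Phi_c \<phi> f0 h0 f h c w = (case w of (z, d) \<Rightarrow> Phi \<phi> f0 h0 f h z + ereal (c * (norm d)\<^sup>2))"


definition Fmodel :: "('b::real_inner \<Rightarrow> ereal) \<Rightarrow> ('b \<Rightarrow> real) \<Rightarrow> 'b \<Rightarrow> 'b \<Rightarrow> ('b \<Rightarrow>\<^sub>L 'b) \<Rightarrow> 'b \<Rightarrow> ereal" where
  "Fmodel g0 \<phi> xk \<xi> Q z = g0 xk + ereal (inner \<xi> (z - xk) + inner (z - xk) (blinfun_apply Q (z - xk)) / 2 + \<phi> z)"

definition pos_part_inf_norm :: "(real^'m::finite) \<Rightarrow> real" where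
  "pos_part_inf_norm w = Max (range (\<lambda>i. max 0 (w $ i)))"

end

theory Submission
  imports Defs
begin

text \<open>Write \<open>F\<^sub>k = F (x\<^sup>k)\<close> and \<open>e\<^sub>k = sqrt (F\<^sub>k - F\<^sub>k\<^sub>+\<^sub>1)\<close>; by the acceptance test the steps are
  \<open>O(e\<^sub>k)\<close>, so it suffices that \<open>e\<close> is summable. Comparing the model values at \<open>x\<^sup>k\<close>, at the exact solution
  \<open>xbar\<^sup>k\<close> and at the inexact one \<open>x\<^sup>k\<^sup>+\<^sup>1\<close> shows \<open>\<bar>xbar\<^sup>k - x\<^sup>k\<bar> = O(e\<^sub>k)\<close> and that the predicted decrease
  is \<open>O(e\<^sub>k\<^sup>2)\<close>, without any bound on the multipliers of the inexact solution. The partial BMP supplies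
  bounded multipliers for \<open>xbar\<^sup>k\<close>; they yield a subgradient of the potential at \<open>w\<^sup>k\<close> of norm \<open>O(e\<^sub>k)\<close>.
  The potential equals \<open>lim F\<^sub>k\<close> at all cluster points of \<open>w\<close>, so finitely many desingularizing functions,
  summed to \<open>\<Psi>\<close>, give \<open>e\<^sub>k\<^sub>+\<^sub>1\<^sup>2 \<le> K e\<^sub>k (\<Psi>\<^sub>k - \<Psi>\<^sub>k\<^sub>+\<^sub>1)\<close>, and the arithmetic-geometric mean inequality makes \<open>e\<close>
  summable. Stationarity follows by passing to the limit in the optimality conditions of \<open>xbar\<^sup>k\<close>.\<close>

section \<open>Subdifferentials\<close>

text \<open>The potential at \<open>w^k\<close> is only known to lie between F_{k+1} - c |d|^2 and
  F_k, with d the step. The added term c |d|^2 lifts it to at least F_{k+1}, so the KL inequality at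
  \<open>w^k\<close> speaks about a level at or above F_{k+1}; concavity carries it down to the
  interval from F_{k+2} to F_{k+1}. Hence the decrease e_{k+1}^2 meets a subgradient of size O(e_k),
  and the recursion couples neighbouring indices. The multipliers of the inexact solution could be
  arbitrarily large: x^{k+1} need not satisfy the constraint models, and the BMP speaks only of
  their feasible points. These multipliers enter only paired with xbar^k - x^{k+1}; there convexity
  of the constraint models and the complementarity tolerance bound the pairing by (beta_C / 2) |d|^2
  whatever their size. What remains is an error |d| times a distance to xbar^k, which strong
  convexity of the model absorbs.\<close>

lemma frechet_imp_limiting: "v \<in> frechet_subdiff f x \<Longrightarrow> v \<in> limiting_subdiff f x"
  unfolding limiting_subdiff_def
  by (intro CollectI conjI exI[of _ "\<lambda>_. x"] exI[of _ "\<lambda>_. v"] allI tendsto_const)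
    (auto simp: frechet_subdiff_def)

text \<open>The first-order expansion of the minorant at the touching point is a lower expansion of
  \<open>F\<close>. This is how Frechet subgradients are constructed below: for convex functions,
  for indicators and for the potential.\<close>

lemma frechet_subdiff_minorant:
  fixes F :: "'b::real_inner \<Rightarrow> ereal"
  assumes le: "\<And>w. ereal (m w) \<le> F w" and eq: "F w0 = ereal (m w0)"
    and der: "(m has_derivative (\<lambda>d. inner p d)) (at w0)"
  shows "p \<in> frechet_subdiff F w0"
  unfolding frechet_subdiff_def
proof (intro CollectI conjI allI impI)
  show "\<bar>F w0\<bar> \<noteq> \<infinity>" using eq by simp
  fix e :: real assume "e > 0"
  then obtain d where "d > 0" and d: "\<And>y. norm (y - w0) < d \<Longrightarrow>
      norm (m y - m w0 - inner p (y - w0)) \<le> e * norm (y - w0)"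
    using der unfolding has_derivative_at_alt by blast
  show "\<exists>d>0. \<forall>y. dist y w0 < d \<longrightarrow> F w0 + ereal (inner p (y - w0) - e * norm (y - w0)) \<le> F y"
  proof (intro exI conjI allI impI)
    fix y assume "dist y w0 < d"
    then have "norm (m y - m w0 - inner p (y - w0)) \<le> e * norm (y - w0)"
      using d by (simp add: dist_norm)
    then have "m w0 + (inner p (y - w0) - e * norm (y - w0)) \<le> m y"
      by (simp add: abs_le_iff)
    then have "F w0 + ereal (inner p (y - w0) - e * norm (y - w0)) \<le> ereal (m y)"
      by (simp add: eq)
    then show "F w0 + ereal (inner p (y - w0) - e * norm (y - w0)) \<le> F y"
      using le order_trans by blast
  qed fact
qed

text \<open>Inserting the point at parameter \<open>t\<close> of the segment into the Frechet
  inequality and dividing by a small \<open>t\<close> leaves an arbitrarily small error: convexity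
  along one segment turns the local inequality into a global one.\<close>

lemma frechet_subdiff_chord:
  fixes f :: "'b::real_inner \<Rightarrow> ereal"
  assumes v: "v \<in> frechet_subdiff f x" and fx: "f x = ereal a"
    and conv: "\<And>t. 0 < t \<Longrightarrow> t < 1 \<Longrightarrow> f (x + t *\<^sub>R (z - x)) \<le> ereal ((1 - t) * a + t * b)"
  shows "a + inner v (z - x) \<le> b"
proof (rule field_le_epsilon)
  fix e :: real assume "e > 0"
  define n where "n = norm (z - x) + 1"
  have n: "n > 0" "norm (z - x) \<le> n" by (auto simp: n_def add_nonneg_pos)
  from \<open>e > 0\<close> n obtain d where "d > 0" and d: "\<And>y. dist y x < d \<Longrightarrow>
      f y \<ge> f x + ereal (inner v (y - x) - e / n * norm (y - x))"
    using v unfolding frechet_subdiff_def by (auto dest!: spec[of _ "e / n"])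
  define t where "t = min (1/2) (d / (2 * n))"
  have t: "0 < t" "t < 1" "t * n < d"
    using \<open>d > 0\<close> n by (auto simp: t_def min_def field_simps)
  have tn: "t * norm (z - x) < d"
    using t n by (smt (verit) mult_left_mono)
  have "f x + ereal (inner v (t *\<^sub>R (z - x)) - e / n * norm (t *\<^sub>R (z - x)))
      \<le> f (x + t *\<^sub>R (z - x))"
    using d[of "x + t *\<^sub>R (z - x)"] tn t by (simp add: dist_norm)
  also have "\<dots> \<le> ereal ((1 - t) * a + t * b)" using conv t by blast
  finally have "a + t * inner v (z - x) - e / n * (t * norm (z - x)) \<le> (1 - t) * a + t * b"
    using fx t by simp
  then have "t * (a + inner v (z - x)) \<le> t * (b + e / n * norm (z - x))"
    by (simp add: algebra_simps)
  then have "a + inner v (z - x) \<le> b + e / n * norm (z - x)"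
    using t by simp
  also have "e / n * norm (z - x) \<le> e / n * n"
    using n \<open>e > 0\<close> by (intro mult_left_mono) auto
  finally show "a + inner v (z - x) \<le> b + e" using n by simp
qed

text \<open>The chord inequality holds at each approximating Frechet subgradient and survives the
  limit because the function values converge. The converse uses the affine support as its own smooth
  minorant.\<close>

lemma limiting_subdiff_convex:
  fixes \<phi> :: "'a::euclidean_space \<Rightarrow> real"
  assumes "convex_on UNIV \<phi>"
  shows "v \<in> limiting_subdiff (\<lambda>y. ereal (\<phi> y)) x \<longleftrightarrow> (\<forall>z. \<phi> x + inner v (z - x) \<le> \<phi> z)"
proof
  assume "v \<in> limiting_subdiff (\<lambda>y. ereal (\<phi> y)) x"
  then obtain xs vs where xs: "xs \<longlonglongrightarrow> x" and vs: "vs \<longlonglongrightarrow> v"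
      and ph: "(\<lambda>k. \<phi> (xs k)) \<longlonglongrightarrow> \<phi> x"
      and fr: "\<And>k. vs k \<in> frechet_subdiff (\<lambda>y. ereal (\<phi> y)) (xs k)"
    unfolding limiting_subdiff_def by auto
  show "\<forall>z. \<phi> x + inner v (z - x) \<le> \<phi> z"
  proof
    fix z
    have "\<phi> (xs k) + inner (vs k) (z - xs k) \<le> \<phi> z" for k
    proof (rule frechet_subdiff_chord[OF fr refl])
      fix t :: real assume "0 < t" "t < 1"
      then show "ereal (\<phi> (xs k + t *\<^sub>R (z - xs k))) \<le> ereal ((1 - t) * \<phi> (xs k) + t * \<phi> z)"
        using convex_onD[OF assms, of t "xs k" z] by (simp add: algebra_simps)
    qed
    moreover have "(\<lambda>k. \<phi> (xs k) + inner (vs k) (z - xs k)) \<longlonglongrightarrow> \<phi> x + inner v (z - x)"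
      by (intro tendsto_intros ph vs xs)
    ultimately show "\<phi> x + inner v (z - x) \<le> \<phi> z"
      by (intro LIMSEQ_le_const2) auto
  qed
next
  assume *: "\<forall>z. \<phi> x + inner v (z - x) \<le> \<phi> z"
  show "v \<in> limiting_subdiff (\<lambda>y. ereal (\<phi> y)) x"
  proof (rule frechet_imp_limiting, rule frechet_subdiff_minorant)
    show "ereal (\<phi> x + inner v (w - x)) \<le> ereal (\<phi> w)" for w using * by simp
    show "((\<lambda>w. \<phi> x + inner v (w - x)) has_derivative inner v) (at x)"
      by (auto intro!: derivative_eq_intros)
  qed simp
qed

lemma normal_cone_convex:
  fixes C :: "'b::real_inner set"
  assumes "convex C"
  shows "v \<in> normal_cone C x \<longleftrightarrow> x \<in> C \<and> (\<forall>z\<in>C. inner v (z - x) \<le> 0)"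
proof
  assume "v \<in> normal_cone C x"
  then obtain xs vs where xC: "x \<in> C" and xs: "xs \<longlonglongrightarrow> x" and vs: "vs \<longlonglongrightarrow> v"
      and fr: "\<And>k. vs k \<in> frechet_subdiff (ind C) (xs k)"
    unfolding limiting_subdiff_def normal_cone_def by (auto simp: ind_def split: if_splits)
  have xsC: "xs k \<in> C" for k
    using fr[of k] by (auto simp: frechet_subdiff_def ind_def split: if_splits)
  have "inner v (z - x) \<le> 0" if z: "z \<in> C" for z
  proof -
    have "0 + inner (vs k) (z - xs k) \<le> 0" for k
    proof (rule frechet_subdiff_chord[OF fr])
      show "ind C (xs k) = ereal 0" using xsC by (simp add: ind_def)
      fix t :: real assume "0 < t" "t < 1"
      then have "xs k + t *\<^sub>R (z - xs k) \<in> C"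
        using convexD_alt[OF assms xsC z, of t] by (simp add: algebra_simps)
      then show "ind C (xs k + t *\<^sub>R (z - xs k)) \<le> ereal ((1 - t) * 0 + t * 0)"
        by (simp add: ind_def)
    qed
    moreover have "(\<lambda>k. inner (vs k) (z - xs k)) \<longlonglongrightarrow> inner v (z - x)"
      by (intro tendsto_intros vs xs)
    ultimately show "inner v (z - x) \<le> 0"
      by (intro LIMSEQ_le_const2) auto
  qed
  with xC show "x \<in> C \<and> (\<forall>z\<in>C. inner v (z - x) \<le> 0)" by blast
next
  assume *: "x \<in> C \<and> (\<forall>z\<in>C. inner v (z - x) \<le> 0)"
  show "v \<in> normal_cone C x"
    unfolding normal_cone_def
  proof (rule frechet_imp_limiting, rule frechet_subdiff_minorant)
    show "ereal (inner v (w - x)) \<le> ind C w" for w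
      using * by (auto simp: ind_def)
    show "ind C x = ereal (inner v (x - x))" using * by (simp add: ind_def)
    show "((\<lambda>w. inner v (w - x)) has_derivative inner v) (at x)"
      by (auto intro!: derivative_eq_intros)
  qed
qed

lemma convex_nonpos: "convex (nonpos :: (real^'m) set)"
  unfolding nonpos_def convex_def by (auto intro!: add_nonpos_nonpos mult_nonneg_nonpos)

text \<open>Moving \<open>w\<close> in a single coordinate, once down by 1 and once up to 0, stays
  in the orthant; these two tests give the sign and the complementarity conditions.\<close>

lemma normal_cone_nonpos:
  fixes w :: "real^'m"
  shows "lam \<in> normal_cone nonpos w \<longleftrightarrow> w \<in> nonpos \<and> lam \<in> nonneg \<and> (\<forall>i. lam $ i * w $ i = 0)"
proof -
  have "lam \<in> nonneg \<and> (\<forall>i. lam $ i * w $ i = 0)"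
    if w: "w \<in> nonpos" and *: "\<And>z. z \<in> nonpos \<Longrightarrow> inner lam (z - w) \<le> 0"
  proof -
    have ax: "inner lam (axis i r) = lam $ i * r" for i r
      by (metis inner_axis inner_real_def)
    have n: "lam $ i \<ge> 0" for i
    proof -
      have "w + axis i (-1) \<in> nonpos"
        using w by (auto simp: nonpos_def axis_def intro: order_trans[of _ "0 + 0"])
      from *[OF this] show ?thesis by (simp add: ax)
    qed
    have "lam $ i * w $ i \<ge> 0" for i
    proof -
      have "w + axis i (- (w $ i)) \<in> nonpos"
        using w by (auto simp: nonpos_def axis_def)
      from *[OF this] show ?thesis by (simp add: ax)
    qed
    moreover have "lam $ i * w $ i \<le> 0" for i
      using w n[of i] by (simp add: nonpos_def mult_nonneg_nonpos)
    ultimately have "lam $ i * w $ i = 0" for i by (meson antisym)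
    then show ?thesis using n by (simp add: nonneg_def)
  qed
  moreover have "inner lam (z - w) \<le> 0"
    if "w \<in> nonpos" "lam \<in> nonneg" "\<And>i. lam $ i * w $ i = 0" "z \<in> nonpos" for z
  proof -
    have "inner lam (z - w) = (\<Sum>i\<in>UNIV. lam $ i * z $ i)"
      unfolding inner_vec_def using that(3) by (intro sum.cong refl) (simp add: right_diff_distrib)
    also have "\<dots> \<le> 0"
      using that by (intro sum_nonpos) (simp add: nonneg_def nonpos_def mult_nonneg_nonpos)
    finally show ?thesis .
  qed
  ultimately show ?thesis
    unfolding normal_cone_convex[OF convex_nonpos] by blast
qed

lemma limiting_subdiff_approx:
  assumes v: "v \<in> limiting_subdiff f x" and e: "e > 0"
  shows "\<exists>x' v'. v' \<in> frechet_subdiff f x' \<and> dist x' x < e \<and> dist v' v < e \<and>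
      f x - ereal e \<le> f x' \<and> f x' \<le> f x + ereal e"
proof -
  from v obtain us ws where us: "us \<longlonglongrightarrow> x" and f: "(\<lambda>j. f (us j)) \<longlonglongrightarrow> f x"
    and fr: "\<And>j. ws j \<in> frechet_subdiff f (us j)" and ws: "ws \<longlonglongrightarrow> v" and fi: "\<bar>f x\<bar> \<noteq> \<infinity>"
    unfolding limiting_subdiff_def mem_Collect_eq by metis
  from fi obtain a where a: "f x = ereal a" by (cases "f x") simp_all
  have "\<forall>\<^sub>F j in sequentially. dist (us j) x < e"
    using us e by (rule tendstoD)
  moreover have "\<forall>\<^sub>F j in sequentially. dist (ws j) v < e"
    using ws e by (rule tendstoD)
  moreover have "\<forall>\<^sub>F j in sequentially. ereal (a - e) < f (us j)"
    using f[unfolded a] by (rule order_tendstoD) (use e in simp)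
  moreover have "\<forall>\<^sub>F j in sequentially. f (us j) < ereal (a + e)"
    using f[unfolded a] by (rule order_tendstoD) (use e in simp)
  ultimately have "\<forall>\<^sub>F j in sequentially. dist (us j) x < e \<and> dist (ws j) v < e \<and>
      ereal (a - e) < f (us j) \<and> f (us j) < ereal (a + e)"
    by eventually_elim blast
  then obtain j where j: "dist (us j) x < e" "dist (ws j) v < e"
      "ereal (a - e) < f (us j)" "f (us j) < ereal (a + e)"
    using eventually_happens'[OF sequentially_bot] by blast
  show ?thesis
  proof (intro exI conjI)
    show "ws j \<in> frechet_subdiff f (us j)" by (rule fr)
    show "f x - ereal e \<le> f (us j)" using j(3) by (simp add: a)
    show "f (us j) \<le> f x + ereal e" using j(4) by (simp add: a)
  qed (fact j)+
qed

text \<open>Diagonal argument: each limiting subgradient is replaced by a Frechet one at distance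
  less than \<open>1 / Suc k\<close>, with the function value controlled as well, so that a limit of
  limits becomes a single limit. The stationarity of the limit point rests on it.\<close>

lemma limiting_subdiff_closed:
  fixes f :: "'b::real_inner \<Rightarrow> ereal"
  assumes xs: "xs \<longlonglongrightarrow> x" and fxs: "(\<lambda>k. f (xs k)) \<longlonglongrightarrow> f x" and fin: "\<bar>f x\<bar> \<noteq> \<infinity>"
    and mem: "\<And>k. vs k \<in> limiting_subdiff f (xs k)" and vs: "vs \<longlonglongrightarrow> v"
  shows "v \<in> limiting_subdiff f x"
proof -
  define e where "e k = 1 / real (Suc k)" for k
  have e: "e k > 0" for k by (simp add: e_def)
  have "\<forall>k. \<exists>p. snd p \<in> frechet_subdiff f (fst p) \<and> dist (fst p) (xs k) < e k \<and>
      dist (snd p) (vs k) < e k \<and>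
      f (xs k) - ereal (e k) \<le> f (fst p) \<and> f (fst p) \<le> f (xs k) + ereal (e k)"
    using limiting_subdiff_approx[OF mem e] by simp
  from choice[OF this] obtain p where p: "\<And>k. snd (p k) \<in> frechet_subdiff f (fst (p k)) \<and>
      dist (fst (p k)) (xs k) < e k \<and> dist (snd (p k)) (vs k) < e k \<and>
      f (xs k) - ereal (e k) \<le> f (fst (p k)) \<and> f (fst (p k)) \<le> f (xs k) + ereal (e k)"
    by blast
  define x' v' where "x' k = fst (p k)" and "v' k = snd (p k)" for k
  have fr: "v' k \<in> frechet_subdiff f (x' k)"
    and dx: "dist (x' k) (xs k) < e k" and dv: "dist (v' k) (vs k) < e k"
    and lo: "f (xs k) - ereal (e k) \<le> f (x' k)" and hi: "f (x' k) \<le> f (xs k) + ereal (e k)" for k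
    using p[of k] by (auto simp: x'_def v'_def)
  have z: "e \<longlonglongrightarrow> 0"
    unfolding e_def using LIMSEQ_inverse_real_of_nat by (simp add: inverse_eq_divide)
  then have ze: "(\<lambda>k. ereal (e k)) \<longlonglongrightarrow> 0"
    unfolding zero_ereal_def by simp
  have dx0: "(\<lambda>k. x' k - xs k) \<longlonglongrightarrow> 0"
    by (rule Lim_null_comparison[OF always_eventually z])
      (use dx in \<open>simp add: dist_norm less_imp_le\<close>)
  have x': "x' \<longlonglongrightarrow> x"
    using tendsto_add[OF dx0 xs] by simp
  have dv0: "(\<lambda>k. v' k - vs k) \<longlonglongrightarrow> 0"
    by (rule Lim_null_comparison[OF always_eventually z])
      (use dv in \<open>simp add: dist_norm less_imp_le\<close>)
  have v': "v' \<longlonglongrightarrow> v"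
    using tendsto_add[OF dv0 vs] by simp
  have "(\<lambda>k. f (x' k)) \<longlonglongrightarrow> f x"
  proof (rule tendsto_sandwich)
    have "(\<lambda>k. f (xs k) - ereal (e k)) \<longlonglongrightarrow> f x - 0"
      using fin by (intro tendsto_diff_ereal fxs ze) auto
    then show "(\<lambda>k. f (xs k) - ereal (e k)) \<longlonglongrightarrow> f x" by simp
    have "(\<lambda>k. f (xs k) + ereal (e k)) \<longlonglongrightarrow> f x + 0"
      using fin by (intro tendsto_add_ereal fxs ze) auto
    then show "(\<lambda>k. f (xs k) + ereal (e k)) \<longlonglongrightarrow> f x" by simp
  qed (use lo hi in \<open>simp_all add: always_eventually\<close>)
  then show ?thesis
    unfolding limiting_subdiff_def using fin fr x' v' by blast
qed

section \<open>Compactness, convexity and conjugates\<close>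

lemma compact_uniform_bound:
  fixes P :: "'b::metric_space \<Rightarrow> real \<Rightarrow> bool"
  assumes "compact C"
    and loc: "\<And>a. a \<in> C \<Longrightarrow> \<exists>d>0. \<exists>K. \<forall>z\<in>C \<inter> ball a d. P z K"
    and mono: "\<And>z K K'. P z K \<Longrightarrow> K \<le> K' \<Longrightarrow> P z K'"
  shows "\<exists>K\<ge>0. \<forall>z\<in>C. P z K"
proof -
  have "\<forall>a\<in>C. \<exists>q. fst q > 0 \<and> (\<forall>z\<in>C \<inter> ball a (fst q). P z (snd q))"
    using loc by (metis fst_conv snd_conv)
  from bchoice[OF this] obtain q where q: "\<And>a. a \<in> C \<Longrightarrow> fst (q a) > 0"
    "\<And>a z. a \<in> C \<Longrightarrow> z \<in> C \<Longrightarrow> z \<in> ball a (fst (q a)) \<Longrightarrow> P z (snd (q a))"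
    by blast
  have "C \<subseteq> (\<Union>a\<in>C. ball a (fst (q a)))" using q(1) by force
  then obtain I where I: "I \<subseteq> C" "finite I" "C \<subseteq> (\<Union>a\<in>I. ball a (fst (q a)))"
    using compactE_image[OF \<open>compact C\<close>, of C "\<lambda>a. ball a (fst (q a))"] by (metis open_ball)
  define K where "K = Max (insert 0 ((\<lambda>a. snd (q a)) ` I))"
  have "K \<ge> 0" unfolding K_def using I by (intro Max_ge) auto
  moreover have "P z K" if "z \<in> C" for z
  proof -
    obtain a where a: "a \<in> I" "z \<in> ball a (fst (q a))" using I \<open>z \<in> C\<close> by blast
    have "snd (q a) \<le> K" unfolding K_def using a I by (intro Max_ge) auto
    with q(2)[of a z] a I \<open>z \<in> C\<close> mono show ?thesis by blast
  qed
  ultimately show ?thesis by blast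
qed

lemma loc_lipschitz_isCont:
  assumes "loc_lipschitz_at f x"
  shows "isCont f x"
proof -
  obtain d K where d: "d > 0" and K: "\<And>y z. y \<in> ball x d \<Longrightarrow> z \<in> ball x d \<Longrightarrow> \<bar>f y - f z\<bar> \<le> K * dist y z"
    using assms unfolding loc_lipschitz_at_def by blast
  have "(\<lambda>y. f y - f x) \<midarrow>x\<rightarrow> 0"
  proof (rule Lim_null_comparison)
    show "\<forall>\<^sub>F y in at x. norm (f y - f x) \<le> K * dist y x"
      using d K by (auto simp: eventually_at dist_commute intro!: exI[of _ d])
    have "((\<lambda>y. K * dist y x) \<longlongrightarrow> K * dist x x) (at x)" by (intro tendsto_intros)
    then show "((\<lambda>y. K * dist y x) \<longlongrightarrow> 0) (at x)" by simp
  qed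
  then show ?thesis by (simp add: isCont_def LIM_zero_iff)
qed

text \<open>The chord inequality for the convex function \<open>\<rho>/2 \<bar>.\<bar>^2 - f\<close> is used at points \<open>x - t (y - x)\<close>
  beyond \<open>x\<close>, where the Frechet inequality bounds \<open>f\<close> from below.\<close>
lemma frechet_descent:
  fixes F :: "'b::real_inner \<Rightarrow> ereal"
  assumes conv: "convex_on (ball a d) (\<lambda>y. \<rho> / 2 * (norm y)\<^sup>2 - f y)" and "\<rho> > 0"
    and F: "\<And>z. z \<in> ball a d \<Longrightarrow> F z = ereal (f z)"
    and x: "x \<in> ball a d" and y: "y \<in> ball a d" and v: "v \<in> frechet_subdiff F x"
  shows "f y \<le> f x + inner v (y - x) + \<rho> / 2 * (norm (y - x))\<^sup>2"
proof (rule field_le_epsilon)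
  fix e :: real assume "e > 0"
  define n where "n = norm (y - x) + 1"
  have n: "n > 0" "norm (y - x) \<le> n" by (auto simp: n_def add_nonneg_pos)
  define e' where "e' = e / (2 * n)"
  have e': "e' > 0" using \<open>e > 0\<close> n by (simp add: e'_def)
  then obtain r where "r > 0" and r: "\<And>y. dist y x < r \<Longrightarrow>
      F y \<ge> F x + ereal (inner v (y - x) - e' * norm (y - x))"
    using v unfolding frechet_subdiff_def by blast
  obtain r' where r': "r' > 0" "ball x r' \<subseteq> ball a d"
    using openE[OF open_ball x] by blast
  \<comment> \<open>The first bound keeps the reflected point \<open>u\<close> in both
    neighbourhoods; the second leaves at most \<open>e / 2\<close> for the additional curvature
    term. The other half of \<open>e\<close> is spent on the Frechet error through
    \<open>e'\<close>.\<close>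
  define t where "t = min (min r r' / (2 * n)) (e / (\<rho> * n * n))"
  have t: "t > 0" using \<open>r > 0\<close> r' n e' \<open>e > 0\<close> \<open>\<rho> > 0\<close> by (simp add: t_def)
  have "t \<le> min r r' / (2 * n)" by (simp add: t_def)
  then have "t * n \<le> min r r' / 2" using n by (simp add: field_simps)
  then have tn: "t * n < r" "t * n < r'" using \<open>r > 0\<close> r' by linarith+
  have "t \<le> e / (\<rho> * n * n)" by (simp add: t_def)
  then have te: "\<rho> * t * (n * n) \<le> e" using n \<open>\<rho> > 0\<close> by (simp add: field_simps)
  define w where "w = y - x"
  have yw: "y = x + w" by (simp add: w_def)
  have nw: "norm w \<le> n" using n by (simp add: w_def)
  define u where "u = x - t *\<^sub>R w"
  have du: "dist u x = t * norm w" using t by (simp add: u_def dist_norm)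
  have "t * norm w \<le> t * n" using t nw by simp
  then have "dist u x < r" "u \<in> ball x r'"
    using tn du by (simp_all add: dist_commute[of x])
  with r'(2) have dur: "dist u x < r" "u \<in> ball a d" by blast+
  have "F x + ereal (inner v (u - x) - e' * norm (u - x)) \<le> F u" using r dur by blast
  then have fu: "f x - t * inner v w - e' * (t * norm w) \<le> f u"
    using F dur x t by (simp add: u_def)
  \<comment> \<open>Since \<open>u\<close> is \<open>x\<close> minus \<open>t\<close> times
    \<open>y - x\<close>, the point \<open>x\<close> divides the segment from \<open>u\<close> to
    \<open>y\<close> with weight \<open>t / (1 + t)\<close> on \<open>y\<close>.\<close>
  have xc: "x = (1 - t / (1 + t)) *\<^sub>R u + (t / (1 + t)) *\<^sub>R y"
  proof -
    have "(1 + t) *\<^sub>R x = u + t *\<^sub>R y" by (simp add: u_def w_def algebra_simps)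
    then have "x = (1 / (1 + t)) *\<^sub>R (u + t *\<^sub>R y)"
      using t by (simp add: divide_inverse) (metis add_pos_pos less_numeral_extra(1)
        less_numeral_extra(3) scaleR_one scaleR_scaleR left_inverse)
    moreover have "1 - t / (1 + t) = 1 / (1 + t)" using t by (simp add: field_simps)
    ultimately show ?thesis by (simp add: scaleR_add_right)
  qed
  define \<psi> where "\<psi> = (\<lambda>y. \<rho> / 2 * (norm y)\<^sup>2 - f y)"
  have "\<psi> x \<le> (1 - t / (1 + t)) * \<psi> u + t / (1 + t) * \<psi> y"
    using convex_onD[OF conv, of "t / (1 + t)" u y] t dur y xc[symmetric] by (simp add: \<psi>_def)
  then have "(1 + t) * \<psi> x \<le> (1 + t) * ((1 - t / (1 + t)) * \<psi> u + t / (1 + t) * \<psi> y)"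
    using t by simp
  also have "\<dots> = ((1 + t) * (1 - t / (1 + t))) * \<psi> u + ((1 + t) * (t / (1 + t))) * \<psi> y"
    by (simp only: distrib_left mult.assoc)
  also have "(1 + t) * (1 - t / (1 + t)) = 1" using t by (simp add: field_simps)
  also have "(1 + t) * (t / (1 + t)) = t" using t by simp
  finally have psi: "(1 + t) * \<psi> x \<le> \<psi> u + t * \<psi> y" by simp
  have sq: "t * (norm y)\<^sup>2 + (norm u)\<^sup>2 - (1 + t) * (norm x)\<^sup>2 = t * ((1 + t) * (norm w)\<^sup>2)"
    unfolding u_def yw power2_norm_eq_inner
    by (simp add: inner_diff_left inner_diff_right inner_add_left inner_add_right inner_commute algebra_simps)
  have "t * (f y - f x) \<le> \<rho> / 2 * (t * (norm y)\<^sup>2 + (norm u)\<^sup>2 - (1 + t) * (norm x)\<^sup>2)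
      + t * inner v w + e' * (t * norm w)"
    using psi fu by (simp add: \<psi>_def algebra_simps add_divide_distrib)
  also have "\<dots> = t * (\<rho> / 2 * ((1 + t) * (norm w)\<^sup>2) + inner v w + e' * norm w)"
    unfolding sq by (simp add: algebra_simps)
  finally have "f y - f x \<le> \<rho> / 2 * ((1 + t) * (norm w)\<^sup>2) + inner v w + e' * norm w"
    using t by simp
  moreover have "\<rho> * t * (norm w)\<^sup>2 \<le> e"
  proof -
    have "(norm w)\<^sup>2 \<le> n * n" using nw n by (simp add: power2_eq_square mult_mono)
    then have "\<rho> * t * (norm w)\<^sup>2 \<le> \<rho> * t * (n * n)" using t \<open>\<rho> > 0\<close> by simp
    with te show ?thesis by simp
  qed
  moreover have "e' * norm w \<le> e / 2"
  proof -
    have "e' * norm w \<le> e' * n" using nw e' by simp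
    also have "\<dots> = e / 2" using n by (simp add: e'_def)
    finally show ?thesis .
  qed
  ultimately show "f y \<le> f x + inner v (y - x) + \<rho> / 2 * (norm (y - x))\<^sup>2 + e"
    unfolding w_def by (simp add: algebra_simps)
qed

text \<open>A step from \<open>x\<close> along \<open>v\<close> itself makes the Frechet inequality
  demand growth at rate almost \<open>norm v\<close>, and the Lipschitz estimate caps that
  rate.\<close>

lemma frechet_lipschitz_bound:
  fixes F :: "'b::real_inner \<Rightarrow> ereal"
  assumes lip: "\<And>y z. y \<in> ball a d \<Longrightarrow> z \<in> ball a d \<Longrightarrow> \<bar>f y - f z\<bar> \<le> K * dist y z"
    and F: "\<And>z. z \<in> ball a d \<Longrightarrow> F z = ereal (f z)"
    and x: "x \<in> ball a d" and v: "v \<in> frechet_subdiff F x" and "K \<ge> 0"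
  shows "norm v \<le> K"
proof (rule field_le_epsilon)
  fix e :: real assume "e > 0"
  then obtain r where "r > 0" and r: "\<And>y. dist y x < r \<Longrightarrow>
      F y \<ge> F x + ereal (inner v (y - x) - e * norm (y - x))"
    using v unfolding frechet_subdiff_def by blast
  obtain r' where r': "r' > 0" "ball x r' \<subseteq> ball a d"
    using openE[OF open_ball x] by blast
  define t where "t = min r r' / (2 * (norm v + 1))"
  have t: "t > 0" using \<open>r > 0\<close> r' by (simp add: t_def add_nonneg_pos)
  have "t * (norm v + 1) = min r r' / 2"
    unfolding t_def by (simp add: field_simps add_nonneg_eq_0_iff)
  then have tn: "t * norm v < r" "t * norm v < r'"
    using \<open>r > 0\<close> r' t by (auto simp: algebra_simps)
  define y where "y = x + t *\<^sub>R v"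
  have dy: "dist y x = t * norm v" using t by (simp add: y_def dist_norm)
  then have "dist y x < r" "y \<in> ball x r'"
    using tn by (simp_all add: dist_commute[of x])
  with r'(2) have yb: "y \<in> ball a d" "dist y x < r" by blast+
  have "F x + ereal (inner v (y - x) - e * norm (y - x)) \<le> F y" using r yb by blast
  then have "t * (norm v)\<^sup>2 - e * (t * norm v) \<le> f y - f x"
    using F[OF x] F[OF yb(1)] t by (simp add: y_def power2_norm_eq_inner)
  also have "\<dots> \<le> K * (t * norm v)" using lip[OF yb(1) x] by (simp add: dy)
  finally have "t * (norm v * norm v) \<le> t * ((K + e) * norm v)"
    by (simp add: algebra_simps power2_eq_square)
  then have "norm v * norm v \<le> (K + e) * norm v" using t by simp
  then show "norm v \<le> K + e"
    using \<open>K \<ge> 0\<close> \<open>e > 0\<close> by (cases "norm v = 0") auto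
qed

section \<open>Cluster points of bounded sequences\<close>

lemma cluster_points_closure:
  fixes s :: "nat \<Rightarrow> 'b::metric_space"
  assumes "\<And>n. p \<in> closure (s ` {n..})"
  shows "p \<in> cluster_points s"
proof -
  have ex: "\<exists>k\<ge>n. dist (s k) p < e" if "e > 0" for n e
    using assms[of n] that unfolding closure_approachable by (auto simp: dist_commute)
  have "\<exists>f. \<forall>n. dist (s (f n)) p < 1 / Suc n \<and> f n < f (Suc n)"
  proof (rule dependent_nat_choice)
    show "\<exists>x. dist (s x) p < 1 / real (Suc 0)" using ex[of 1 0] by auto
    show "\<exists>y. dist (s y) p < 1 / real (Suc (Suc n)) \<and> x < y" for x n
      using ex[of "1 / real (Suc (Suc n))" "Suc x"] by (auto simp: Suc_le_eq)
  qed
  then obtain f where f: "\<And>n. dist (s (f n)) p < 1 / Suc n" "\<And>n. f n < f (Suc n)" by blast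
  have "(s \<circ> f) \<longlonglongrightarrow> p"
  proof (rule metric_LIMSEQ_I)
    fix r :: real assume "r > 0"
    then obtain N where N: "1 / Suc N < r" using nat_approx_posE by blast
    have "dist ((s \<circ> f) n) p < r" if "n \<ge> N" for n
    proof -
      have "dist (s (f n)) p < 1 / Suc n" by (rule f)
      also have "1 / real (Suc n) \<le> 1 / real (Suc N)" using that by (simp add: frac_le)
      finally show ?thesis using N by simp
    qed
    then show "\<exists>N. \<forall>n\<ge>N. dist ((s \<circ> f) n) p < r" by blast
  qed
  moreover have "strict_mono f" using f(2) by (simp add: strict_mono_Suc_iff)
  ultimately show ?thesis unfolding cluster_points_def by blast
qed

text \<open>If the closures of all tails stuck out of the cover, the parts outside would be nested
  nonempty compact sets, and a common point would be an uncovered cluster point. This reduces data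
  given at each cluster point (BMP constants, KL gauges) to finitely many.\<close>

lemma cluster_points_finite_cover:
  fixes s :: "nat \<Rightarrow> 'b::{real_normed_vector, heine_borel}"
  assumes bdd: "bounded (range s)"
    and U: "\<And>p. p \<in> cluster_points s \<Longrightarrow> open (U p) \<and> p \<in> U p"
  obtains I N where "finite I" "I \<subseteq> cluster_points s" "\<And>k. k \<ge> N \<Longrightarrow> \<exists>p\<in>I. s k \<in> U p"
proof -
  let ?W = "\<Union>p\<in>cluster_points s. U p"
  have oW: "open ?W" using U by blast
  have cmp: "compact (closure (s ` {n..}))" for n
    using bdd by (intro compact_closure[THEN iffD2]) (rule bounded_subset, auto)
  have "\<exists>n. closure (s ` {n..}) \<subseteq> ?W"
  proof (rule ccontr)
    assume neg: "\<not> ?thesis"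
    have "\<Inter>(range (\<lambda>n. closure (s ` {n..}) - ?W)) \<noteq> {}"
    proof (rule compact_nest)
      show "compact (closure (s ` {n..}) - ?W)" for n using cmp oW by (rule compact_diff)
      show "closure (s ` {n..}) - ?W \<noteq> {}" for n using neg by blast
      show "closure (s ` {n..}) - ?W \<subseteq> closure (s ` {m..}) - ?W" if "m \<le> n" for m n
        using that by (intro Diff_mono closure_mono image_mono) auto
    qed
    then obtain p where p: "\<And>n. p \<in> closure (s ` {n..})" "p \<notin> ?W" by auto
    then have "p \<in> cluster_points s" by (intro cluster_points_closure)
    with U p(2) show False by blast
  qed
  then obtain N where N: "closure (s ` {N..}) \<subseteq> ?W" by blast
  then obtain I where I: "I \<subseteq> cluster_points s" "finite I" "closure (s ` {N..}) \<subseteq> (\<Union>p\<in>I. U p)"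
    using compactE_image[OF cmp[of N], of "cluster_points s" U] U by metis
  show ?thesis
  proof (rule that[OF I(2,1)])
    fix k assume "k \<ge> N"
    then have "s k \<in> closure (s ` {N..})" using closure_subset by fastforce
    then show "\<exists>p\<in>I. s k \<in> U p" using I(3) by blast
  qed
qed

section \<open>Separation, subgradients and conjugates\<close>

lemma convex_sum_rule:
  fixes \<phi> :: "'a::euclidean_space \<Rightarrow> real"
  assumes \<phi>: "convex_on UNIV \<phi>" and C: "convex C" and xC: "x \<in> C"
    and min: "\<And>z. z \<in> C \<Longrightarrow> \<phi> x + inner a (z - x) \<le> \<phi> z"
  obtains v where "\<And>z. \<phi> x + inner v (z - x) \<le> \<phi> z" "\<And>z. z \<in> C \<Longrightarrow> inner (a - v) (z - x) \<le> 0"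
proof -
  \<comment> \<open>\<open>S\<close> is the hypograph over \<open>C\<close> of the affine minorant,
    \<open>T\<close> the strict epigraph of \<open>\<phi>\<close>; \<open>min\<close> says exactly
    that they do not meet. The slope of a separating hyperplane will be the desired
    subgradient.\<close>
  define S T where "S = {p. fst p \<in> C \<and> snd p \<le> \<phi> x + inner a (fst p - x)}"
    and "T = {p. \<phi> (fst p) < snd p}"
  have "convex S"
    unfolding S_def
  proof (rule convexI)
    fix p q :: "'a \<times> real" and u w :: real
    assume p: "p \<in> {p. fst p \<in> C \<and> snd p \<le> \<phi> x + inner a (fst p - x)}"
      and q: "q \<in> {p. fst p \<in> C \<and> snd p \<le> \<phi> x + inner a (fst p - x)}"
      and uw: "0 \<le> u" "0 \<le> w" "u + w = 1"
    have "u * snd p + w * snd q \<le> u * (\<phi> x + inner a (fst p - x)) + w * (\<phi> x + inner a (fst q - x))"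
      using p q uw by (intro add_mono mult_left_mono) auto
    also have "\<dots> = (u + w) * (\<phi> x - inner a x) + inner a (u *\<^sub>R fst p + w *\<^sub>R fst q)"
      by (simp add: algebra_simps inner_diff_right inner_add_right)
    also have "\<dots> = \<phi> x + inner a (u *\<^sub>R fst p + w *\<^sub>R fst q - x)"
      using uw by (simp add: inner_diff_right)
    finally show "u *\<^sub>R p + w *\<^sub>R q \<in> {p. fst p \<in> C \<and> snd p \<le> \<phi> x + inner a (fst p - x)}"
      using convexD[OF C, of "fst p" "fst q" u w] p q uw by simp
  qed
  moreover have "convex T"
    unfolding T_def
  proof (rule convexI)
    fix p q :: "'a \<times> real" and u w :: real
    assume p: "p \<in> {p. \<phi> (fst p) < snd p}" and q: "q \<in> {p. \<phi> (fst p) < snd p}"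
      and uw: "0 \<le> u" "0 \<le> w" "u + w = 1"
    have u: "u = 1 - w" using uw by simp
    have "\<phi> (u *\<^sub>R fst p + w *\<^sub>R fst q) \<le> u * \<phi> (fst p) + w * \<phi> (fst q)"
      using convex_onD[OF \<phi>, of w "fst p" "fst q"] uw by (simp add: u)
    also have "\<dots> < u * snd p + w * snd q"
    proof (cases "w = 0")
      case True then show ?thesis using p uw by simp
    next
      case False
      then have "w * \<phi> (fst q) < w * snd q" using q uw by simp
      moreover have "u * \<phi> (fst p) \<le> u * snd p" using p uw by (intro mult_left_mono) auto
      ultimately show ?thesis by simp
    qed
    finally show "u *\<^sub>R p + w *\<^sub>R q \<in> {p. \<phi> (fst p) < snd p}" by simp
  qed
  moreover have "(x, \<phi> x) \<in> S" "(x, \<phi> x + 1) \<in> T" using xC by (auto simp: S_def T_def)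
  moreover have "S \<inter> T = {}" using min by (force simp: S_def T_def)
  ultimately obtain c b where c: "c \<noteq> 0" "\<And>p. p \<in> S \<Longrightarrow> inner c p \<le> b" "\<And>p. p \<in> T \<Longrightarrow> inner c p \<ge> b"
    using separating_hyperplane_sets[of S T] by (metis empty_iff)
  obtain u \<gamma> where ug: "c = (u, \<gamma>)" by (cases c)
  have S: "inner u z + \<gamma> * t \<le> b" if "z \<in> C" "t \<le> \<phi> x + inner a (z - x)" for z t
    using c(2)[of "(z, t)"] that by (simp add: S_def ug)
  have T: "inner u z + \<gamma> * t \<ge> b" if "\<phi> z < t" for z t
    using c(3)[of "(z, t)"] that by (simp add: T_def ug)
  have Sx: "inner u x + \<gamma> * \<phi> x \<le> b" using S[OF xC, of "\<phi> x"] by simp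
  have "\<gamma> \<ge> 0" using T[of x "\<phi> x + 1"] Sx by (simp add: algebra_simps)
  \<comment> \<open>The hyperplane cannot be vertical: \<open>\<phi>\<close> is finite everywhere,
    so \<open>T\<close> lies over the whole space and even over \<open>x - u\<close>. This takes the
    place of a qualification condition.\<close>
  moreover have "\<gamma> \<noteq> 0"
  proof
    assume g: "\<gamma> = 0"
    have "inner u (x - u) \<ge> b" using T[of "x - u" "\<phi> (x - u) + 1"] g by simp
    then have "inner u u \<le> 0" using Sx g by (simp add: inner_diff_right)
    then have "u = 0" using inner_eq_zero_iff[of u] inner_ge_zero[of u] by linarith
    with c(1) ug g show False by (simp add: zero_prod_def)
  qed
  ultimately have g: "\<gamma> > 0" by simp
  have T': "inner u z + \<gamma> * \<phi> z \<ge> b" for z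
  proof (rule field_le_epsilon)
    fix e :: real assume "e > 0"
    then show "b \<le> inner u z + \<gamma> * \<phi> z + e"
      using T[of z "\<phi> z + e / \<gamma>"] g by (simp add: algebra_simps)
  qed
  define v where "v = (- 1 / \<gamma>) *\<^sub>R u"
  have vz: "\<gamma> * inner v z = - inner u z" for z using g by (simp add: v_def)
  show ?thesis
  proof (rule that[of v])
    fix z
    have "\<gamma> * (\<phi> x + inner v (z - x)) \<le> \<gamma> * \<phi> z"
      using T'[of z] Sx by (simp add: algebra_simps inner_diff_right vz)
    then show "\<phi> x + inner v (z - x) \<le> \<phi> z" using g by simp
  next
    fix z assume z: "z \<in> C"
    have "\<gamma> * inner (a - v) (z - x) \<le> \<gamma> * 0"
      using S[OF z order_refl] T'[of x] by (simp add: algebra_simps inner_diff_right inner_diff_left vz)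
    then show "inner (a - v) (z - x) \<le> 0" by (simp only: mult_le_cancel_left_pos[OF g])
  qed
qed

lemma convex_subgradient_exists:
  fixes \<phi> :: "'a::euclidean_space \<Rightarrow> real"
  assumes "convex_on UNIV \<phi>"
  obtains v where "\<And>z. \<phi> x + inner v (z - x) \<le> \<phi> z"
  using convex_sum_rule[OF assms, of "{x}" x 0] by auto

text \<open>Strong convexity makes \<open>h\<close> minus a linear function coercive, so the
  supremum is attained. The quadratic decay away from the maximizer \<open>p\<close> later converts
  a gap in function values into a distance to \<open>p\<close>.\<close>

lemma strongly_convex_fconj:
  fixes h :: "'a::euclidean_space \<Rightarrow> real"
  assumes "strongly_convex h"
  obtains \<sigma> where "\<sigma> > 0"
    "\<And>q. \<exists>p. fconj h q = ereal (inner q p - h p) \<and>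
        (\<forall>z. inner q z - h z + \<sigma> / 2 * (norm (z - p))\<^sup>2 \<le> inner q p - h p)"
proof -
  obtain \<sigma> where s: "\<sigma> > 0" and conv: "convex_on UNIV (\<lambda>x. h x - \<sigma> / 2 * (norm x)\<^sup>2)"
    using assms unfolding strongly_convex_def by blast
  obtain v where v: "\<And>z. h 0 - \<sigma> / 2 * (norm (0::'a))\<^sup>2 + inner v (z - 0) \<le> h z - \<sigma> / 2 * (norm z)\<^sup>2"
    using convex_subgradient_exists[OF conv, of 0] by blast
  have conth: "continuous_on A h" for A
  proof -
    have "continuous_on UNIV (\<lambda>x. (h x - \<sigma> / 2 * (norm x)\<^sup>2) + \<sigma> / 2 * (norm x)\<^sup>2)"
      by (intro continuous_intros convex_on_continuous conv) auto
    then show ?thesis using continuous_on_subset by fastforce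
  qed
  show ?thesis
  proof (rule that[OF s])
    fix q :: 'a
    define \<psi> where "\<psi> z = h z - inner q z" for z
    \<comment> \<open>Beyond this radius the quadratic term outweighs the linear term
      \<open>inner (q - v) z\<close>, where \<open>v\<close> supports the convex remainder of
      \<open>h\<close> at 0.\<close>
    define R where "R = 2 * norm (q - v) / \<sigma>"
    have R: "R \<ge> 0" using s by (simp add: R_def)
    have out: "\<psi> z \<ge> \<psi> 0" if "norm z > R" for z
    proof -
      have "inner (q - v) z \<le> norm (q - v) * norm z" by (rule norm_cauchy_schwarz)
      also have "\<dots> = \<sigma> / 2 * R * norm z" using s by (simp add: R_def)
      also have "\<dots> \<le> \<sigma> / 2 * norm z * norm z" using that s by (intro mult_right_mono mult_left_mono) auto
      finally have "inner q z - inner v z \<le> \<sigma> / 2 * (norm z)\<^sup>2"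
        by (simp add: inner_diff_left power2_eq_square)
      with v[of z] show ?thesis by (simp add: \<psi>_def)
    qed
    have "continuous_on (cball 0 R) \<psi>" unfolding \<psi>_def by (intro continuous_intros conth)
    then obtain p where p: "p \<in> cball 0 R" "\<And>z. z \<in> cball 0 R \<Longrightarrow> \<psi> p \<le> \<psi> z"
      using continuous_attains_inf[of "cball 0 R" \<psi>] R by auto
    have min: "\<psi> p \<le> \<psi> z" for z
    proof (cases "z \<in> cball 0 R")
      case False
      then have "\<psi> 0 \<le> \<psi> z" using out by simp
      moreover have "\<psi> p \<le> \<psi> 0" using p(2)[of 0] R by simp
      ultimately show ?thesis by simp
    qed (rule p)
    have quad: "inner q z - h z + \<sigma> / 2 * (norm (z - p))\<^sup>2 \<le> inner q p - h p" for z
    proof -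
      have chord: "\<sigma> / 2 * (1 - t) * (norm (z - p))\<^sup>2 \<le> \<psi> z - \<psi> p" if t: "0 < t" "t < 1" for t
      proof -
        let ?y = "(1 - t) *\<^sub>R p + t *\<^sub>R z"
        have "h ?y - \<sigma> / 2 * (norm ?y)\<^sup>2 \<le> (1 - t) * (h p - \<sigma> / 2 * (norm p)\<^sup>2) + t * (h z - \<sigma> / 2 * (norm z)\<^sup>2)"
          using convex_onD[OF conv, of t p z] t by simp
        moreover have "(1 - t) * (norm p)\<^sup>2 + t * (norm z)\<^sup>2 - (norm ?y)\<^sup>2 = t * ((1 - t) * (norm (z - p))\<^sup>2)"
          unfolding power2_norm_eq_inner
          by (simp add: inner_diff_left inner_diff_right inner_add_left inner_add_right inner_commute algebra_simps)
        then have "(1 - t) * (norm p)\<^sup>2 + t * (norm z)\<^sup>2 = (norm ?y)\<^sup>2 + t * ((1 - t) * (norm (z - p))\<^sup>2)"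
          by linarith
        then have "\<sigma> / 2 * ((1 - t) * (norm p)\<^sup>2 + t * (norm z)\<^sup>2) =
            \<sigma> / 2 * (norm ?y)\<^sup>2 + \<sigma> / 2 * (t * ((1 - t) * (norm (z - p))\<^sup>2))"
          by (simp only: distrib_left)
        moreover have "(1 - t) * (h p - \<sigma> / 2 * (norm p)\<^sup>2) + t * (h z - \<sigma> / 2 * (norm z)\<^sup>2)
            = (1 - t) * h p + t * h z - \<sigma> / 2 * ((1 - t) * (norm p)\<^sup>2 + t * (norm z)\<^sup>2)"
          by (simp add: field_simps)
        ultimately have "h ?y \<le> (1 - t) * h p + t * h z - \<sigma> / 2 * (t * ((1 - t) * (norm (z - p))\<^sup>2))"
          by linarith
        then have "\<psi> ?y \<le> (1 - t) * \<psi> p + t * \<psi> z - \<sigma> / 2 * (t * ((1 - t) * (norm (z - p))\<^sup>2))"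
          by (simp add: \<psi>_def algebra_simps inner_add_right)
        with min[of ?y] have "t * (\<sigma> / 2 * (1 - t) * (norm (z - p))\<^sup>2) \<le> t * (\<psi> z - \<psi> p)"
          by (simp add: field_simps)
        then show ?thesis using t by simp
      qed
      have "((\<lambda>t. \<sigma> / 2 * (1 - t) * (norm (z - p))\<^sup>2) \<longlongrightarrow> \<sigma> / 2 * (1 - 0) * (norm (z - p))\<^sup>2) (at_right 0)"
        by (intro tendsto_intros)
      moreover have "\<forall>\<^sub>F t in at_right 0. \<sigma> / 2 * (1 - t) * (norm (z - p))\<^sup>2 \<le> \<psi> z - \<psi> p"
        using eventually_at_right_real[OF zero_less_one]
        by eventually_elim (use chord in auto)
      ultimately have "\<sigma> / 2 * (1 - 0) * (norm (z - p))\<^sup>2 \<le> \<psi> z - \<psi> p"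
        by (rule tendsto_upperbound) auto
      then show ?thesis by (simp add: \<psi>_def)
    qed
    have "fconj h q = ereal (inner q p - h p)"
      unfolding fconj_def
    proof (rule antisym)
      have "inner q z - h z \<le> inner q p - h p" for z using min[of z] by (simp add: \<psi>_def)
      then show "(SUP z. ereal (inner q z - h z)) \<le> ereal (inner q p - h p)"
        by (intro SUP_least) simp
    qed (rule SUP_upper, simp)
    with quad show "\<exists>p. fconj h q = ereal (inner q p - h p) \<and>
        (\<forall>z. inner q z - h z + \<sigma> / 2 * (norm (z - p))\<^sup>2 \<le> inner q p - h p)" by blast
  qed
qed

lemma fconj_ge: "ereal (inner q z - h z) \<le> fconj h q"
  unfolding fconj_def by (rule SUP_upper) simp

text \<open>\<open>grad\<close> is a choice among representing vectors, so it is identified through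
  uniqueness of the derivative; self-adjointness merges the two terms of the product rule.\<close>

lemma strongly_convex_quadratic_grad:
  fixes f :: "'a::euclidean_space \<Rightarrow> real"
  assumes "strongly_convex_quadratic f"
  obtains A b c where "self_adjoint A" "\<And>s. grad f s = blinfun_apply A s + b"
    "\<And>s. f s = inner s (blinfun_apply A s) / 2 + inner b s + c"
proof -
  obtain A b c where A: "self_adjoint A"
    and f: "\<And>s. f s = inner s (blinfun_apply A s) / 2 + inner b s + c"
    using assms unfolding strongly_convex_quadratic_def by blast
  have "grad f s = blinfun_apply A s + b" for s
  proof -
    have sa: "inner s (blinfun_apply A d) = inner (blinfun_apply A s) d" for d
      using A by (simp add: self_adjoint_def)
    have der: "(f has_derivative (\<lambda>d. inner (blinfun_apply A s + b) d)) (at s)"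
    proof -
      have "((\<lambda>s. inner s (blinfun_apply A s) / 2 + inner b s + c) has_derivative
          (\<lambda>d. (inner s (blinfun_apply A d) + inner d (blinfun_apply A s)) / 2 + inner b d)) (at s)"
        by (auto intro!: derivative_eq_intros)
      moreover have "inner d (blinfun_apply A s) = inner (blinfun_apply A s) d" for d
        by (rule inner_commute)
      moreover have "f = (\<lambda>s. inner s (blinfun_apply A s) / 2 + inner b s + c)"
        by (rule ext) (rule f)
      ultimately show ?thesis by (simp add: sa inner_add_left)
    qed
    then have "(f has_derivative (\<lambda>d. inner (grad f s) d)) (at s)"
      unfolding grad_def by (rule someI)
    from has_derivative_unique[OF this der]
    have "inner (grad f s - (blinfun_apply A s + b)) d = 0" for d
      by (metis inner_diff_left eq_iff_diff_eq_0)
    from this[of "grad f s - (blinfun_apply A s + b)"] show ?thesis by simp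
  qed
  with A f show ?thesis using that by blast
qed

text \<open>Polarization: let \<open>e\<close> be the multiple of \<open>Q d\<close> with the length
  of \<open>d\<close>. Four times the pairing of \<open>e\<close> with \<open>Q d\<close> is the
  quadratic form at \<open>d + e\<close> minus a nonnegative value, and \<open>d + e\<close> has
  norm at most \<open>2 * norm d\<close>.\<close>

lemma self_adjoint_norm_bound:
  fixes Q :: "'a::euclidean_space \<Rightarrow>\<^sub>L 'a"
  assumes sa: "self_adjoint Q" and nn: "\<And>d. 0 \<le> inner d (blinfun_apply Q d)"
    and ub: "\<And>d. inner d (blinfun_apply Q d) \<le> c * (norm d)\<^sup>2"
  shows "norm (blinfun_apply Q d) \<le> c * norm d"
proof (cases "blinfun_apply Q d = 0 \<or> d = 0")
  case True
  have "0 \<le> c * (norm d)\<^sup>2" using nn ub order_trans by blast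
  then have "0 \<le> c * norm d"
    by (cases "d = 0") (simp_all add: zero_le_mult_iff)
  with True show ?thesis by auto
next
  case False
  define e where "e = (norm d / norm (blinfun_apply Q d)) *\<^sub>R blinfun_apply Q d"
  have e: "norm e = norm d" using False by (simp add: e_def)
  have "4 * inner e (blinfun_apply Q d) = inner (d + e) (blinfun_apply Q (d + e)) - inner (d - e) (blinfun_apply Q (d - e))"
    using sa unfolding self_adjoint_def
    by (simp add: blinfun.add_right blinfun.diff_right inner_diff_left inner_diff_right inner_add_left inner_add_right inner_commute)
  also have "\<dots> \<le> c * (norm (d + e))\<^sup>2" using ub[of "d + e"] nn[of "d - e"] by simp
  also have "\<dots> \<le> c * (2 * norm d)\<^sup>2"
  proof (rule mult_left_mono)
    show "(norm (d + e))\<^sup>2 \<le> (2 * norm d)\<^sup>2"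
      using norm_triangle_ineq[of d e] e by (intro power_mono) auto
    have "0 \<le> c * (norm d)\<^sup>2" using nn ub order_trans by blast
    then show "c \<ge> 0" using False by (simp add: zero_le_mult_iff)
  qed
  finally have "inner e (blinfun_apply Q d) \<le> c * (norm d)\<^sup>2" by (simp add: power2_eq_square)
  moreover have "inner e (blinfun_apply Q d) = norm d * norm (blinfun_apply Q d)"
    using False by (simp add: e_def power2_norm_eq_inner[symmetric] power2_eq_square)
  ultimately have "norm d * norm (blinfun_apply Q d) \<le> norm d * (c * norm d)"
    by (simp add: power2_eq_square algebra_simps)
  then show ?thesis using False by simp
qed

text \<open>The recursion says that \<open>e k + \<psi> k\<close> drops by at least
  \<open>e k / 2\<close> at each step, and this sum stays nonnegative.\<close>

lemma summable_of_halving_telescope: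
  fixes e \<psi> :: "nat \<Rightarrow> real"
  assumes e: "\<And>k. e k \<ge> 0" and \<psi>: "\<And>k. k \<ge> K \<Longrightarrow> \<psi> k \<ge> 0"
    and rec: "\<And>k. k \<ge> K \<Longrightarrow> e (Suc k) \<le> e k / 2 + (\<psi> k - \<psi> (Suc k))"
  shows "summable e"
proof -
  define a where "a k = e (k + K) + \<psi> (k + K)" for k
  have a0: "a k \<ge> 0" for k using e \<psi> by (simp add: a_def)
  have step: "e (k + K) / 2 \<le> a k - a (Suc k)" for k
    using rec[of "k + K"] by (simp add: a_def)
  have "(\<Sum>k<n. e (k + K)) \<le> 2 * a 0" for n
  proof -
    have "(\<Sum>k<n. e (k + K) / 2) \<le> (\<Sum>k<n. a k - a (Suc k))" by (intro sum_mono step)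
    also have "\<dots> = a 0 - a n" by (rule sum_lessThan_telescope')
    finally show ?thesis using a0[of n] by (simp add: sum_divide_distrib[symmetric])
  qed
  then have "summable (\<lambda>k. e (k + K))"
    using e by (intro summableI_nonneg_bounded)
  then show ?thesis by (simp add: summable_iff_shift)
qed

section \<open>Descent inequalities for upper-C2 functions\<close>

lemma limiting_subdiff_norm_le:
  fixes F :: "'b::real_inner \<Rightarrow> ereal"
  assumes lip: "\<And>y z. y \<in> ball a d \<Longrightarrow> z \<in> ball a d \<Longrightarrow> \<bar>f y - f z\<bar> \<le> K * dist y z"
    and F: "\<And>z. z \<in> ball a d \<Longrightarrow> F z = ereal (f z)"
    and x: "x \<in> ball a d" and v: "v \<in> limiting_subdiff F x" and K: "K \<ge> 0"
  shows "norm v \<le> K"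
proof -
  obtain xs vs where xs: "xs \<longlonglongrightarrow> x" and fr: "\<And>k. vs k \<in> frechet_subdiff F (xs k)" and vs: "vs \<longlonglongrightarrow> v"
    using v unfolding limiting_subdiff_def mem_Collect_eq by metis
  have "\<forall>\<^sub>F k in sequentially. xs k \<in> ball a d"
    using xs x by (rule topological_tendstoD[OF _ open_ball])
  then have "\<forall>\<^sub>F k in sequentially. norm (vs k) \<le> K"
    by eventually_elim (rule frechet_lipschitz_bound[OF lip F _ fr K])
  then show ?thesis
    by (rule tendsto_upperbound[OF tendsto_norm[OF vs]]) simp
qed

lemma limiting_subdiff_descent:
  fixes F :: "'b::real_inner \<Rightarrow> ereal"
  assumes conv: "convex_on (ball a d) (\<lambda>y. \<rho> / 2 * (norm y)\<^sup>2 - f y)" and \<rho>: "\<rho> > 0"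
    and F: "\<And>z. z \<in> ball a d \<Longrightarrow> F z = ereal (f z)"
    and x: "x \<in> ball a d" and y: "y \<in> ball a d" and v: "v \<in> limiting_subdiff F x"
  shows "f y \<le> f x + inner v (y - x) + \<rho> / 2 * (norm (y - x))\<^sup>2"
proof -
  obtain xs vs where xs: "xs \<longlonglongrightarrow> x" and Fx: "(\<lambda>k. F (xs k)) \<longlonglongrightarrow> F x"
    and fr: "\<And>k. vs k \<in> frechet_subdiff F (xs k)" and vs: "vs \<longlonglongrightarrow> v"
    using v unfolding limiting_subdiff_def mem_Collect_eq by metis
  have ev: "\<forall>\<^sub>F k in sequentially. xs k \<in> ball a d"
    using xs x by (rule topological_tendstoD[OF _ open_ball])
  then have "\<forall>\<^sub>F k in sequentially. F (xs k) = ereal (f (xs k))"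
    by eventually_elim (rule F)
  with Fx have "(\<lambda>k. ereal (f (xs k))) \<longlonglongrightarrow> ereal (f x)"
    unfolding F[OF x] by (rule Lim_transform_eventually)
  then have fx: "(\<lambda>k. f (xs k)) \<longlonglongrightarrow> f x" by simp
  have "\<forall>\<^sub>F k in sequentially. f y \<le> f (xs k) + inner (vs k) (y - xs k) + \<rho> / 2 * (norm (y - xs k))\<^sup>2"
    using ev by eventually_elim (rule frechet_descent[OF conv \<rho> F _ y fr])
  moreover have "(\<lambda>k. f (xs k) + inner (vs k) (y - xs k) + \<rho> / 2 * (norm (y - xs k))\<^sup>2)
      \<longlonglongrightarrow> f x + inner v (y - x) + \<rho> / 2 * (norm (y - x))\<^sup>2"
    by (intro tendsto_intros fx vs xs)
  ultimately show ?thesis by (intro tendsto_lowerbound) auto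
qed

text \<open>Far from \<open>z\<close> the quadratic term absorbs the boundedness of \<open>f\<close> on the compact set, so \<open>C\<close> need not be convex.\<close>
lemma upper_C2_uniform_descent:
  fixes F :: "'b::euclidean_space \<Rightarrow> ereal"
  assumes C: "compact C" and U: "open U" "C \<subseteq> U" and F: "\<And>z. z \<in> U \<Longrightarrow> F z = ereal (f z)"
    and lip: "\<And>z. z \<in> C \<Longrightarrow> loc_lipschitz_at f z" and uC2: "\<And>z. z \<in> C \<Longrightarrow> upper_C2_at f z"
  obtains K where "K \<ge> 0" "\<And>z v. z \<in> C \<Longrightarrow> v \<in> limiting_subdiff F z \<Longrightarrow> norm v \<le> K"
    "\<And>z v y. z \<in> C \<Longrightarrow> v \<in> limiting_subdiff F z \<Longrightarrow> y \<in> C \<Longrightarrow>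
      f y \<le> f z + inner v (y - z) + K * (norm (y - z))\<^sup>2"
proof -
  have "continuous_on C f"
    using lip by (auto intro!: continuous_at_imp_continuous_on loc_lipschitz_isCont)
  then have "bounded (f ` C)" using C by (intro compact_imp_bounded compact_continuous_image)
  then obtain B where B: "\<And>z. z \<in> C \<Longrightarrow> \<bar>f z\<bar> \<le> B" unfolding bounded_iff by auto
  define P where "P z K \<longleftrightarrow> (\<forall>v\<in>limiting_subdiff F z. norm v \<le> K \<and>
      (\<forall>y\<in>C. f y \<le> f z + inner v (y - z) + K * (norm (y - z))\<^sup>2))" for z K
  have "\<exists>K\<ge>0. \<forall>z\<in>C. P z K"
  proof (rule compact_uniform_bound[OF C])
    fix z and K K' :: real
    assume "P z K" "K \<le> K'"
    then show "P z K'" unfolding P_def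
      by (meson add_left_mono mult_right_mono order_trans zero_le_power2)
  next
    fix a assume a: "a \<in> C"
    obtain d1 K1 where d1: "d1 > 0" and K1: "\<And>y z. y \<in> ball a d1 \<Longrightarrow> z \<in> ball a d1 \<Longrightarrow> \<bar>f y - f z\<bar> \<le> K1 * dist y z"
      using lip[OF a] unfolding loc_lipschitz_at_def by blast
    obtain \<rho> d2 where d2: "d2 > 0" and \<rho>: "\<rho> > 0" and cv: "convex_on (ball a d2) (\<lambda>y. \<rho> / 2 * (norm y)\<^sup>2 - f y)"
      using uC2[OF a] unfolding upper_C2_at_def by blast
    obtain d3 where d3: "d3 > 0" "ball a d3 \<subseteq> U" using U a by (meson openE subsetD)
    define d where "d = min d1 (min d2 d3)"
    have d: "d > 0" using d1 d2 d3 by (simp add: d_def)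
    have sub: "ball a d \<subseteq> ball a d1" "ball a d \<subseteq> ball a d2" "ball a d \<subseteq> ball a d3"
      by (auto simp: d_def)
    have lip': "\<bar>f y - f z\<bar> \<le> \<bar>K1\<bar> * dist y z" if "y \<in> ball a d" "z \<in> ball a d" for y z
      using K1[of y z] that sub(1) mult_right_mono[OF abs_ge_self[of K1] zero_le_dist[of y z]]
      by (meson order_trans subsetD)
    have cv': "convex_on (ball a d) (\<lambda>y. \<rho> / 2 * (norm y)\<^sup>2 - f y)"
      using cv sub(2) by (rule convex_on_subset) simp
    have F': "F z = ereal (f z)" if "z \<in> ball a d" for z using F that sub(3) d3(2) by blast
    define K where "K = max \<bar>K1\<bar> (max (\<rho> / 2) (2 * B / (d / 2)\<^sup>2 + \<bar>K1\<bar> / (d / 2)))"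
    have K: "\<bar>K1\<bar> \<le> K" "\<rho> / 2 \<le> K" "2 * B / (d / 2)\<^sup>2 + \<bar>K1\<bar> / (d / 2) \<le> K"
      by (simp_all only: K_def le_max_iff_disj order_refl simp_thms)
    \<comment> \<open>Half the radius for \<open>z\<close>, so that every \<open>y\<close> outside
      \<open>ball a d\<close> is at distance at least \<open>d / 2\<close> from \<open>z\<close>;
      the last entry of the maximum defining \<open>K\<close> is tuned to this distance.\<close>
    have "P z K" if z: "z \<in> C" "z \<in> ball a (d / 2)" for z
      unfolding P_def
    proof (intro ballI conjI)
      fix v assume v: "v \<in> limiting_subdiff F z"
      have zb: "z \<in> ball a d" using z d by auto
      have nv: "norm v \<le> \<bar>K1\<bar>" by (rule limiting_subdiff_norm_le[OF lip' F' zb v]) auto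
      then show "norm v \<le> K" using K(1) by simp
      fix y assume y: "y \<in> C"
      show "f y \<le> f z + inner v (y - z) + K * (norm (y - z))\<^sup>2"
      proof (cases "y \<in> ball a d")
        case True
        have "f y \<le> f z + inner v (y - z) + \<rho> / 2 * (norm (y - z))\<^sup>2"
          by (rule limiting_subdiff_descent[OF cv' \<rho> F' zb True v])
        also have "\<rho> / 2 * (norm (y - z))\<^sup>2 \<le> K * (norm (y - z))\<^sup>2"
          by (intro mult_right_mono K) simp
        finally show ?thesis by simp
      next
        case False
        define n where "n = norm (y - z)"
        have "dist a y \<le> dist a z + dist z y" by (rule dist_triangle)
        then have n: "n \<ge> d / 2" using False z by (simp add: n_def dist_norm norm_minus_commute)
        have "0 \<le> B" using B[OF y] by simp
        have "f y - f z - inner v (y - z) \<le> 2 * B + \<bar>K1\<bar> * n"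
        proof -
          have "- inner v (y - z) \<le> norm v * n" unfolding n_def
            using Cauchy_Schwarz_ineq2[of v "y - z"] by simp
          also have "\<dots> \<le> \<bar>K1\<bar> * n" using nv by (intro mult_right_mono) (auto simp: n_def)
          finally show ?thesis using B[OF y] B[OF z(1)] by linarith
        qed
        also have "2 * B \<le> 2 * B / (d / 2)\<^sup>2 * n\<^sup>2"
        proof -
          have "(d / 2)\<^sup>2 \<le> n\<^sup>2" using n d by (intro power_mono) auto
          then have "2 * B / (d / 2)\<^sup>2 * (d / 2)\<^sup>2 \<le> 2 * B / (d / 2)\<^sup>2 * n\<^sup>2"
            using \<open>0 \<le> B\<close> by (intro mult_left_mono) auto
          then show ?thesis using d by simp
        qed
        also have "\<bar>K1\<bar> * n \<le> \<bar>K1\<bar> / (d / 2) * n\<^sup>2"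
        proof -
          have "(\<bar>K1\<bar> / (d / 2) * n) * (d / 2) \<le> (\<bar>K1\<bar> / (d / 2) * n) * n"
            using n d by (intro mult_left_mono) auto
          then show ?thesis using d by (simp add: power2_eq_square mult.assoc)
        qed
        also have "2 * B / (d / 2)\<^sup>2 * n\<^sup>2 + \<bar>K1\<bar> / (d / 2) * n\<^sup>2 \<le> K * n\<^sup>2"
          unfolding distrib_right[symmetric] by (intro mult_right_mono K) simp
        finally show ?thesis by (simp add: n_def)
      qed
    qed
    then show "\<exists>d>0. \<exists>K. \<forall>z\<in>C \<inter> ball a d. P z K"
      using d by (intro exI[of _ "d / 2"] exI[of _ K] conjI ballI) auto
  qed
  then show ?thesis using that unfolding P_def by blast
qed

lemma subgradient_norm_le:
  fixes \<phi> :: "'a::real_inner \<Rightarrow> real"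
  assumes sub: "\<And>z. \<phi> x + inner v (z - x) \<le> \<phi> z" and B: "\<And>z. norm (z - x) \<le> 1 \<Longrightarrow> \<bar>\<phi> z\<bar> \<le> B"
  shows "norm v \<le> 2 * B"
proof (cases "v = 0")
  case True then show ?thesis using B[of x] by simp
next
  case False
  let ?z = "x + (1 / norm v) *\<^sub>R v"
  have "inner v (?z - x) = norm v" using False by (simp add: power2_norm_eq_inner[symmetric] power2_eq_square)
  moreover have "norm (?z - x) \<le> 1" using False by simp
  ultimately show ?thesis using sub[of ?z] B[of ?z] B[of x] by simp
qed

section \<open>The potential function\<close>

text \<open>\<open>T0fun\<close> with the supremum in the conjugate replaced by the single candidate
  \<open>p\<close>: a finite minorant for every \<open>p\<close>, exact if \<open>p\<close> is a
  maximizer. \<open>T_aff\<close> does the same for a component of \<open>Tfun\<close>.\<close>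

definition T0_aff :: "('b::real_inner \<Rightarrow> real) \<Rightarrow> ('b \<Rightarrow> real) \<Rightarrow> 'b \<Rightarrow> 'b \<Rightarrow> 'b \<Rightarrow> 'b \<Rightarrow> real" where
  "T0_aff f0 h0 p x s \<xi> = inner \<xi> x + f0 s - inner (grad f0 s) s + (inner (- \<xi> + grad f0 s) p - h0 p)"

definition T_aff :: "('m::finite \<Rightarrow> 'b::real_inner \<Rightarrow> real) \<Rightarrow> ('m \<Rightarrow> 'b \<Rightarrow> real) \<Rightarrow> 'b \<Rightarrow>
     'b \<Rightarrow> 'b \<Rightarrow> ('b^'m) \<Rightarrow> (real^'m) \<Rightarrow> 'm \<Rightarrow> real" where
  "T_aff f h p x s V L i = inner (V $ i) x + f i s - inner (grad (f i) s) s
      + (inner (- (V $ i) + grad (f i) s) p - h i p) + (norm (x - s))\<^sup>2 / 2 * L $ i"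

lemma T0_aff_le: "ereal (T0_aff f0 h0 p x s \<xi>) \<le> T0fun f0 h0 x s \<xi>"
  unfolding T0_aff_def T0fun_def plus_ereal.simps(1)[symmetric]
  by (intro add_left_mono fconj_ge)

lemma T_aff_le: "ereal (T_aff f h p x s V L i) \<le> Tfun f h x s V L i"
  unfolding T_aff_def Tfun_def plus_ereal.simps(1)[symmetric]
  by (intro add_left_mono add_right_mono fconj_ge)

lemma T0_aff_eq:
  "fconj h0 (- \<xi> + grad f0 s) = ereal (inner (- \<xi> + grad f0 s) p - h0 p) \<Longrightarrow>
    T0fun f0 h0 x s \<xi> = ereal (T0_aff f0 h0 p x s \<xi>)"
  by (simp add: T0_aff_def T0fun_def)

lemma T0_aff_self: "T0_aff f0 h0 s x s \<xi> = inner \<xi> (x - s) + (f0 s - h0 s)"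
  by (simp add: T0_aff_def algebra_simps inner_diff_right inner_add_left inner_diff_left)

text \<open>The link between the potential and the algorithm: with candidate \<open>p = s\<close>
  the minorant is the constraint model itself, so complementarity for the model becomes
  complementarity for the minorant.\<close>

lemma T_aff_self:
  assumes "g i s = f i s - h i s"
  shows "T_aff f h s x s V L i = Gfun g x s V L $ i"
  by (simp add: T_aff_def Gfun_def assms algebra_simps inner_diff_right inner_add_left inner_diff_left)

lemma Phi_finiteD:
  assumes "Phi \<phi> f0 h0 f h (x, s, V, L, \<xi>) \<noteq> \<infinity>"
  shows "L \<in> nonneg" "\<And>i. Tfun f h x s V L i \<le> 0"
    "Phi \<phi> f0 h0 f h (x, s, V, L, \<xi>) = ereal (\<phi> x) + T0fun f0 h0 x s \<xi>"
proof -
  have "T0fun f0 h0 x s \<xi> \<noteq> -\<infinity>" using T0_aff_le[of f0 h0 0 x s \<xi>] by auto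
  then have *: "L \<in> nonneg \<and> (\<forall>i. Tfun f h x s V L i \<le> 0)"
    using assms by (auto simp: Phi_def split: if_splits)
  then show "L \<in> nonneg" "\<And>i. Tfun f h x s V L i \<le> 0"
    "Phi \<phi> f0 h0 f h (x, s, V, L, \<xi>) = ereal (\<phi> x) + T0fun f0 h0 x s \<xi>"
    by (auto simp: Phi_def)
qed

lemma Phi_feasible:
  assumes "L \<in> nonneg" "\<And>i. Tfun f h x s V L i \<le> 0"
  shows "Phi \<phi> f0 h0 f h (x, s, V, L, \<xi>) = ereal (\<phi> x) + T0fun f0 h0 x s \<xi>"
  using assms by (simp add: Phi_def)

lemma Phi_lower: "ereal (\<phi> x + T0_aff f0 h0 p x s \<xi>) \<le> Phi \<phi> f0 h0 f h (x, s, V, L, \<xi>)"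
proof (cases "Phi \<phi> f0 h0 f h (x, s, V, L, \<xi>) = \<infinity>")
  case False
  have "ereal (\<phi> x) + ereal (T0_aff f0 h0 p x s \<xi>) \<le> ereal (\<phi> x) + T0fun f0 h0 x s \<xi>"
    by (intro add_left_mono T0_aff_le)
  then show ?thesis using Phi_finiteD(3)[OF False] by simp
qed simp

text \<open>Multipliers \<open>lam\<close> for the active constraints turn \<open>\<Phi>\<close> into a Lagrangian minorant; fixing the
  maximizers in the conjugates makes the minorant smooth, so no qualification condition is needed.\<close>
lemma Phi_c_subgradient:
  fixes \<phi> f0 h0 :: "'a::euclidean_space \<Rightarrow> real" and f h :: "'m::finite \<Rightarrow> 'a \<Rightarrow> real"
  assumes fin: "Phi \<phi> f0 h0 f h (x, s, V, L, \<xi>) \<noteq> \<infinity>"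
    and vb: "\<And>z. \<phi> x + inner vb (z - x) \<le> \<phi> z"
    and p: "fconj h0 (- \<xi> + grad f0 s) = ereal (inner (- \<xi> + grad f0 s) p - h0 p)"
    and lam: "\<And>i. lam $ i \<ge> 0" "\<And>i. lam $ i * T_aff f h s x s V L i = 0"
    and A0: "self_adjoint A0" "\<And>s. grad f0 s = blinfun_apply A0 s + b0"
      "\<And>s. f0 s = inner s (blinfun_apply A0 s) / 2 + inner b0 s + c0"
    and A: "\<And>i. self_adjoint (A i)" "\<And>i s. grad (f i) s = blinfun_apply (A i) s + b i"
      "\<And>i s. f i s = inner s (blinfun_apply (A i) s) / 2 + inner (b i) s + ct i"
  shows "((vb + \<xi> + matvec V lam + inner L lam *\<^sub>R (x - s),
           blinfun_apply A0 (p - s) + inner L lam *\<^sub>R (s - x),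
           (\<chi> i. lam $ i *\<^sub>R (x - s)), (\<chi> i. lam $ i * ((norm (x - s))\<^sup>2 / 2)), x - p), (2 * c) *\<^sub>R d)
         \<in> frechet_subdiff (Phi_c \<phi> f0 h0 f h c) ((x, s, V, L, \<xi>), d)"
    (is "?P \<in> _")
proof (rule frechet_subdiff_minorant)
  define X Sx Vx Lx Xi where
    "X w = fst (fst w)" and "Sx w = fst (snd (fst w))" and "Vx w = fst (snd (snd (fst w)))" and
    "Lx w = fst (snd (snd (snd (fst w))))" and "Xi w = snd (snd (snd (snd (fst w))))"
    for w :: "('a \<times> 'a \<times> ('a^'m) \<times> (real^'m) \<times> 'a) \<times> 'a"
  note proj = X_def Sx_def Vx_def Lx_def Xi_def
  define m where "m w = \<phi> x + inner vb (X w - x) + T0_aff f0 h0 p (X w) (Sx w) (Xi w)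
      + (\<Sum>i\<in>UNIV. lam $ i * T_aff f h s (X w) (Sx w) (Vx w) (Lx w) i) + c * (norm (snd w))\<^sup>2" for w
  let ?w0 = "((x, s, V, L, \<xi>), d)"
  show "ereal (m w) \<le> Phi_c \<phi> f0 h0 f h c w" for w
  proof -
    obtain x' s' V' L' \<xi>' d' where w: "w = ((x', s', V', L', \<xi>'), d')" by (metis prod.exhaust)
    show ?thesis
    proof (cases "Phi \<phi> f0 h0 f h (x', s', V', L', \<xi>') = \<infinity>")
      case True then show ?thesis by (simp add: w Phi_c_def)
    next
      case False
      have "lam $ i * T_aff f h s x' s' V' L' i \<le> 0" for i
      proof -
        have "ereal (T_aff f h s x' s' V' L' i) \<le> 0"
          using T_aff_le Phi_finiteD(2)[OF False] order_trans by blast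
        then show ?thesis using lam(1)[of i] by (simp add: mult_nonneg_nonpos)
      qed
      then have "(\<Sum>i\<in>UNIV. lam $ i * T_aff f h s x' s' V' L' i) \<le> 0" by (intro sum_nonpos)
      then have "m w \<le> \<phi> x' + T0_aff f0 h0 p x' s' \<xi>' + c * (norm d')\<^sup>2"
        using vb[of x'] by (simp add: m_def w proj)
      then have "ereal (m w) \<le> ereal (\<phi> x' + T0_aff f0 h0 p x' s' \<xi>') + ereal (c * (norm d')\<^sup>2)" by simp
      also have "\<dots> \<le> Phi \<phi> f0 h0 f h (x', s', V', L', \<xi>') + ereal (c * (norm d')\<^sup>2)"
        by (intro add_right_mono Phi_lower)
      finally show ?thesis by (simp add: w Phi_c_def)
    qed
  qed
  \<comment> \<open>The minorant touches at the base point because \<open>p\<close> attains the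
    conjugate in \<open>T0fun\<close> and the multiplier sum vanishes by \<open>lam(2)\<close>. The
    candidate \<open>s\<close> in the constraint terms is not assumed to attain their
    conjugates.\<close>
  show "Phi_c \<phi> f0 h0 f h c ?w0 = ereal (m ?w0)"
    unfolding Phi_c_def prod.case Phi_finiteD(3)[OF fin] T0_aff_eq[OF p]
    by (simp add: m_def proj lam(2))
  have dT0: "((\<lambda>w. T0_aff f0 h0 p (X w) (Sx w) (Xi w)) has_derivative
      (\<lambda>w. inner \<xi> (X w) + inner (blinfun_apply A0 (p - s)) (Sx w) + inner (x - p) (Xi w))) (at ?w0)"
  proof -
    have sa: "inner u (blinfun_apply A0 v) = inner (blinfun_apply A0 u) v" for u v
      using A0(1) by (simp add: self_adjoint_def)
    have eq: "T0_aff f0 h0 p x s \<xi> = inner \<xi> x - inner s (blinfun_apply A0 s) / 2 + c0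
        + (inner (- \<xi> + blinfun_apply A0 s + b0) p - h0 p)" for x s \<xi>
      by (simp add: T0_aff_def A0(2,3) inner_add_left inner_diff_left inner_commute[of s "blinfun_apply A0 s"])
    show ?thesis
      unfolding eq proj
      by (rule derivative_eq_intros refl | simp)+
        (auto simp: fun_eq_iff inner_add_left inner_diff_left blinfun.diff_right sa inner_commute algebra_simps)
  qed
  have dT: "((\<lambda>w. T_aff f h s (X w) (Sx w) (Vx w) (Lx w) i) has_derivative
      (\<lambda>w. inner (V $ i + L $ i *\<^sub>R (x - s)) (X w) + inner (L $ i *\<^sub>R (s - x)) (Sx w)
        + inner (x - s) (Vx w $ i) + (norm (x - s))\<^sup>2 / 2 * Lx w $ i)) (at ?w0)" for i
  proof -
    have sa: "inner u (blinfun_apply (A i) v) = inner (blinfun_apply (A i) u) v" for u v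
      using A(1) by (simp add: self_adjoint_def)
    have eq: "T_aff f h s0 x s V L i = inner (V $ i) x - inner s (blinfun_apply (A i) s) / 2 + ct i
        + (inner (- (V $ i) + blinfun_apply (A i) s + b i) s0 - h i s0) + inner (x - s) (x - s) / 2 * L $ i"
      for s0 x s V L
      by (simp add: T_aff_def A(2,3) inner_add_left inner_diff_left inner_commute[of s "blinfun_apply (A i) s"] power2_norm_eq_inner)
    show ?thesis
      unfolding eq proj
      by (rule derivative_eq_intros refl bounded_linear.has_derivative[OF bounded_linear_vec_nth] | simp)+
        (auto simp: fun_eq_iff inner_add_left inner_diff_left inner_diff_right blinfun.diff_right sa inner_commute
          algebra_simps add_divide_distrib diff_divide_distrib power2_norm_eq_inner)
  qed
  have "(m has_derivative (\<lambda>w. inner vb (X w) + (inner \<xi> (X w) + inner (blinfun_apply A0 (p - s)) (Sx w) + inner (x - p) (Xi w))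
     + (\<Sum>i\<in>UNIV. lam $ i * (inner (V $ i + L $ i *\<^sub>R (x - s)) (X w) + inner (L $ i *\<^sub>R (s - x)) (Sx w)
        + inner (x - s) (Vx w $ i) + (norm (x - s))\<^sup>2 / 2 * Lx w $ i)) + (2 * c) * inner d (snd w))) (at ?w0)"
  proof -
    have dX: "((\<lambda>w. \<phi> x + inner vb (X w - x)) has_derivative (\<lambda>w. inner vb (X w))) (at ?w0)"
      unfolding proj by (auto intro!: derivative_eq_intros)
    have dd: "((\<lambda>w. c * (norm (snd w))\<^sup>2) has_derivative (\<lambda>w. (2 * c) * inner d (snd w))) (at ?w0)"
      unfolding power2_norm_eq_inner by (auto intro!: derivative_eq_intros simp: inner_commute algebra_simps)
    show ?thesis
      unfolding m_def[abs_def]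
      by (intro has_derivative_add dX dT0 dd has_derivative_sum has_derivative_mult_right dT)
  qed
  moreover have "inner vb (X w) + (inner \<xi> (X w) + inner (blinfun_apply A0 (p - s)) (Sx w) + inner (x - p) (Xi w))
     + (\<Sum>i\<in>UNIV. lam $ i * (inner (V $ i + L $ i *\<^sub>R (x - s)) (X w) + inner (L $ i *\<^sub>R (s - x)) (Sx w)
        + inner (x - s) (Vx w $ i) + (norm (x - s))\<^sup>2 / 2 * Lx w $ i)) + (2 * c) * inner d (snd w) = inner ?P w" for w
  proof -
    have "(\<Sum>i\<in>UNIV. lam $ i * (inner (V $ i + L $ i *\<^sub>R (x - s)) (X w) + inner (L $ i *\<^sub>R (s - x)) (Sx w)
        + inner (x - s) (Vx w $ i) + (norm (x - s))\<^sup>2 / 2 * Lx w $ i))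
      = inner (matvec V lam) (X w) + inner L lam * inner (x - s) (X w) + inner L lam * inner (s - x) (Sx w)
        + inner (\<chi> i. lam $ i *\<^sub>R (x - s)) (Vx w) + inner (\<chi> i. lam $ i * ((norm (x - s))\<^sup>2 / 2)) (Lx w)"
      unfolding matvec_def inner_vec_def[of L] inner_vec_def[of _ "Vx w"] inner_vec_def[of _ "Lx w"]
        inner_sum_left sum_distrib_right sum.distrib[symmetric]
      by (intro sum.cong refl) (simp add: inner_add_left algebra_simps)
    then show ?thesis
      by (cases w) (auto simp: proj inner_add_left)
  qed
  ultimately show "(m has_derivative inner ?P) (at ?w0)" by (simp add: fun_eq_iff)
qed

lemma T0_aff_tendsto:
  fixes f0 :: "'a::euclidean_space \<Rightarrow> real"
  assumes f0: "strongly_convex_quadratic f0"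
    and lim: "(X \<longlongrightarrow> x) F" "(S \<longlongrightarrow> s) F" "(\<Xi> \<longlongrightarrow> \<xi>) F"
  shows "((\<lambda>k. T0_aff f0 h0 p (X k) (S k) (\<Xi> k)) \<longlongrightarrow> T0_aff f0 h0 p x s \<xi>) F"
proof -
  obtain A b c where "\<And>s. grad f0 s = blinfun_apply A s + b"
    "\<And>s. f0 s = inner s (blinfun_apply A s) / 2 + inner b s + c"
    using strongly_convex_quadratic_grad[OF f0] by metis
  then show ?thesis unfolding T0_aff_def by (simp only:) (intro tendsto_intros lim, simp)
qed

lemma T_aff_tendsto:
  fixes f :: "'m::finite \<Rightarrow> 'a::euclidean_space \<Rightarrow> real"
  assumes f: "strongly_convex_quadratic (f i)"
    and lim: "(X \<longlongrightarrow> x) F" "(S \<longlongrightarrow> s) F" "(W \<longlongrightarrow> V) F" "(L \<longlongrightarrow> l) F"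
  shows "((\<lambda>k. T_aff f h p (X k) (S k) (W k) (L k) i) \<longlongrightarrow> T_aff f h p x s V l i) F"
proof -
  obtain A b c where "\<And>s. grad (f i) s = blinfun_apply A s + b"
    "\<And>s. f i s = inner s (blinfun_apply A s) / 2 + inner b s + c"
    using strongly_convex_quadratic_grad[OF f] by metis
  then show ?thesis unfolding T_aff_def by (simp only:) (intro tendsto_intros lim, simp_all)
qed

section \<open>The Kurdyka-Lojasiewicz inequality\<close>

text \<open>A derivative-free form of the KL inequality, valid for each single subgradient. Here
  \<open>r\<close> is the excess of the potential over the limit value \<open>Fs\<close>, while
  \<open>s\<close> and \<open>t\<close> will be the excesses of two consecutive objective values;
  the radius \<open>\<epsilon>\<close> is a real number even if the KL property holds with an
  infinite one.\<close>

definition KL_gauge :: "('b::real_inner \<Rightarrow> ereal) \<Rightarrow> 'b \<Rightarrow> real \<Rightarrow> real \<Rightarrow> real \<Rightarrow> (real \<Rightarrow> real) \<Rightarrow> bool" where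
  "KL_gauge H wb Fs \<delta> \<epsilon> \<psi> \<longleftrightarrow> \<delta> > 0 \<and> \<epsilon> > 0 \<and> (\<forall>t. 0 \<le> t \<longrightarrow> t < \<epsilon> \<longrightarrow> 0 \<le> \<psi> t) \<and>
     (\<forall>s t. 0 \<le> t \<longrightarrow> t \<le> s \<longrightarrow> s < \<epsilon> \<longrightarrow> \<psi> t \<le> \<psi> s) \<and>
     (\<forall>w p r s t. w \<in> ball wb \<delta> \<longrightarrow> p \<in> limiting_subdiff H w \<longrightarrow> H w = ereal (Fs + r) \<longrightarrow> r < \<epsilon> \<longrightarrow>
        0 \<le> t \<longrightarrow> t \<le> s \<longrightarrow> 0 < s \<longrightarrow> s \<le> r \<longrightarrow> s - t \<le> norm p * (\<psi> s - \<psi> t))"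

text \<open>Since the desingularizing function is concave, its derivative at the value \<open>r\<close> of the potential
  bounds its difference quotients on \<open>[0, r]\<close> from below; the inequality is stated for values \<open>t \<le> s \<le> r\<close>
  because the potential lies between consecutive objective values only up to \<open>c \<bar>d\<bar>^2\<close>.\<close>
lemma KL_at_gauge:
  fixes H :: "'b::real_inner \<Rightarrow> ereal"
  assumes KL: "KL_at H wb" and wb: "H wb = ereal Fs"
  shows "\<exists>\<delta> \<epsilon> \<psi>. KL_gauge H wb Fs \<delta> \<epsilon> \<psi>"
proof -
  obtain \<delta> \<eta> \<psi> \<psi>' where \<delta>: "\<delta> > 0" and \<eta>: "\<eta> > 0" and ups: "Upsilon \<eta> \<psi> \<psi>'"
    and kl: "\<And>w. dist w wb < \<delta> \<Longrightarrow> H wb < H w \<Longrightarrow> H w < H wb + \<eta> \<Longrightarrow> limiting_subdiff H w \<noteq> {} \<Longrightarrow>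
           \<psi>' (real_of_ereal (H w - H wb)) * infdist 0 (limiting_subdiff H w) \<ge> 1"
    using KL unfolding KL_at_def by metis
  obtain \<epsilon> where \<epsilon>: "0 < \<epsilon>" "ereal \<epsilon> < \<eta>" using ereal_dense2[OF \<eta>] by auto
  have lt: "ereal t < \<eta>" if "t < \<epsilon>" for t
    using that \<epsilon>(2) by (meson ereal_less_eq(3) le_less_trans less_imp_le)
  have conc: "convex_on {0..<\<epsilon>} (\<lambda>t. - \<psi> t)"
    using ups lt unfolding Upsilon_def concave_on_def by (elim conjE) (rule convex_on_subset, auto)
  have der: "(\<psi> has_real_derivative \<psi>' t) (at t)" "\<psi>' t > 0" if "0 < t" "t < \<epsilon>" for t
    using ups lt that unfolding Upsilon_def by auto
  have tang: "\<psi> u - \<psi> t \<le> \<psi>' t * (u - t)" if "0 < t" "t < \<epsilon>" "0 \<le> u" "u < \<epsilon>" for t u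
  proof -
    have "(- \<psi> u) - (- \<psi> t) \<ge> (- \<psi>' t) * (u - t)"
    proof (rule convex_on_imp_above_tangent[OF conc])
      show "connected {0..<\<epsilon>}" by (intro convex_connected) simp
      show "t \<in> interior {0..<\<epsilon>}" using that by simp
      show "u \<in> {0..<\<epsilon>}" using that by simp
      show "((\<lambda>t. - \<psi> t) has_real_derivative - \<psi>' t) (at t within {0..<\<epsilon>})"
        using has_field_derivative_at_within[OF DERIV_minus[OF der(1)[OF that(1,2)]]] .
    qed
    then show ?thesis by simp
  qed
  have mono: "\<psi>' s * (s - t) \<le> \<psi> s - \<psi> t" if "0 \<le> t" "0 < s" "s < \<epsilon>" "t < \<epsilon>" for s t
    using tang[of s t] that by (simp add: algebra_simps)
  have "KL_gauge H wb Fs \<delta> \<epsilon> \<psi>"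
    unfolding KL_gauge_def
  proof (intro conjI allI impI \<delta> \<epsilon>(1))
    show "\<psi> t \<ge> 0" if "0 \<le> t" "t < \<epsilon>" for t
      using ups lt that unfolding Upsilon_def by auto
    show "\<psi> t \<le> \<psi> s" if "0 \<le> t" "t \<le> s" "s < \<epsilon>" for s t
    proof (cases "s = t")
      case False
      then have "0 \<le> \<psi>' s * (s - t)" using der(2)[of s] that by simp
      with mono[of t s] False that show ?thesis by simp
    qed simp
    fix w p r s t
    assume w: "w \<in> ball wb \<delta>" and p: "p \<in> limiting_subdiff H w" and Hw: "H w = ereal (Fs + r)"
      and r: "r < \<epsilon>" and st: "0 \<le> t" "t \<le> s" "0 < s" "s \<le> r"
    have "\<psi>' r * infdist 0 (limiting_subdiff H w) \<ge> 1"
    proof -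
      have "H w < H wb + \<eta>"
      proof -
        have "ereal (Fs + r) < ereal Fs + \<eta>" using lt[OF r] by (cases \<eta>) auto
        then show ?thesis by (simp add: Hw wb)
      qed
      moreover have "H wb < H w" using st by (simp add: Hw wb)
      ultimately show ?thesis using kl[of w] w p by (auto simp: Hw wb dist_commute)
    qed
    moreover have "infdist 0 (limiting_subdiff H w) \<le> norm p"
      using infdist_le[OF p, of 0] by simp
    moreover have pr: "\<psi>' r > 0" using der(2)[of r] st r by simp
    ultimately have 1: "1 \<le> \<psi>' r * norm p" by (meson mult_left_mono less_imp_le order_trans)
    \<comment> \<open>The derivative of a concave function is antitone: add the tangent inequalities
      at \<open>r\<close> and at \<open>s\<close>.\<close>
    have "\<psi>' r \<le> \<psi>' s"
    proof (cases "r = s")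
      case False
      have "0 \<le> (\<psi>' s - \<psi>' r) * (r - s)"
        using tang[of s r] tang[of r s] st r by (simp add: algebra_simps)
      then show ?thesis using st False by (simp add: zero_le_mult_iff)
    qed simp
    then have "1 \<le> \<psi>' s * norm p" using 1 by (meson mult_right_mono norm_ge_zero order_trans)
    then have "s - t \<le> (\<psi>' s * norm p) * (s - t)" using st by (simp add: mult_le_cancel_right1)
    also have "\<dots> = norm p * (\<psi>' s * (s - t))" by simp
    also have "\<dots> \<le> norm p * (\<psi> s - \<psi> t)" using mono[of t s] st r by (intro mult_left_mono) auto
    finally show "s - t \<le> norm p * (\<psi> s - \<psi> t)" .
  qed
  then show ?thesis by blast
qed

section \<open>The inner loop of iMBA\<close>

text \<open>For \<open>t > e\<close> one factor \<open>e\<close> of the square is replaced by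
  \<open>t\<close> and the whole inequality divided by \<open>t\<close>; the summand 1 covers
  \<open>t \<le> e\<close>. In this way a mixed error term is absorbed by strong convexity.\<close>

lemma quadratic_rate:
  fixes t e a b \<mu> :: real
  assumes "\<mu> > 0" "a \<ge> 0" "b \<ge> 0" "t \<ge> 0" "e \<ge> 0" and le: "\<mu> * t\<^sup>2 \<le> a * e\<^sup>2 + b * e * t"
  shows "t \<le> (1 + (a + b) / \<mu>) * e"
proof (cases "t \<le> e")
  case True
  then have "1 * t \<le> (1 + (a + b) / \<mu>) * e" using assms by (intro mult_mono) auto
  then show ?thesis by simp
next
  case False
  have "a * e\<^sup>2 \<le> a * (e * t)" using False assms by (intro mult_left_mono) (auto simp: power2_eq_square mult_left_mono)
  with le have "(\<mu> * t) * t \<le> ((a + b) * e) * t" by (simp add: algebra_simps power2_eq_square)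
  then have "\<mu> * t \<le> (a + b) * e" using False assms by (simp add: mult_le_cancel_right)
  then have "t \<le> (a + b) / \<mu> * e" using assms by (simp add: field_simps)
  also have "\<dots> \<le> (1 + (a + b) / \<mu>) * e" using assms by (intro mult_right_mono) auto
  finally show ?thesis .
qed

lemma strongly_convex_continuous:
  fixes h :: "'a::euclidean_space \<Rightarrow> real"
  assumes "strongly_convex h"
  shows "isCont h x"
proof -
  obtain \<sigma> where conv: "convex_on UNIV (\<lambda>x. h x - \<sigma> / 2 * (norm x)\<^sup>2)"
    using assms unfolding strongly_convex_def by blast
  have "continuous_on UNIV (\<lambda>x. (h x - \<sigma> / 2 * (norm x)\<^sup>2) + \<sigma> / 2 * (norm x)\<^sup>2)"
    by (intro continuous_intros convex_on_continuous conv) auto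
  then show ?thesis by (simp add: continuous_on_eq_continuous_at)
qed

lemma pos_part_inf_norm_ge: "w $ i \<le> pos_part_inf_norm w" "0 \<le> pos_part_inf_norm w"
proof -
  have "max 0 (w $ i) \<le> pos_part_inf_norm w" unfolding pos_part_inf_norm_def by (intro Max_ge) auto
  then show "w $ i \<le> pos_part_inf_norm w" "0 \<le> pos_part_inf_norm w" by auto
qed

section \<open>The constraint models as convex quadratics\<close>

lemma Gfun_self: "Gfun g s s V L = gvec g s"
  by (simp add: Gfun_def gvec_def)

lemma Gfun_expand:
  "Gfun g z s V L $ i = Gfun g y s V L $ i + inner (V $ i + L $ i *\<^sub>R (y - s)) (z - y) + (norm (z - y))\<^sup>2 / 2 * L $ i"
  unfolding Gfun_def power2_norm_eq_inner
  by (simp add: inner_diff_left inner_diff_right inner_add_left inner_add_right inner_commute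
      algebra_simps add_divide_distrib diff_divide_distrib)

text \<open>The quadratic remainder of the expansion around \<open>y\<close> is nonnegative. This
  convexity gives convex subproblem domains and lets the inexact solution be tested against the
  exact one.\<close>

lemma Gfun_tangent:
  assumes "0 \<le> L $ i"
  shows "Gfun g y s V L $ i + inner (V $ i + L $ i *\<^sub>R (y - s)) (z - y) \<le> Gfun g z s V L $ i"
proof -
  have "0 \<le> (norm (z - y))\<^sup>2 / 2 * L $ i" using assms by simp
  then show ?thesis using Gfun_expand[of g z s V L i y] by linarith
qed

lemma matvec_inner: "inner (matvec V lam + inner L lam *\<^sub>R u) z = (\<Sum>i\<in>UNIV. lam $ i * inner (V $ i + L $ i *\<^sub>R u) z)"
  unfolding matvec_def inner_vec_def[of L] inner_add_left inner_sum_left inner_scaleR_left sum_distrib_right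
    sum.distrib[symmetric]
  by (intro sum.cong refl) (simp add: algebra_simps)

lemma convex_Gfun_nonpos:
  assumes "L \<in> nonneg"
  shows "convex {z. Gfun g z s V L \<in> nonpos}"
  unfolding convex_alt
proof (intro ballI allI impI)
  fix y z and u :: real
  assume y: "y \<in> {z. Gfun g z s V L \<in> nonpos}" and z: "z \<in> {z. Gfun g z s V L \<in> nonpos}"
    and u: "0 \<le> u \<and> u \<le> 1"
  let ?w = "(1 - u) *\<^sub>R y + u *\<^sub>R z"
  have "Gfun g ?w s V L $ i \<le> 0" for i
  proof -
    let ?q = "V $ i + L $ i *\<^sub>R (?w - s)"
    have "0 \<le> L $ i" using assms by (simp add: nonneg_def)
    define G a b where "G = Gfun g ?w s V L $ i" and "a = inner ?q (y - ?w)" and "b = inner ?q (z - ?w)"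
    have "G + a \<le> 0" "G + b \<le> 0"
      using y z Gfun_tangent[OF \<open>0 \<le> L $ i\<close>, of g ?w s V y] Gfun_tangent[OF \<open>0 \<le> L $ i\<close>, of g ?w s V z]
      unfolding G_def a_def b_def by (auto simp: nonpos_def intro: order_trans)
    then have "(1 - u) * (G + a) + u * (G + b) \<le> 0"
      using u by (intro add_nonpos_nonpos[OF mult_nonneg_nonpos mult_nonneg_nonpos]) auto
    moreover have "(1 - u) * a + u * b = 0"
    proof -
      have "(1 - u) * a + u * b = inner ?q ((1 - u) *\<^sub>R (y - ?w) + u *\<^sub>R (z - ?w))"
        unfolding a_def b_def by (simp only: inner_add_right inner_scaleR_right)
      also have "(1 - u) *\<^sub>R (y - ?w) + u *\<^sub>R (z - ?w) = 0" by (simp add: algebra_simps)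
      finally show ?thesis by simp
    qed
    ultimately show ?thesis unfolding G_def[symmetric] by (simp add: algebra_simps)
  qed
  then show "?w \<in> {z. Gfun g z s V L \<in> nonpos}" by (simp add: nonpos_def)
qed

lemma norm_vec_le_sum:
  fixes V :: "'b::real_normed_vector ^ 'm::finite"
  assumes "\<And>i. norm (V $ i) \<le> B"
  shows "norm V \<le> real CARD('m) * B"
proof -
  have "norm V \<le> (\<Sum>i\<in>UNIV. norm (V $ i))" unfolding norm_vec_def by (rule L2_set_le_sum) simp
  also have "\<dots> \<le> (\<Sum>i\<in>(UNIV::'m set). B)" by (intro sum_mono assms)
  finally show ?thesis by simp
qed

lemma norm_Pair_le_add: "norm a \<le> A \<Longrightarrow> norm b \<le> B \<Longrightarrow> norm (a, b) \<le> A + B"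
  using norm_Pair_le[of a b] by linarith

section \<open>The setting of iMBA: iterates, objective values and descent constants\<close>

locale imba =
  fixes g0 :: "'a::euclidean_space \<Rightarrow> ereal"
    and g :: "'m::finite \<Rightarrow> 'a \<Rightarrow> real"
    and \<phi> :: "'a \<Rightarrow> real"
    and Oset :: "'a set"
    and \<mu>min \<mu>max Lmin Lmax M \<beta>C \<beta>S \<alpha> \<tau> :: real
    and x \<xi> :: "nat \<Rightarrow> 'a"
    and V :: "nat \<Rightarrow> ('a^'m)"
    and jk :: "nat \<Rightarrow> nat"
    and \<mu> :: "nat \<Rightarrow> nat \<Rightarrow> real"
    and Q :: "nat \<Rightarrow> nat \<Rightarrow> ('a \<Rightarrow>\<^sub>L 'a)"
    and L :: "nat \<Rightarrow> nat \<Rightarrow> (real^'m)"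
    and xbar y v :: "nat \<Rightarrow> nat \<Rightarrow> 'a"
    and lam :: "nat \<Rightarrow> nat \<Rightarrow> (real^'m)"
    and D :: "'a set"
    and f0 h0 :: "'a \<Rightarrow> real"
    and f h :: "'m \<Rightarrow> 'a \<Rightarrow> real"
    and c :: real and khat :: nat
  assumes O_open: "open Oset"
    and Gamma_sub: "feas g \<subseteq> Oset"
    and g0_proper: "\<forall>z. g0 z \<noteq> -\<infinity>"
    and g0_finite: "\<forall>z\<in>Oset. g0 z \<noteq> \<infinity>"
    and g0_lip: "\<forall>z\<in>Oset. loc_lipschitz_at (\<lambda>w. real_of_ereal (g0 w)) z"
    and g0_uC2: "\<forall>z\<in>Oset. upper_C2_at (\<lambda>w. real_of_ereal (g0 w)) z"
    and g_lip: "\<forall>i z. loc_lipschitz_at (g i) z"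
    and g_uC2: "\<forall>i z. upper_C2_at (g i) z"
    and phi_convex: "convex_on UNIV \<phi>"
    and F_bdd: "\<exists>b. \<forall>z\<in>feas g. Fobj g0 g \<phi> z \<ge> ereal b"
    and par: "0 < \<mu>min" "\<mu>min \<le> \<mu>max" "0 < Lmin" "Lmin \<le> Lmax" "M > 0" "\<beta>C > 0" "\<beta>S > 0"
      "\<alpha> > 0" "\<tau> > 1"
    and x0: "x 0 \<in> feas g"
    and xi_sub: "\<forall>k. \<xi> k \<in> limiting_subdiff g0 (x k)"
    and V_sub: "\<forall>k i. V k $ i \<in> limiting_subdiff (\<lambda>z. ereal (g i z)) (x k)"
    and mu0: "\<forall>k. \<mu>min \<le> \<mu> k 0 \<and> \<mu> k 0 \<le> \<mu>max"
    and L0: "\<forall>k i. Lmin \<le> L k 0 $ i \<and> L k 0 $ i \<le> Lmax"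
    and Q_sa: "\<forall>k j. j \<le> jk k \<longrightarrow> self_adjoint (Q k j) \<and>
        (\<forall>d. \<mu> k j * (norm d)\<^sup>2 \<le> inner d (blinfun_apply (Q k j) d) \<and>
             inner d (blinfun_apply (Q k j) d) \<le> (\<mu> k j + M) * (norm d)\<^sup>2)"
    and xbar_min: "\<forall>k j. j \<le> jk k \<longrightarrow>
        Gfun g (xbar k j) (x k) (V k) (L k j) \<in> nonpos \<and>
        (\<forall>z. Gfun g z (x k) (V k) (L k j) \<in> nonpos \<longrightarrow>
           Fmodel g0 \<phi> (x k) (\<xi> k) (Q k j) (xbar k j) \<le> Fmodel g0 \<phi> (x k) (\<xi> k) (Q k j) z)"
    and inexact: "\<forall>k j. j \<le> jk k \<longrightarrow>
        v k j \<in> limiting_subdiff (\<lambda>z. ereal (\<phi> z)) (y k j) \<and> lam k j \<in> nonneg \<and>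
        Fmodel g0 \<phi> (x k) (\<xi> k) (Q k j) (y k j) \<le> Fmodel g0 \<phi> (x k) (\<xi> k) (Q k j) (x k) \<and>
        max 0 (- inner (lam k j) (Gfun g (y k j) (x k) (V k) (L k j)))
          + pos_part_inf_norm (Gfun g (y k j) (x k) (V k) (L k j))
          \<le> \<beta>C / 2 * (norm (y k j - x k))\<^sup>2 \<and>
        norm (\<xi> k + blinfun_apply (Q k j) (y k j - x k) + v k j + matvec (V k) (lam k j)
              + inner (L k j) (lam k j) *\<^sub>R (y k j - x k))
          \<le> \<beta>S * norm (y k j - x k)"
    and accept: "\<forall>k. gvec g (y k (jk k)) \<in> nonpos \<and>
        Fobj g0 g \<phi> (y k (jk k)) \<le> Fobj g0 g \<phi> (x k) - ereal (\<alpha> / 2 * (norm (y k (jk k) - x k))\<^sup>2)"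
    and reject: "\<forall>k j. j < jk k \<longrightarrow>
        \<not> (gvec g (y k j) \<in> nonpos \<and>
           Fobj g0 g \<phi> (y k j) \<le> Fobj g0 g \<phi> (x k) - ereal (\<alpha> / 2 * (norm (y k j - x k))\<^sup>2)) \<and>
        (gvec g (y k j) \<notin> nonpos \<longrightarrow> L k (Suc j) = \<tau> *\<^sub>R L k j \<and> \<mu> k (Suc j) = \<mu> k j) \<and>
        (gvec g (y k j) \<in> nonpos \<longrightarrow> L k (Suc j) = L k j \<and> \<mu> k (Suc j) = \<tau> * \<mu> k j)"
    and x_next: "\<forall>k. x (Suc k) = y k (jk k)"
    and A3: "bounded (range x)"
    and A4: "\<forall>p \<in> cluster_points (\<lambda>k. ((x k, L k (jk k), V k, \<xi> k, Q k (jk k)), xbar k (jk k))).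
        partial_BMP g (fst p) (snd p)"
    and D_sub: "range x \<subseteq> D"
    and dc0: "\<forall>z\<in>D. g0 z = ereal (f0 z - h0 z)"
    and dc: "\<forall>i. \<forall>z\<in>D. g i z = f i z - h i z"
    and fq: "strongly_convex_quadratic f0" "\<forall>i. strongly_convex_quadratic (f i)"
    and hsc: "strongly_convex h0" "\<forall>i. strongly_convex (h i)"
    and c_pos: "c > 0"
    and sandwich: "\<forall>k\<ge>khat.
        Fobj g0 g \<phi> (x (Suc k)) - ereal (c * (norm (x (Suc k) - x k))\<^sup>2)
          \<le> Phi \<phi> f0 h0 f h (xbar k (jk k), x k, V k, L k (jk k), \<xi> k) \<and>
        Phi \<phi> f0 h0 f h (xbar k (jk k), x k, V k, L k (jk k), \<xi> k) \<le> Fobj g0 g \<phi> (x k)"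
    and KL: "\<forall>w\<in>cluster_points (\<lambda>k. ((xbar k (jk k), x k, V k, L k (jk k), \<xi> k), x (Suc k) - x k)).
        KL_at (Phi_c \<phi> f0 h0 f h c) w"
begin

abbreviation "xb k \<equiv> xbar k (jk k)"
abbreviation "Lk k \<equiv> L k (jk k)"
abbreviation "Qk k \<equiv> Q k (jk k)"

text \<open>The objective at the iterates as a real number. Writing \<open>g0\<close> through its
  decomposition on \<open>D\<close> also makes its values continuous functions of the iterates,
  which is used when passing to cluster points.\<close>

definition "Fr k = f0 (x k) - h0 (x k) + \<phi> (x k)"
definition "e k = sqrt (Fr k - Fr (Suc k))"

lemma x_feas: "x k \<in> feas g"
  using x0 accept x_next by (cases k) (auto simp: feas_def)

lemma x_O: "x k \<in> Oset" using x_feas Gamma_sub by blast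

lemma g0_real: "z \<in> Oset \<Longrightarrow> g0 z = ereal (real_of_ereal (g0 z))"
  using bspec[OF g0_finite, of z] spec[OF g0_proper, of z] by (cases "g0 z") simp_all

lemma g0_x: "g0 (x k) = ereal (f0 (x k) - h0 (x k))"
  using dc0 D_sub by blast

lemma Fobj_feas:
  assumes "z \<in> feas g"
  shows "Fobj g0 g \<phi> z = ereal (real_of_ereal (g0 z) + \<phi> z)"
proof -
  have "z \<in> Oset" using assms Gamma_sub by blast
  from g0_real[OF this] obtain a where "g0 z = ereal a" by blast
  moreover have "gvec g z \<in> nonpos" using assms by (simp add: feas_def)
  ultimately show ?thesis by (simp add: Fobj_def ind_def)
qed

lemma Fobj_x: "Fobj g0 g \<phi> (x k) = ereal (Fr k)"
  using Fobj_feas[OF x_feas[of k]] by (simp add: g0_x Fr_def)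

lemma decrease: "\<alpha> / 2 * (norm (x (Suc k) - x k))\<^sup>2 \<le> Fr k - Fr (Suc k)"
  using accept[rule_format, of k] Fobj_x[of k] Fobj_x[of "Suc k"] x_next by simp

lemma Fr_le: "Fr (Suc k) \<le> Fr k"
proof -
  have "0 \<le> \<alpha> / 2 * (norm (x (Suc k) - x k))\<^sup>2" using par by simp
  with decrease[of k] show ?thesis by linarith
qed

lemma e_ge: "e k \<ge> 0" and e_sq: "(e k)\<^sup>2 = Fr k - Fr (Suc k)"
  using Fr_le[of k] by (auto simp: e_def)

lemma step_le: "norm (x (Suc k) - x k) \<le> sqrt (2 / \<alpha>) * e k"
proof -
  have "(norm (x (Suc k) - x k))\<^sup>2 \<le> 2 / \<alpha> * (Fr k - Fr (Suc k))"
    using decrease[of k] par by (simp add: field_simps)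
  then have "norm (x (Suc k) - x k) \<le> sqrt (2 / \<alpha> * (Fr k - Fr (Suc k)))" by (rule real_le_rsqrt)
  then show ?thesis unfolding e_def real_sqrt_mult .
qed

lemma g_cont: "isCont (g i) z" using g_lip by (intro loc_lipschitz_isCont) blast

lemma phi_cont: "isCont \<phi> z"
  using convex_on_continuous[OF open_UNIV phi_convex] by (simp add: continuous_on_eq_continuous_at)

lemma closed_feas: "closed (feas g)"
proof -
  have "feas g = (\<Inter>i. {z. g i z \<le> 0})" by (auto simp: feas_def nonpos_def gvec_def)
  also have "closed \<dots>"
    by (intro closed_INT ballI closed_Collect_le continuous_intros continuous_at_imp_continuous_on g_cont)
  finally show ?thesis .
qed

lemma phi_bound: "\<exists>B. \<forall>z\<in>cball 0 R. \<bar>\<phi> z\<bar> \<le> B"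
proof -
  have "bounded (\<phi> ` cball 0 R)"
    by (intro compact_imp_bounded compact_continuous_image continuous_at_imp_continuous_on ballI phi_cont) simp
  then show ?thesis unfolding bounded_iff by auto
qed

lemma phi_subgradient_bound:
  "\<exists>B. \<forall>z\<in>cball 0 R. \<forall>u. (\<forall>w. \<phi> z + inner u (w - z) \<le> \<phi> w) \<longrightarrow> norm u \<le> B"
proof -
  obtain B where B: "\<And>z. z \<in> cball 0 (R + 1) \<Longrightarrow> \<bar>\<phi> z\<bar> \<le> B" using phi_bound by blast
  have "norm u \<le> 2 * B" if z: "z \<in> cball 0 R" and u: "\<forall>w. \<phi> z + inner u (w - z) \<le> \<phi> w" for z u
  proof (rule subgradient_norm_le[of \<phi> z u])
    fix w assume "norm (w - z) \<le> 1"
    then show "\<bar>\<phi> w\<bar> \<le> B" using B[of w] z norm_triangle_ineq[of "w - z" z] by simp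
  qed (use u in blast)
  then show ?thesis by blast
qed

text \<open>The feasible part of a ball is a compact subset of \<open>Oset\<close>, where
  \<open>g0\<close> is finite and upper-C2. It need not be convex, but the uniform estimate does not
  ask for that.\<close>

lemma g0_descent:
  obtains K where "K \<ge> 0"
    "\<And>z u. z \<in> feas g \<inter> cball 0 R \<Longrightarrow> u \<in> limiting_subdiff g0 z \<Longrightarrow> norm u \<le> K"
    "\<And>z u w. z \<in> feas g \<inter> cball 0 R \<Longrightarrow> u \<in> limiting_subdiff g0 z \<Longrightarrow> w \<in> feas g \<inter> cball 0 R \<Longrightarrow>
      real_of_ereal (g0 w) \<le> real_of_ereal (g0 z) + inner u (w - z) + K * (norm (w - z))\<^sup>2"
proof (rule upper_C2_uniform_descent[of "feas g \<inter> cball 0 R" Oset g0 "\<lambda>w. real_of_ereal (g0 w)"])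
  show "compact (feas g \<inter> cball 0 R)" using closed_feas by (intro closed_Int_compact) auto
  show "feas g \<inter> cball 0 R \<subseteq> Oset" using Gamma_sub by blast
  show "g0 z = ereal (real_of_ereal (g0 z))" if "z \<in> Oset" for z by (rule g0_real[OF that])
  show "loc_lipschitz_at (\<lambda>w. real_of_ereal (g0 w)) z" if "z \<in> feas g \<inter> cball 0 R" for z
    using g0_lip Gamma_sub that by blast
  show "upper_C2_at (\<lambda>w. real_of_ereal (g0 w)) z" if "z \<in> feas g \<inter> cball 0 R" for z
    using g0_uC2 Gamma_sub that by blast
qed (use O_open that in auto)

lemma g_descent:
  obtains K where "K \<ge> 0"
    "\<And>i z u. z \<in> cball 0 R \<Longrightarrow> u \<in> limiting_subdiff (\<lambda>z. ereal (g i z)) z \<Longrightarrow> norm u \<le> K"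
    "\<And>i z u w. z \<in> cball 0 R \<Longrightarrow> u \<in> limiting_subdiff (\<lambda>z. ereal (g i z)) z \<Longrightarrow> w \<in> cball 0 R \<Longrightarrow>
      g i w \<le> g i z + inner u (w - z) + K * (norm (w - z))\<^sup>2"
proof -
  have "\<exists>K\<ge>0. (\<forall>z u. z \<in> cball 0 R \<longrightarrow> u \<in> limiting_subdiff (\<lambda>z. ereal (g i z)) z \<longrightarrow> norm u \<le> K) \<and>
    (\<forall>z u w. z \<in> cball 0 R \<longrightarrow> u \<in> limiting_subdiff (\<lambda>z. ereal (g i z)) z \<longrightarrow> w \<in> cball 0 R \<longrightarrow>
      g i w \<le> g i z + inner u (w - z) + K * (norm (w - z))\<^sup>2)" for i
    by (rule upper_C2_uniform_descent[of "cball 0 R" UNIV "\<lambda>z. ereal (g i z)" "g i"])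
      (use g_lip g_uC2 in auto)
  then obtain K where K: "\<And>i. K i \<ge> 0"
    "\<And>i z u. z \<in> cball 0 R \<Longrightarrow> u \<in> limiting_subdiff (\<lambda>z. ereal (g i z)) z \<Longrightarrow> norm u \<le> K i"
    "\<And>i z u w. z \<in> cball 0 R \<Longrightarrow> u \<in> limiting_subdiff (\<lambda>z. ereal (g i z)) z \<Longrightarrow> w \<in> cball 0 R \<Longrightarrow>
      g i w \<le> g i z + inner u (w - z) + K i * (norm (w - z))\<^sup>2"
    by metis
  have le: "K i \<le> sum K UNIV" for i using K(1) by (intro member_le_sum) auto
  show ?thesis
  proof (rule that[of "sum K UNIV"])
    show "0 \<le> sum K UNIV" using K(1) by (intro sum_nonneg)
    show "norm u \<le> sum K UNIV" if "z \<in> cball 0 R" "u \<in> limiting_subdiff (\<lambda>z. ereal (g i z)) z" for i z u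
      using K(2)[OF that] le[of i] by linarith
    show "g i w \<le> g i z + inner u (w - z) + sum K UNIV * (norm (w - z))\<^sup>2"
      if "z \<in> cball 0 R" "u \<in> limiting_subdiff (\<lambda>z. ereal (g i z)) z" "w \<in> cball 0 R" for i z u w
      using K(3)[OF that] mult_right_mono[OF le[of i], of "(norm (w - z))\<^sup>2"] by simp
  qed
qed

section \<open>Bounds on trial points and backtracking parameters\<close>

lemma mu_ge: "j \<le> jk k \<Longrightarrow> \<mu>min \<le> \<mu> k j"
proof (induction j)
  case 0 then show ?case using mu0 by simp
next
  case (Suc j)
  then have IH: "\<mu>min \<le> \<mu> k j" by simp
  have "\<mu> k (Suc j) = \<mu> k j \<or> \<mu> k (Suc j) = \<tau> * \<mu> k j" using reject Suc.prems by (metis Suc_le_eq)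
  moreover have "\<mu> k j \<le> \<tau> * \<mu> k j" using IH par by simp
  ultimately show ?case using IH by linarith
qed

lemma Q_lower: "j \<le> jk k \<Longrightarrow> \<mu>min * (norm d)\<^sup>2 \<le> inner d (blinfun_apply (Q k j) d)"
  using Q_sa mu_ge[of j k] mult_right_mono[OF mu_ge[of j k], of "(norm d)\<^sup>2"] by (meson order_trans zero_le_power2)

lemma model_decrease:
  assumes "j \<le> jk k"
  shows "inner (\<xi> k) (y k j - x k) + \<mu> k j / 2 * (norm (y k j - x k))\<^sup>2 + \<phi> (y k j) \<le> \<phi> (x k)"
proof -
  have "Fmodel g0 \<phi> (x k) (\<xi> k) (Q k j) (y k j) \<le> Fmodel g0 \<phi> (x k) (\<xi> k) (Q k j) (x k)"
    using inexact assms by blast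
  moreover have "\<mu> k j * (norm (y k j - x k))\<^sup>2 \<le> inner (y k j - x k) (blinfun_apply (Q k j) (y k j - x k))"
    using Q_sa assms by blast
  ultimately show ?thesis by (simp add: Fmodel_def g0_x)
qed

lemma x_bound: obtains R where "R \<ge> 0" "\<And>k. norm (x k) \<le> R"
  using A3 unfolding bounded_iff by (metis norm_ge_zero order_trans rangeI)

text \<open>The model value does not increase from \<open>x k\<close> to a trial point, and the
  model is strongly convex with modulus at least \<open>\<mu>min\<close>; bounds for
  \<open>\<xi> k\<close> and for a subgradient of \<open>\<phi>\<close> at \<open>x k\<close> then
  limit the length of the trial step. Covering all trials, not only accepted ones, makes the descent
  constants uniform for the backtracking analysis.\<close>

lemma y_bound: obtains R where "\<And>k. norm (x k) \<le> R" "\<And>k j. j \<le> jk k \<Longrightarrow> norm (y k j) \<le> R"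
proof -
  obtain R where R: "R \<ge> 0" "\<And>k. norm (x k) \<le> R" using x_bound by blast
  obtain K where K: "K \<ge> 0"
    "\<And>z u. z \<in> feas g \<inter> cball 0 R \<Longrightarrow> u \<in> limiting_subdiff g0 z \<Longrightarrow> norm u \<le> K"
    using g0_descent[of R] by metis
  obtain B where B: "\<And>z u. z \<in> cball 0 R \<Longrightarrow> (\<And>w. \<phi> z + inner u (w - z) \<le> \<phi> w) \<Longrightarrow> norm u \<le> B"
    using phi_subgradient_bound[of R] by metis
  have xi: "norm (\<xi> k) \<le> K" for k using K(2)[of "x k" "\<xi> k"] x_feas R xi_sub by simp
  have yx: "norm (y k j - x k) \<le> 2 * (K + B) / \<mu>min" if j: "j \<le> jk k" for k j
  proof -
    obtain u where u: "\<And>w. \<phi> (x k) + inner u (w - x k) \<le> \<phi> w"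
      using convex_subgradient_exists[OF phi_convex] by blast
    have nu: "norm u \<le> B" using B[of "x k" u] u R by simp
    define n where "n = norm (y k j - x k)"
    have n: "n \<ge> 0" by (simp add: n_def)
    have "\<mu>min / 2 * n\<^sup>2 \<le> \<mu> k j / 2 * n\<^sup>2" using mu_ge[OF j] by (intro mult_right_mono) auto
    also have "\<dots> \<le> - inner (\<xi> k) (y k j - x k) - inner u (y k j - x k)"
      using model_decrease[OF j] u[of "y k j"] by (simp add: n_def)
    also have "\<dots> \<le> norm (\<xi> k) * n + norm u * n"
      using Cauchy_Schwarz_ineq2[of "\<xi> k" "y k j - x k"] Cauchy_Schwarz_ineq2[of u "y k j - x k"] by (simp add: n_def)
    also have "\<dots> \<le> (K + B) * n" using xi[of k] nu n by (simp add: distrib_right add_mono mult_right_mono)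
    finally have "(\<mu>min / 2 * n) * n \<le> (K + B) * n" by (simp add: power2_eq_square mult.assoc)
    moreover have "0 \<le> K + B" using K(1) nu norm_ge_zero[of u] by linarith
    ultimately have "\<mu>min / 2 * n \<le> K + B"
      using n par by (cases "n = 0") (auto simp: mult_le_cancel_right)
    then show ?thesis using par by (simp add: n_def field_simps)
  qed
  then have "norm (y k j) \<le> R + \<bar>2 * (K + B) / \<mu>min\<bar>" if "j \<le> jk k" for k j
    using norm_triangle_sub[of "y k j" "x k"] R(2)[of k] yx[OF that]
      abs_ge_self[of "2 * (K + B) / \<mu>min"] by linarith
  moreover have "norm (x k) \<le> R + \<bar>2 * (K + B) / \<mu>min\<bar>" for k
    using R(2)[of k] abs_ge_zero[of "2 * (K + B) / \<mu>min"] by linarith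
  ultimately show ?thesis using that by blast
qed

lemma model_constants:
  obtains K where "K \<ge> 0" "\<And>k. norm (\<xi> k) \<le> K" "\<And>k i. norm (V k $ i) \<le> K"
    "\<And>k j i. j \<le> jk k \<Longrightarrow> g i (y k j) \<le> g i (x k) + inner (V k $ i) (y k j - x k) + K * (norm (y k j - x k))\<^sup>2"
    "\<And>k j. j \<le> jk k \<Longrightarrow> y k j \<in> feas g \<Longrightarrow> real_of_ereal (g0 (y k j)) \<le>
       real_of_ereal (g0 (x k)) + inner (\<xi> k) (y k j - x k) + K * (norm (y k j - x k))\<^sup>2"
proof -
  obtain R where R: "\<And>k. norm (x k) \<le> R" "\<And>k j. j \<le> jk k \<Longrightarrow> norm (y k j) \<le> R" using y_bound by blast
  obtain K0 where K0: "K0 \<ge> 0"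
    "\<And>z u. z \<in> feas g \<inter> cball 0 R \<Longrightarrow> u \<in> limiting_subdiff g0 z \<Longrightarrow> norm u \<le> K0"
    "\<And>z u w. z \<in> feas g \<inter> cball 0 R \<Longrightarrow> u \<in> limiting_subdiff g0 z \<Longrightarrow> w \<in> feas g \<inter> cball 0 R \<Longrightarrow>
      real_of_ereal (g0 w) \<le> real_of_ereal (g0 z) + inner u (w - z) + K0 * (norm (w - z))\<^sup>2"
    using g0_descent[of R] by metis
  obtain K1 where K1: "K1 \<ge> 0"
    "\<And>i z u. z \<in> cball 0 R \<Longrightarrow> u \<in> limiting_subdiff (\<lambda>z. ereal (g i z)) z \<Longrightarrow> norm u \<le> K1"
    "\<And>i z u w. z \<in> cball 0 R \<Longrightarrow> u \<in> limiting_subdiff (\<lambda>z. ereal (g i z)) z \<Longrightarrow> w \<in> cball 0 R \<Longrightarrow>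
      g i w \<le> g i z + inner u (w - z) + K1 * (norm (w - z))\<^sup>2"
    using g_descent[of R] by metis
  have xR: "x k \<in> feas g \<inter> cball 0 R" "x k \<in> cball 0 R" for k using R x_feas by auto
  have m0: "K0 * (norm w)\<^sup>2 \<le> (K0 + K1) * (norm w)\<^sup>2" and m1: "K1 * (norm w)\<^sup>2 \<le> (K0 + K1) * (norm w)\<^sup>2" for w :: 'a
    using K0(1) K1(1) by (auto intro: mult_right_mono)
  show ?thesis
  proof (rule that[of "K0 + K1"])
    show "0 \<le> K0 + K1" using K0(1) K1(1) by simp
    show "norm (\<xi> k) \<le> K0 + K1" for k using K0(2)[OF xR(1), of "\<xi> k"] xi_sub K1(1) by force
    show "norm (V k $ i) \<le> K0 + K1" for k i using K1(2)[OF xR(2), of "V k $ i"] V_sub K0(1) by force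
    show "g i (y k j) \<le> g i (x k) + inner (V k $ i) (y k j - x k) + (K0 + K1) * (norm (y k j - x k))\<^sup>2"
      if "j \<le> jk k" for k j i
      using K1(3)[OF xR(2), of "V k $ i" i k "y k j"] V_sub R(2)[OF that] m1[of "y k j - x k"] by force
    show "real_of_ereal (g0 (y k j)) \<le>
       real_of_ereal (g0 (x k)) + inner (\<xi> k) (y k j - x k) + (K0 + K1) * (norm (y k j - x k))\<^sup>2"
      if "j \<le> jk k" "y k j \<in> feas g" for k j
      using K0(3)[OF xR(1), of "\<xi> k" k "y k j"] xi_sub R(2)[OF that(1)] that(2) m0[of "y k j - x k"] by force
  qed
qed

text \<open>A parameter grows only after a failed test, and a test cannot fail once its parameter is
  large. Infeasibility gives information about one component of \<open>L\<close> only, while all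
  components are scaled together; the induction therefore tracks the common factor \<open>s\<close>,
  and \<open>Lmin\<close> turns the bound on a component into a bound on \<open>s\<close>.\<close>

lemma inner_loop_bounds:
  obtains S where "\<And>k. \<mu> k (jk k) \<le> S" "\<And>k i. Lmin \<le> Lk k $ i" "\<And>k i. Lk k $ i \<le> S"
proof -
  obtain K where K: "K \<ge> 0"
    "\<And>k j i. j \<le> jk k \<Longrightarrow> g i (y k j) \<le> g i (x k) + inner (V k $ i) (y k j - x k) + K * (norm (y k j - x k))\<^sup>2"
    "\<And>k j. j \<le> jk k \<Longrightarrow> y k j \<in> feas g \<Longrightarrow> real_of_ereal (g0 (y k j)) \<le>
       real_of_ereal (g0 (x k)) + inner (\<xi> k) (y k j - x k) + K * (norm (y k j - x k))\<^sup>2"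
    using model_constants by metis
  \<comment> \<open>Failure of the decrease test forces \<open>\<mu> k j < 2 * K + \<alpha>\<close>,
    and infeasibility forces \<open>s \<le> (\<beta>C + 2 * K) / Lmin\<close>; the factor
    \<open>\<tau>\<close> pays for the increase that follows, and the other entries cover the
    initial values.\<close>
  define Sm SL where "Sm = max \<mu>max (\<tau> * (2 * K + \<alpha>))" and "SL = max 1 (\<tau> * ((\<beta>C + 2 * K) / Lmin))"
  have inv: "\<mu> k j \<le> Sm \<and> (\<exists>s\<ge>1. s \<le> SL \<and> L k j = s *\<^sub>R L k 0)" if "j \<le> jk k" for k j
    using that
  proof (induction j)
    case 0 then show ?case using mu0 by (auto simp: Sm_def SL_def le_max_iff_disj intro!: exI[of _ 1])
  next
    case (Suc j)
    then obtain s where IH: "\<mu> k j \<le> Sm" "s \<ge> 1" "s \<le> SL" "L k j = s *\<^sub>R L k 0" by auto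
    from Suc.prems have j: "j < jk k" "j \<le> jk k" by auto
    note rej = reject[rule_format, OF j(1)]
    define n where "n = (norm (y k j - x k))\<^sup>2"
    have n: "n \<ge> 0" by (simp add: n_def)
    show ?case
    proof (cases "gvec g (y k j) \<in> nonpos")
      case True
      then have yf: "y k j \<in> feas g" by (simp add: feas_def)
      have "\<not> Fobj g0 g \<phi> (y k j) \<le> Fobj g0 g \<phi> (x k) - ereal (\<alpha> / 2 * (norm (y k j - x k))\<^sup>2)"
        using rej True by blast
      then have "real_of_ereal (g0 (x k)) + \<phi> (x k) - \<alpha> / 2 * n < real_of_ereal (g0 (y k j)) + \<phi> (y k j)"
        unfolding Fobj_feas[OF yf] Fobj_feas[OF x_feas] n_def by simp
      with K(3)[OF j(2) yf] model_decrease[OF j(2)]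
      have "0 < K * n + \<alpha> / 2 * n - \<mu> k j / 2 * n" by (simp add: n_def)
      then have "0 < (K + \<alpha> / 2 - \<mu> k j / 2) * n" by (simp add: algebra_simps)
      then have "0 < K + \<alpha> / 2 - \<mu> k j / 2" using n by (simp add: zero_less_mult_iff)
      then have "\<tau> * \<mu> k j \<le> \<tau> * (2 * K + \<alpha>)" using par by simp
      then show ?thesis using rej True IH by (auto simp: Sm_def)
    next
      case False
      then obtain i where i: "g i (y k j) > 0" by (auto simp: gvec_def nonpos_def not_le)
      have "pos_part_inf_norm (Gfun g (y k j) (x k) (V k) (L k j)) \<le> \<beta>C / 2 * n"
        using inexact[rule_format, OF j(2)] unfolding n_def by linarith
      then have "Gfun g (y k j) (x k) (V k) (L k j) $ i \<le> \<beta>C / 2 * n"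
        using pos_part_inf_norm_ge(1) order_trans by blast
      with K(2)[OF j(2), of i] i have "0 < \<beta>C / 2 * n + K * n - n / 2 * L k j $ i"
        by (simp add: Gfun_def n_def)
      then have "0 < (\<beta>C / 2 + K - L k j $ i / 2) * n" by (simp add: algebra_simps)
      then have "0 < \<beta>C / 2 + K - L k j $ i / 2" using n by (simp add: zero_less_mult_iff)
      then have "L k j $ i \<le> \<beta>C + 2 * K" by simp
      moreover have "s * Lmin \<le> s * L k 0 $ i" using L0 IH(2) by (intro mult_left_mono) auto
      ultimately have "s * Lmin \<le> \<beta>C + 2 * K" using IH(4) by simp
      then have "s \<le> (\<beta>C + 2 * K) / Lmin" using par by (simp add: field_simps)
      then have "\<tau> * s \<le> \<tau> * ((\<beta>C + 2 * K) / Lmin)" using par by (intro mult_left_mono) auto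
      then have "\<tau> * s \<le> SL" unfolding SL_def by (rule max.coboundedI2)
      moreover have "1 \<le> \<tau> * s" using par IH(2) mult_mono[of 1 \<tau> 1 s] by simp
      ultimately show ?thesis using rej False IH by (auto intro!: exI[of _ "\<tau> * s"])
    qed
  qed
  show ?thesis
  proof (rule that[of "max Sm (SL * Lmax)"])
    show "\<mu> k (jk k) \<le> max Sm (SL * Lmax)" for k using inv[of "jk k" k] by auto
    fix k i
    obtain s where s: "s \<ge> 1" "s \<le> SL" "Lk k = s *\<^sub>R L k 0" using inv[of "jk k" k] by auto
    have l: "Lmin \<le> L k 0 $ i" "L k 0 $ i \<le> Lmax" using L0 by auto
    have "1 * Lmin \<le> s * L k 0 $ i" using s l par by (intro mult_mono) auto
    then show "Lmin \<le> Lk k $ i" using s by simp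
    have "s * L k 0 $ i \<le> SL * Lmax" using s l par by (intro mult_mono) auto
    then show "Lk k $ i \<le> max Sm (SL * Lmax)" using s by simp
  qed
qed

lemma Lk_nonneg: "Lk k \<in> nonneg"
proof -
  obtain S where "\<And>k i. Lmin \<le> Lk k $ i" using inner_loop_bounds by metis
  then show ?thesis using par by (auto simp: nonneg_def intro: order_trans[of 0 Lmin])
qed

lemma Q_bounds:
  obtains S where "S \<ge> 0" "\<And>k d. norm (blinfun_apply (Qk k) d) \<le> S * norm d" "\<And>k. norm (Qk k) \<le> S"
proof -
  obtain S where S: "\<And>k. \<mu> k (jk k) \<le> S" using inner_loop_bounds by metis
  have "S \<ge> 0" using S[of 0] mu_ge[of "jk 0" 0] par by linarith
  have b: "norm (blinfun_apply (Qk k) d) \<le> (S + M) * norm d" for k d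
  proof (rule self_adjoint_norm_bound)
    show "self_adjoint (Qk k)" using Q_sa by blast
    show "0 \<le> inner d (blinfun_apply (Qk k) d)" for d
      using Q_lower[of "jk k" k d] par by (meson mult_nonneg_nonneg less_imp_le order_refl order_trans zero_le_power2)
    show "inner d (blinfun_apply (Qk k) d) \<le> (S + M) * (norm d)\<^sup>2" for d
      using Q_sa mult_right_mono[OF add_right_mono[OF S[of k], of M], of "(norm d)\<^sup>2"]
      by (meson order_refl order_trans zero_le_power2)
  qed
  then have "norm (Qk k) \<le> S + M" for k
    using \<open>S \<ge> 0\<close> par by (intro norm_blinfun_bound) auto
  with b show ?thesis using that[of "S + M"] \<open>S \<ge> 0\<close> par by simp
qed

section \<open>Optimality of the exact subproblem solution and its distance to the iterate\<close>

definition "uk k = (x k, Lk k, V k, \<xi> k, Qk k)"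

text \<open>Optimality of \<open>xb k\<close> with the subgradient \<open>u\<close> of
  \<open>\<phi>\<close> split off. The constraints appear through the normal cone rather than
  through multipliers, because a normal vector is what the BMP takes as input.\<close>

definition "kkt k u \<longleftrightarrow> (\<forall>z. \<phi> (xb k) + inner u (z - xb k) \<le> \<phi> z) \<and>
   - (\<xi> k + blinfun_apply (Qk k) (xb k - x k) + u) \<in> normal_cone (S_param g (uk k)) (xb k)"

lemma S_uk: "S_param g (uk k) = {z. Gfun g z (x k) (V k) (Lk k) \<in> nonpos}"
  by (simp add: S_param_def uk_def)

lemma convex_S_uk: "convex (S_param g (uk k))"
  unfolding S_uk by (rule convex_Gfun_nonpos[OF Lk_nonneg])

lemma xb_S: "xb k \<in> S_param g (uk k)" and x_S: "x k \<in> S_param g (uk k)"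
  using xbar_min x_feas[of k] by (auto simp: S_uk Gfun_self feas_def)

text \<open>Comparing \<open>xb k\<close> with points of the segment to a feasible \<open>z\<close>,
  dividing by \<open>t\<close> and letting \<open>t\<close> tend to 0 removes the quadratic term.
  What is left is an affine minorant of \<open>\<phi>\<close> on the feasible set, which the sum
  rule splits.\<close>

lemma kkt_exists: "\<exists>u. kkt k u"
proof -
  define a where "a = \<xi> k + blinfun_apply (Qk k) (xb k - x k)"
  have sa: "inner u (blinfun_apply (Qk k) w) = inner (blinfun_apply (Qk k) u) w" for u w
    using Q_sa by (simp add: self_adjoint_def)
  have foc: "\<phi> (xb k) + inner (- a) (z - xb k) \<le> \<phi> z" if z: "z \<in> S_param g (uk k)" for z
  proof -
    let ?d = "z - xb k"
    have chord: "\<phi> (xb k) - inner a ?d - t / 2 * inner ?d (blinfun_apply (Qk k) ?d) \<le> \<phi> z" if t: "0 < t" "t < 1" for t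
    proof -
      let ?w = "xb k + t *\<^sub>R ?d"
      have w: "?w = (1 - t) *\<^sub>R xb k + t *\<^sub>R z" by (simp add: algebra_simps)
      have "?w \<in> S_param g (uk k)"
        unfolding w using convexD_alt[OF convex_S_uk xb_S z, of t] t by simp
      then have "Fmodel g0 \<phi> (x k) (\<xi> k) (Qk k) (xb k) \<le> Fmodel g0 \<phi> (x k) (\<xi> k) (Qk k) ?w"
        using xbar_min by (simp add: S_uk)
      then have 1: "inner (\<xi> k) (xb k - x k) + inner (xb k - x k) (blinfun_apply (Qk k) (xb k - x k)) / 2 + \<phi> (xb k)
         \<le> inner (\<xi> k) (?w - x k) + inner (?w - x k) (blinfun_apply (Qk k) (?w - x k)) / 2 + \<phi> ?w"
        by (simp add: Fmodel_def g0_x)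
      have ww: "?w - x k = (xb k - x k) + t *\<^sub>R ?d" by simp
      have 2: "inner (\<xi> k) (?w - x k) = inner (\<xi> k) (xb k - x k) + t * inner (\<xi> k) ?d"
        unfolding ww inner_add_right by simp
      have 3: "inner (?w - x k) (blinfun_apply (Qk k) (?w - x k)) = inner (xb k - x k) (blinfun_apply (Qk k) (xb k - x k))
          + 2 * t * inner (blinfun_apply (Qk k) (xb k - x k)) ?d + t * t * inner ?d (blinfun_apply (Qk k) ?d)"
        unfolding ww blinfun.add_right blinfun.scaleR_right inner_add_left inner_add_right
          inner_scaleR_left inner_scaleR_right sa[of "xb k - x k" ?d]
          inner_commute[of ?d "blinfun_apply (Qk k) (xb k - x k)"] by (simp add: algebra_simps)
      define A1 B1 q1 P W Z where "A1 = inner (\<xi> k) ?d" and "B1 = inner (blinfun_apply (Qk k) (xb k - x k)) ?d"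
        and "q1 = inner ?d (blinfun_apply (Qk k) ?d)" and "P = \<phi> (xb k)" and "W = \<phi> ?w" and "Z = \<phi> z"
      note defs = this
      have "0 \<le> t * A1 + t * B1 + t * t * q1 / 2 + W - P"
        using 1 unfolding 2 3 defs[symmetric] by (simp add: add_divide_distrib)
      moreover have "W \<le> (1 - t) * P + t * Z"
        unfolding defs w using convex_onD[OF phi_convex, of t "xb k" z] t by simp
      moreover have "inner a ?d = A1 + B1" by (simp only: a_def inner_add_left defs)
      ultimately have "t * (P - inner a ?d - t / 2 * q1) \<le> t * Z"
        by (simp add: algebra_simps)
      then have "P - inner a ?d - t / 2 * q1 \<le> Z" using t by simp
      then show ?thesis unfolding defs .
    qed
    have "((\<lambda>t. \<phi> (xb k) - inner a ?d - t / 2 * inner ?d (blinfun_apply (Qk k) ?d))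
        \<longlongrightarrow> \<phi> (xb k) - inner a ?d - 0 / 2 * inner ?d (blinfun_apply (Qk k) ?d)) (at_right 0)"
      by (intro tendsto_intros) auto
    moreover have "\<forall>\<^sub>F t in at_right 0. \<phi> (xb k) - inner a ?d - t / 2 * inner ?d (blinfun_apply (Qk k) ?d) \<le> \<phi> z"
      using eventually_at_right_real[OF zero_less_one] by eventually_elim (use chord in auto)
    ultimately have "\<phi> (xb k) - inner a ?d - 0 / 2 * inner ?d (blinfun_apply (Qk k) ?d) \<le> \<phi> z"
      by (rule tendsto_upperbound) auto
    then show ?thesis by simp
  qed
  obtain u where "\<And>z. \<phi> (xb k) + inner u (z - xb k) \<le> \<phi> z"
    "\<And>z. z \<in> S_param g (uk k) \<Longrightarrow> inner (- a - u) (z - xb k) \<le> 0"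
    using convex_sum_rule[OF phi_convex convex_S_uk xb_S foc] by blast
  then have "kkt k u"
    unfolding kkt_def normal_cone_convex[OF convex_S_uk] a_def using xb_S by (simp add: algebra_simps)
  then show ?thesis ..
qed

text \<open>The predicted decrease is bounded below by the squared distance of \<open>xb k\<close>
  to \<open>x k\<close>, through optimality of \<open>xb k\<close> tested at \<open>x k\<close>, and
  above by \<open>(e k)\<^sup>2\<close> plus \<open>e k\<close> times that distance, through the
  inexact optimality of the accepted point. The two bounds together yield both rates.\<close>

lemma model_gap_rate:
  obtains K where "K \<ge> 0" "\<And>k. norm (xb k - x k) \<le> K * e k"
    "\<And>k. \<phi> (x k) - inner (\<xi> k) (xb k - x k) - \<phi> (xb k) \<le> K * (e k)\<^sup>2"
proof -
  obtain K where K: "K \<ge> 0"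
    "\<And>k j. j \<le> jk k \<Longrightarrow> y k j \<in> feas g \<Longrightarrow> real_of_ereal (g0 (y k j)) \<le>
       real_of_ereal (g0 (x k)) + inner (\<xi> k) (y k j - x k) + K * (norm (y k j - x k))\<^sup>2"
    using model_constants by metis
  obtain S where S: "S \<ge> 0" "\<And>k d. norm (blinfun_apply (Qk k) d) \<le> S * norm d" using Q_bounds by metis
  define A B a where "A = \<beta>S + S" and "B = \<beta>C / 2 + K" and "a = sqrt (2 / \<alpha>)"
  have nn: "A \<ge> 0" "B \<ge> 0" "a \<ge> 0" using S K par by (auto simp: A_def B_def a_def)
  define C1 C2 where "C1 = 1 + A * a\<^sup>2 + B * a\<^sup>2" and "C2 = A * a"
  have C: "C1 \<ge> 0" "C2 \<ge> 0" using nn by (auto simp: C1_def C2_def)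
  \<comment> \<open>The predicted decrease at the exact solution, without the quadratic term of the
    model.\<close>
  define gap where "gap k = \<phi> (x k) - inner (\<xi> k) (xb k - x k) - \<phi> (xb k)" for k
  have lower: "\<mu>min * (norm (xb k - x k))\<^sup>2 \<le> gap k" for k
  proof -
    obtain u where u: "kkt k u" using kkt_exists by blast
    have "inner (- (\<xi> k + blinfun_apply (Qk k) (xb k - x k) + u)) (x k - xb k) \<le> 0"
      using u x_S unfolding kkt_def normal_cone_convex[OF convex_S_uk] by blast
    then have "0 \<le> inner (\<xi> k + blinfun_apply (Qk k) (xb k - x k) + u) (x k - xb k)"
      by (simp only: inner_minus_left neg_le_0_iff_le)
    then have "inner (\<xi> k) (xb k - x k) + inner (blinfun_apply (Qk k) (xb k - x k)) (xb k - x k) \<le> inner u (x k - xb k)"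
      by (simp add: inner_add_left inner_diff_right)
    moreover have "\<phi> (xb k) + inner u (x k - xb k) \<le> \<phi> (x k)" using u by (simp add: kkt_def)
    ultimately show ?thesis
      using Q_lower[of "jk k" k "xb k - x k"] by (simp add: gap_def inner_commute)
  qed
  have upper: "gap k \<le> C1 * (e k)\<^sup>2 + C2 * e k * norm (xb k - x k)" for k
  proof -
    define d vk lk where "d = x (Suc k) - x k" and "vk = v k (jk k)" and "lk = lam k (jk k)"
    define G where "G z = Gfun g z (x k) (V k) (Lk k)" for z
    let ?y = "x (Suc k)" and ?N = "matvec (V k) lk + inner (Lk k) lk *\<^sub>R d"
    define r where "r = \<xi> k + blinfun_apply (Qk k) d + vk + matvec (V k) lk + inner (Lk k) lk *\<^sub>R d"
    have inx: "vk \<in> limiting_subdiff (\<lambda>z. ereal (\<phi> z)) ?y" "lk \<in> nonneg"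
      "max 0 (- inner lk (G ?y)) + pos_part_inf_norm (G ?y) \<le> \<beta>C / 2 * (norm d)\<^sup>2"
      "norm r \<le> \<beta>S * norm d"
      using inexact[rule_format, of "jk k" k] x_next unfolding d_def vk_def lk_def G_def r_def by auto
    have dn: "norm d \<le> a * e k" using step_le by (simp add: d_def a_def)
    \<comment> \<open>The only place where the multipliers of the inexact solution are estimated.
      The tangent at that solution lies below the constraint model, which is nonpositive at
      \<open>xb k\<close>; so the pairing is at most \<open>- inner lk (G ?y)\<close>, and the
      complementarity tolerance bounds this.\<close>
    have lam: "inner ?N (xb k - ?y) \<le> \<beta>C / 2 * (norm d)\<^sup>2"
    proof -
      have "lk $ i * (G ?y $ i + inner (V k $ i + Lk k $ i *\<^sub>R d) (xb k - ?y)) \<le> 0" for i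
      proof (rule mult_nonneg_nonpos)
        show "0 \<le> lk $ i" using inx(2) by (simp add: nonneg_def)
        have "G (xb k) $ i \<le> 0" using xb_S[of k] by (simp add: S_uk G_def nonpos_def)
        moreover have "0 \<le> Lk k $ i" using Lk_nonneg[of k] by (simp add: nonneg_def)
        ultimately show "G ?y $ i + inner (V k $ i + Lk k $ i *\<^sub>R d) (xb k - ?y) \<le> 0"
          using Gfun_tangent[of "Lk k" i g ?y "x k" "V k" "xb k"] unfolding G_def d_def by linarith
      qed
      then have "(\<Sum>i\<in>UNIV. lk $ i * (G ?y $ i + inner (V k $ i + Lk k $ i *\<^sub>R d) (xb k - ?y))) \<le> 0"
        by (intro sum_nonpos)
      then have "inner lk (G ?y) + inner ?N (xb k - ?y) \<le> 0"
        unfolding matvec_inner by (simp add: inner_vec_def distrib_left sum.distrib)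
      then show ?thesis using inx(3) pos_part_inf_norm_ge(2)[of "G ?y"] by linarith
    qed
    have yf: "y k (jk k) \<in> feas g" using x_feas[of "Suc k"] x_next by simp
    have "real_of_ereal (g0 ?y) \<le> real_of_ereal (g0 (x k)) + inner (\<xi> k) d + K * (norm d)\<^sup>2"
      using K(2)[OF order_refl yf] x_next by (simp add: d_def)
    then have 1: "Fr (Suc k) - \<phi> ?y \<le> Fr k - \<phi> (x k) + inner (\<xi> k) d + K * (norm d)\<^sup>2"
      by (simp add: Fr_def g0_x)
    have 2: "\<phi> ?y + inner vk (xb k - ?y) \<le> \<phi> (xb k)"
      using inx(1) limiting_subdiff_convex[OF phi_convex] by blast
    have 3: "inner (r - blinfun_apply (Qk k) d) (?y - xb k) \<le> A * norm d * (norm d + norm (xb k - x k))"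
    proof -
      have "inner (r - blinfun_apply (Qk k) d) (?y - xb k) \<le> norm (r - blinfun_apply (Qk k) d) * norm (?y - xb k)"
        by (rule norm_cauchy_schwarz)
      also have "\<dots> \<le> (A * norm d) * (norm d + norm (xb k - x k))"
      proof (rule mult_mono)
        show "norm (r - blinfun_apply (Qk k) d) \<le> A * norm d"
          using norm_triangle_ineq4[of r "blinfun_apply (Qk k) d"] inx(4) S(2)[of k d] by (simp add: A_def distrib_right)
        show "norm (?y - xb k) \<le> norm d + norm (xb k - x k)"
          using norm_triangle_ineq4[of d "xb k - x k"] by (simp add: d_def)
      qed (use nn in auto)
      finally show ?thesis .
    qed
    \<comment> \<open>Exact bookkeeping: the residual minus its \<open>Q\<close> term consists of
      \<open>\<xi> k\<close>, \<open>vk\<close> and the multiplier vector \<open>?N\<close>, and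
      pairing with \<open>?y - xb k\<close> exposes the terms missing in \<open>gap\<close>.\<close>
    have 4: "inner (r - blinfun_apply (Qk k) d) (?y - xb k) + inner ?N (xb k - ?y)
        = inner (\<xi> k) d - inner (\<xi> k) (xb k - x k) - inner vk (xb k - ?y)"
    proof -
      define U where "U = ?y - xb k"
      have U: "xb k - ?y = - U" "U = d - (xb k - x k)" by (simp_all add: U_def d_def)
      have rN: "r - blinfun_apply (Qk k) d = (\<xi> k + vk) + ?N" by (simp add: r_def)
      have "inner (r - blinfun_apply (Qk k) d) U + inner ?N (- U) = inner (\<xi> k) U + inner vk U"
        unfolding rN inner_add_left[of _ ?N] by (simp add: inner_add_left)
      moreover have "inner (\<xi> k) U = inner (\<xi> k) d - inner (\<xi> k) (xb k - x k)"
        unfolding U(2) by (rule inner_diff_right)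
      ultimately show ?thesis unfolding U(1) U_def[symmetric] by simp
    qed
    have "gap k \<le> (e k)\<^sup>2 + A * norm d * (norm d + norm (xb k - x k)) + B * (norm d)\<^sup>2"
      using 1 2 3 4 lam by (simp add: gap_def e_sq B_def distrib_right)
    also have "\<dots> \<le> (e k)\<^sup>2 + A * (a * e k) * (a * e k + norm (xb k - x k)) + B * (a * e k)\<^sup>2"
      using dn nn e_ge[of k] by (intro add_mono mult_mono order_refl mult_left_mono power_mono) auto
    also have "\<dots> = C1 * (e k)\<^sup>2 + C2 * e k * norm (xb k - x k)"
      by (simp add: C1_def C2_def algebra_simps power2_eq_square)
    finally show ?thesis .
  qed
  define K' where "K' = 1 + (C1 + C2) / \<mu>min"
  have K': "K' \<ge> 0" using C par by (simp add: K'_def)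
  have rate: "norm (xb k - x k) \<le> K' * e k" for k
    unfolding K'_def using lower[of k] upper[of k] C par e_ge[of k] by (intro quadratic_rate) auto
  have "gap k \<le> (C1 + C2 * K') * (e k)\<^sup>2" for k
  proof -
    have "C2 * e k * norm (xb k - x k) \<le> C2 * e k * (K' * e k)"
      using rate[of k] C e_ge[of k] by (intro mult_left_mono) auto
    with upper[of k] show ?thesis by (simp add: power2_eq_square algebra_simps)
  qed
  moreover have "(C1 + C2 * K') * (e k)\<^sup>2 \<le> max K' (C1 + C2 * K') * (e k)\<^sup>2" for k
    by (intro mult_right_mono) auto
  moreover have "K' * e k \<le> max K' (C1 + C2 * K') * e k" for k
    using e_ge[of k] by (intro mult_right_mono) auto
  ultimately show ?thesis
    using that[of "max K' (C1 + C2 * K')"] rate K' unfolding gap_def by (meson le_max_iff_disj order_trans)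
qed

section \<open>Multipliers and the rate of the subgradients\<close>

definition "Fs = lim Fr"

lemma Fr_tendsto: "Fr \<longlonglongrightarrow> Fs" and Fs_le: "Fs \<le> Fr k"
proof -
  obtain b where "\<And>z. z \<in> feas g \<Longrightarrow> Fobj g0 g \<phi> z \<ge> ereal b" using F_bdd by blast
  then have "b \<le> Fr k" for k using x_feas[of k] Fobj_x[of k] by (metis ereal_less_eq(3))
  moreover have "decseq Fr" using Fr_le by (simp add: decseq_Suc_iff)
  ultimately obtain l where l: "Fr \<longlonglongrightarrow> l" "\<forall>i. l \<le> Fr i" by (metis decseq_convergent)
  then have "Fs = l" unfolding Fs_def by (simp add: limI)
  with l show "Fr \<longlonglongrightarrow> Fs" "Fs \<le> Fr k" by auto
qed

lemma e_tendsto: "e \<longlonglongrightarrow> 0"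
proof -
  have "(\<lambda>k. sqrt (Fr k - Fr (Suc k))) \<longlonglongrightarrow> sqrt (Fs - Fs)"
    by (intro tendsto_intros Fr_tendsto LIMSEQ_Suc)
  then show ?thesis by (simp add: e_def[abs_def])
qed

lemma rate_tendsto:
  fixes z :: "nat \<Rightarrow> 'b::real_normed_vector"
  assumes "\<And>k. norm (z k) \<le> K * e k"
  shows "z \<longlonglongrightarrow> 0"
proof (rule Lim_null_comparison)
  show "\<forall>\<^sub>F k in sequentially. norm (z k) \<le> K * e k" using assms by simp
  show "(\<lambda>k. K * e k) \<longlonglongrightarrow> 0" using tendsto_mult_right_zero[OF e_tendsto] by simp
qed

lemma step_tendsto: "(\<lambda>k. x (Suc k) - x k) \<longlonglongrightarrow> 0"
  by (rule rate_tendsto[OF step_le])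

lemma xb_x_tendsto: "(\<lambda>k. xb k - x k) \<longlonglongrightarrow> 0"
proof -
  obtain K where "\<And>k. norm (xb k - x k) \<le> K * e k" using model_gap_rate by metis
  then show ?thesis by (rule rate_tendsto)
qed

lemma data_bounds:
  obtains R where "R \<ge> 0" "\<And>k. norm (x k) \<le> R" "\<And>k. norm (xb k) \<le> R" "\<And>k. norm (xb k - x k) \<le> R"
    "\<And>k. norm (x (Suc k) - x k) \<le> R"
    "\<And>k. norm (\<xi> k) \<le> R" "\<And>k. norm (V k) \<le> R" "\<And>k. norm (Lk k) \<le> R" "\<And>k. norm (Qk k) \<le> R"
    "\<And>k d. norm (blinfun_apply (Qk k) d) \<le> R * norm d"
proof -
  obtain R1 where R1: "R1 \<ge> 0" "\<And>k. norm (x k) \<le> R1" using x_bound by blast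
  obtain R2 where R2: "\<And>k. norm (xb k - x k) \<le> R2"
    using convergent_imp_bounded[OF xb_x_tendsto] unfolding bounded_iff by blast
  obtain K where K: "\<And>k. norm (\<xi> k) \<le> K" "\<And>k i. norm (V k $ i) \<le> K" using model_constants by metis
  obtain S where S: "\<And>k i. Lmin \<le> Lk k $ i" "\<And>k i. Lk k $ i \<le> S" using inner_loop_bounds by metis
  obtain S' where S': "S' \<ge> 0" "\<And>k d. norm (blinfun_apply (Qk k) d) \<le> S' * norm d" "\<And>k. norm (Qk k) \<le> S'"
    using Q_bounds by metis
  define m where "m = real CARD('m)"
  have V: "norm (V k) \<le> m * K" for k unfolding m_def by (rule norm_vec_le_sum[OF K(2)])
  have L: "norm (Lk k) \<le> m * S" for k
    unfolding m_def
  proof (rule norm_vec_le_sum)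
    fix i
    have "0 \<le> Lk k $ i" using S(1)[of k i] par(3) by linarith
    then show "norm (Lk k $ i) \<le> S" using S(2)[of k i] by simp
  qed
  have nn: "0 \<le> R2" "0 \<le> K" "0 \<le> m * K" "0 \<le> m * S"
    using norm_ge_zero R2 K(1) V L by (meson order_trans)+
  have xb: "norm (xb k) \<le> R1 + R2" for k using norm_triangle_sub[of "xb k" "x k"] R1(2)[of k] R2[of k] by linarith
  define R where "R = 2 * R1 + R2 + K + m * K + m * S + S'"
  have RR: "R1 \<le> R" "R2 \<le> R" "R1 + R2 \<le> R" "2 * R1 \<le> R" "K \<le> R" "m * K \<le> R" "m * S \<le> R" "S' \<le> R" "0 \<le> R"
    using nn R1(1) S'(1) by (auto simp: R_def)
  show ?thesis
  proof (rule that[of R])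
    show "norm (x (Suc k) - x k) \<le> R" for k
      using norm_triangle_ineq4[of "x (Suc k)" "x k"] R1(2)[of k] R1(2)[of "Suc k"] RR by linarith
    show "norm (blinfun_apply (Qk k) d) \<le> R * norm d" for k d
      using S'(2)[of k d] mult_right_mono[OF RR(8), of "norm d"] by simp
  qed (use RR R1 R2 K V L S' xb order_trans in blast)+
qed

lemma bounded_w: "bounded (range (\<lambda>k. ((xb k, x k, V k, Lk k, \<xi> k), x (Suc k) - x k)))"
proof -
  obtain R where "\<And>k. norm (x k) \<le> R" "\<And>k. norm (xb k) \<le> R"
    "\<And>k. norm (x (Suc k) - x k) \<le> R"
    "\<And>k. norm (\<xi> k) \<le> R" "\<And>k. norm (V k) \<le> R" "\<And>k. norm (Lk k) \<le> R"
    using data_bounds by metis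
  then have "norm ((xb k, x k, V k, Lk k, \<xi> k), x (Suc k) - x k) \<le> (R + (R + (R + (R + R)))) + R" for k
    by (intro norm_Pair_le_add)
  then show ?thesis unfolding bounded_iff by blast
qed

lemma bounded_u: "bounded (range (\<lambda>k. (uk k, xb k)))"
proof -
  obtain R where "\<And>k. norm (x k) \<le> R" "\<And>k. norm (xb k) \<le> R"
    "\<And>k. norm (\<xi> k) \<le> R" "\<And>k. norm (V k) \<le> R" "\<And>k. norm (Lk k) \<le> R" "\<And>k. norm (Qk k) \<le> R"
    using data_bounds by metis
  then have "norm (uk k, xb k) \<le> (R + (R + (R + (R + R)))) + R" for k
    unfolding uk_def by (intro norm_Pair_le_add)
  then show ?thesis unfolding bounded_iff by blast
qed

lemma in_U_uk: "in_U (uk k)"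
proof -
  have "0 \<le> inner d (blinfun_apply (Qk k) d)" for d
  proof -
    have "0 \<le> \<mu>min * (norm d)\<^sup>2" using par by simp
    then show ?thesis using Q_lower[of "jk k" k d] by simp
  qed
  then show ?thesis using Lk_nonneg Q_sa by (simp add: in_U_def uk_def psd_def)
qed

text \<open>Membership in \<open>Lambda_param\<close> at \<open>xb k\<close> for the normal vector
  in \<open>kkt k u\<close>, with the normal cone of the orthant spelled out as sign and
  complementarity conditions.\<close>

definition "multiplier k u lm \<longleftrightarrow> lm \<in> nonneg \<and> (\<forall>i. lm $ i * Gfun g (xb k) (x k) (V k) (Lk k) $ i = 0) \<and>
   matvec (V k) lm + inner (Lk k) lm *\<^sub>R (xb k - x k) = - (\<xi> k + blinfun_apply (Qk k) (xb k - x k) + u)"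

text \<open>The BMP bounds some multiplier by a constant times the norm of the normal vector, near
  each cluster point with its own constant. These normal vectors are uniformly bounded, and finitely
  many neighbourhoods contain all late terms.\<close>

lemma bounded_multipliers:
  obtains B N where "B \<ge> 0"
    "\<And>k. k \<ge> N \<Longrightarrow> \<exists>u lm. kkt k u \<and> norm u \<le> B \<and> multiplier k u lm \<and> norm lm \<le> B"
proof -
  obtain R where R: "R \<ge> 0" "\<And>k. norm (xb k) \<le> R" "\<And>k. norm (xb k - x k) \<le> R"
    "\<And>k. norm (\<xi> k) \<le> R" "\<And>k d. norm (blinfun_apply (Qk k) d) \<le> R * norm d"
    using data_bounds by metis
  obtain B where B: "\<And>z u. z \<in> cball 0 R \<Longrightarrow> (\<And>w. \<phi> z + inner u (w - z) \<le> \<phi> w) \<Longrightarrow> norm u \<le> B"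
    using phi_subgradient_bound[of R] by metis
  have uB: "norm u \<le> B" if "kkt k u" for k u using B[of "xb k" u] R(2) that by (simp add: kkt_def)
  define B' where "B' = R + R * R + B"
  have yB: "norm (- (\<xi> k + blinfun_apply (Qk k) (xb k - x k) + u)) \<le> B'" if "kkt k u" for k u
  proof -
    have "norm (\<xi> k + blinfun_apply (Qk k) (xb k - x k) + u) \<le> norm (\<xi> k) + norm (blinfun_apply (Qk k) (xb k - x k)) + norm u"
      by (meson add_right_mono norm_triangle_ineq order_trans)
    moreover have "norm (blinfun_apply (Qk k) (xb k - x k)) \<le> R * R"
      using R(5)[of k "xb k - x k"] mult_left_mono[OF R(3)[of k] R(1)] by linarith
    ultimately show ?thesis using R(4)[of k] uB[OF that] by (simp only: B'_def norm_minus_cancel)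
  qed
  define s where "s k = (uk k, xb k)" for k
  define good where "good \<kappa> k \<longleftrightarrow> (\<forall>u. kkt k u \<longrightarrow> (\<exists>lm. multiplier k u lm \<and>
      norm lm \<le> \<kappa> * norm (- (\<xi> k + blinfun_apply (Qk k) (xb k - x k) + u))))" for \<kappa> k
  have loc: "\<exists>q. open (fst q) \<and> p \<in> fst q \<and> (\<forall>k. s k \<in> fst q \<longrightarrow> good (snd q) k)"
    if p: "p \<in> cluster_points s" for p
  proof -
    have "partial_BMP g (fst p) (snd p)" using A4 p unfolding s_def[abs_def] uk_def by blast
    then obtain \<kappa> UU VV where op: "open UU" "fst p \<in> UU" "open VV" "snd p \<in> VV"
      and bmp: "\<And>u x y. u \<in> UU \<Longrightarrow> in_U u \<Longrightarrow> x \<in> VV \<inter> S_param g u \<Longrightarrow> y \<in> normal_cone (S_param g u) x \<Longrightarrow>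
           (\<exists>lam\<in>Lambda_param g u x y. norm lam \<le> \<kappa> * norm y)"
      unfolding partial_BMP_def by metis
    have "good \<kappa> k" if "s k \<in> UU \<times> VV" for k
      unfolding good_def
    proof (intro allI impI)
      fix u assume u: "kkt k u"
      let ?y = "- (\<xi> k + blinfun_apply (Qk k) (xb k - x k) + u)"
      have y: "?y \<in> normal_cone (S_param g (uk k)) (xb k)" using u unfolding kkt_def by blast
      have "uk k \<in> UU" "xb k \<in> VV \<inter> S_param g (uk k)" using xb_S that by (auto simp: s_def)
      from bmp[OF this(1) in_U_uk this(2) y]
      obtain lm where lm: "lm \<in> Lambda_param g (uk k) (xb k) ?y" "norm lm \<le> \<kappa> * norm ?y" by blast
      then have "multiplier k u lm"
        by (auto simp: Lambda_param_def uk_def normal_cone_nonpos multiplier_def)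
      with lm show "\<exists>lm. multiplier k u lm \<and> norm lm \<le> \<kappa> * norm ?y" by blast
    qed
    then show ?thesis using op by (intro exI[of _ "(UU \<times> VV, \<kappa>)"]) (auto simp: open_Times mem_Times_iff)
  qed
  then have "\<forall>p\<in>cluster_points s. \<exists>q. open (fst q) \<and> p \<in> fst q \<and> (\<forall>k. s k \<in> fst q \<longrightarrow> good (snd q) k)"
    by blast
  from bchoice[OF this] obtain q where q: "\<And>p. p \<in> cluster_points s \<Longrightarrow> open (fst (q p)) \<and> p \<in> fst (q p)"
    "\<And>p k. p \<in> cluster_points s \<Longrightarrow> s k \<in> fst (q p) \<Longrightarrow> good (snd (q p)) k" by blast
  have "bounded (range s)" unfolding s_def[abs_def] by (rule bounded_u)
  from cluster_points_finite_cover[OF this, of "\<lambda>p. fst (q p)"] q(1)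
  obtain I N where I: "finite I" "I \<subseteq> cluster_points s" "\<And>k. k \<ge> N \<Longrightarrow> \<exists>p\<in>I. s k \<in> fst (q p)" by metis
  \<comment> \<open>The sum of absolute values dominates each of the finitely many local
    constants.\<close>
  define \<kappa> where "\<kappa> = (\<Sum>p\<in>I. \<bar>snd (q p)\<bar>)"
  have k0: "\<kappa> \<ge> 0" by (simp add: \<kappa>_def sum_nonneg)
  show ?thesis
  proof (rule that[of "max B (\<kappa> * B')" N])
    obtain u where "kkt 0 u" using kkt_exists by blast
    then show "0 \<le> max B (\<kappa> * B')" using uB[of 0 u] norm_ge_zero[of u] by linarith
    fix k assume "k \<ge> N"
    then obtain p where p: "p \<in> I" "s k \<in> fst (q p)" using I(3) by blast
    obtain u where u: "kkt k u" using kkt_exists by blast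
    have "good (snd (q p)) k" using q(2) p I(2) by blast
    then obtain lm where lm: "multiplier k u lm"
      "norm lm \<le> snd (q p) * norm (- (\<xi> k + blinfun_apply (Qk k) (xb k - x k) + u))"
      using u unfolding good_def by blast
    have "snd (q p) \<le> \<bar>snd (q p)\<bar>" by simp
    also have "\<dots> \<le> \<kappa>" unfolding \<kappa>_def using p I(1) by (intro member_le_sum) auto
    finally have "norm lm \<le> \<kappa> * B'"
      using lm(2) yB[OF u] k0 by (meson mult_mono norm_ge_zero order_trans)
    then show "\<exists>u lm. kkt k u \<and> norm u \<le> max B (\<kappa> * B') \<and> multiplier k u lm \<and> norm lm \<le> max B (\<kappa> * B')"
      using u uB[OF u] lm(1) by (auto simp: le_max_iff_disj)
  qed
qed

section \<open>The potential along the iterates\<close>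

lemma x_dc: "g i (x k) = f i (x k) - h i (x k)" using dc D_sub by blast

lemma Phi_le:
  assumes "k \<ge> khat"
  shows "Phi \<phi> f0 h0 f h (xb k, x k, V k, Lk k, \<xi> k) \<le> ereal (Fr k)"
    and "ereal (Fr (Suc k) - c * (norm (x (Suc k) - x k))\<^sup>2) \<le> Phi \<phi> f0 h0 f h (xb k, x k, V k, Lk k, \<xi> k)"
    and "Phi \<phi> f0 h0 f h (xb k, x k, V k, Lk k, \<xi> k) \<noteq> \<infinity>"
proof -
  show 1: "Phi \<phi> f0 h0 f h (xb k, x k, V k, Lk k, \<xi> k) \<le> ereal (Fr k)"
    using sandwich[rule_format, OF assms] Fobj_x[of k] by simp
  show "ereal (Fr (Suc k) - c * (norm (x (Suc k) - x k))\<^sup>2) \<le> Phi \<phi> f0 h0 f h (xb k, x k, V k, Lk k, \<xi> k)"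
    using sandwich[rule_format, OF assms] Fobj_x[of "Suc k"] by simp
  show "Phi \<phi> f0 h0 f h (xb k, x k, V k, Lk k, \<xi> k) \<noteq> \<infinity>" using 1 by auto
qed

text \<open>The Fenchel gap of \<open>h0\<close> at \<open>x k\<close> is at most the model decrease, so strong convexity puts the
  maximizer \<open>p\<close> within \<open>O(e k)\<close> of \<open>x k\<close>, even when \<open>- \<xi> k + grad f0 (x k)\<close> is no
  subgradient of \<open>h0\<close> (the decomposition is only known on \<open>D\<close>, which may have empty interior).\<close>
lemma conjugate_maximizer_rate:
  obtains K where "K \<ge> 0"
    "\<And>k. k \<ge> khat \<Longrightarrow> \<exists>p. fconj h0 (- \<xi> k + grad f0 (x k)) = ereal (inner (- \<xi> k + grad f0 (x k)) p - h0 p) \<and>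
       norm (x k - p) \<le> K * e k"
proof -
  obtain K where K: "K \<ge> 0" "\<And>k. \<phi> (x k) - inner (\<xi> k) (xb k - x k) - \<phi> (xb k) \<le> K * (e k)\<^sup>2"
    using model_gap_rate by metis
  obtain \<sigma> where \<sigma>: "\<sigma> > 0" "\<And>q. \<exists>p. fconj h0 q = ereal (inner q p - h0 p) \<and>
        (\<forall>z. inner q z - h0 z + \<sigma> / 2 * (norm (z - p))\<^sup>2 \<le> inner q p - h0 p)"
    using strongly_convex_fconj[OF hsc(1)] by metis
  show ?thesis
  proof (rule that[of "sqrt (2 * K / \<sigma>)"])
    show "0 \<le> sqrt (2 * K / \<sigma>)" using K \<sigma> by simp
    fix k assume k: "k \<ge> khat"
    define q where "q = - \<xi> k + grad f0 (x k)"
    obtain p where p: "fconj h0 q = ereal (inner q p - h0 p)"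
      "\<And>z. inner q z - h0 z + \<sigma> / 2 * (norm (z - p))\<^sup>2 \<le> inner q p - h0 p" using \<sigma>(2) by blast
    \<comment> \<open>The upper half of the sandwich, with the conjugate evaluated at
      \<open>p\<close>. Replacing \<open>p\<close> by \<open>x k\<close> changes the value by
      exactly the Fenchel gap and turns the rest into the linearized objective.\<close>
    have "ereal (\<phi> (xb k) + T0_aff f0 h0 p (xb k) (x k) (\<xi> k)) \<le> ereal (Fr k)"
      using Phi_lower Phi_le(1)[OF k] order_trans by blast
    then have "\<phi> (xb k) + T0_aff f0 h0 p (xb k) (x k) (\<xi> k) \<le> Fr k" by simp
    moreover have "T0_aff f0 h0 p (xb k) (x k) (\<xi> k) - T0_aff f0 h0 (x k) (xb k) (x k) (\<xi> k)
        = (inner q p - h0 p) - (inner q (x k) - h0 (x k))"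
      by (simp add: T0_aff_def q_def)
    ultimately have "\<sigma> / 2 * (norm (x k - p))\<^sup>2 \<le> K * (e k)\<^sup>2"
      using p(2)[of "x k"] K(2)[of k] T0_aff_self[of f0 h0 "x k" "xb k" "\<xi> k"] by (simp add: Fr_def)
    then have "(norm (x k - p))\<^sup>2 \<le> 2 * K / \<sigma> * (e k)\<^sup>2" using \<sigma>(1) by (simp add: field_simps)
    then have "norm (x k - p) \<le> sqrt (2 * K / \<sigma> * (e k)\<^sup>2)" by (rule real_le_rsqrt)
    also have "\<dots> = sqrt (2 * K / \<sigma>) * e k" unfolding real_sqrt_mult using e_ge[of k] by simp
    finally show "\<exists>p. fconj h0 (- \<xi> k + grad f0 (x k)) = ereal (inner (- \<xi> k + grad f0 (x k)) p - h0 p) \<and>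
       norm (x k - p) \<le> sqrt (2 * K / \<sigma>) * e k" using p(1) unfolding q_def by blast
  qed
qed

text \<open>Each block of the explicit subgradient carries a factor of size \<open>O(e k)\<close>:
  \<open>xb k - x k\<close>, the distance from the conjugate maximizer \<open>p\<close>, or the
  step. The accompanying multipliers, matrices and linear maps are bounded.\<close>

lemma subgradient_rate:
  obtains K N where "K \<ge> 0" "N \<ge> khat"
    "\<And>k. k \<ge> N \<Longrightarrow> \<exists>P \<in> limiting_subdiff (Phi_c \<phi> f0 h0 f h c) ((xb k, x k, V k, Lk k, \<xi> k), x (Suc k) - x k).
        norm P \<le> K * e k"
proof -
  obtain R where R: "R \<ge> 0" "\<And>k. norm (xb k - x k) \<le> R" "\<And>k. norm (Lk k) \<le> R"
    "\<And>k d. norm (blinfun_apply (Qk k) d) \<le> R * norm d" using data_bounds by metis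
  obtain K1 where K1: "K1 \<ge> 0" "\<And>k. norm (xb k - x k) \<le> K1 * e k" using model_gap_rate by metis
  obtain K2 where K2: "K2 \<ge> 0"
    "\<And>k. k \<ge> khat \<Longrightarrow> \<exists>p. fconj h0 (- \<xi> k + grad f0 (x k)) = ereal (inner (- \<xi> k + grad f0 (x k)) p - h0 p) \<and>
       norm (x k - p) \<le> K2 * e k" using conjugate_maximizer_rate by metis
  obtain B N where B: "B \<ge> 0"
    "\<And>k. k \<ge> N \<Longrightarrow> \<exists>u lm. kkt k u \<and> norm u \<le> B \<and> multiplier k u lm \<and> norm lm \<le> B"
    using bounded_multipliers by metis
  obtain A0 b0 c0 where A0: "self_adjoint A0" "\<And>s. grad f0 s = blinfun_apply A0 s + b0"
      "\<And>s. f0 s = inner s (blinfun_apply A0 s) / 2 + inner b0 s + c0"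
    using strongly_convex_quadratic_grad[OF fq(1)] by metis
  have "\<exists>A b ct. self_adjoint A \<and> (\<forall>s. grad (f i) s = blinfun_apply A s + b) \<and>
      (\<forall>s. f i s = inner s (blinfun_apply A s) / 2 + inner b s + ct)" for i
    using strongly_convex_quadratic_grad[OF fq(2)[rule_format, of i]] by metis
  then obtain A b ct where A: "\<And>i. self_adjoint (A i)" "\<And>i s. grad (f i) s = blinfun_apply (A i) s + b i"
      "\<And>i s. f i s = inner s (blinfun_apply (A i) s) / 2 + inner (b i) s + ct i" by metis
  define m where "m = real CARD('m)"
  define a where "a = sqrt (2 / \<alpha>)"
  define K where "K = (R * K1 + ((norm A0 * K2 + R * B * K1) + (m * (B * K1) + (m * (B * (R * K1)) + (K1 + K2))))) + 2 * c * a"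
  show ?thesis
  proof (rule that[of K "max N khat"])
    show "0 \<le> K" using R(1) K1(1) K2(1) B(1) c_pos par by (simp add: K_def m_def a_def)
    show "khat \<le> max N khat" by simp
    fix k assume "max N khat \<le> k"
    then have k: "N \<le> k" "khat \<le> k" by auto
    obtain p where p: "fconj h0 (- \<xi> k + grad f0 (x k)) = ereal (inner (- \<xi> k + grad f0 (x k)) p - h0 p)"
      "norm (x k - p) \<le> K2 * e k" using K2(2)[OF k(2)] by blast
    obtain u lm where u: "kkt k u" and lm: "multiplier k u lm" "norm lm \<le> B" using B(2)[OF k(1)] by blast
    let ?xx = "xb k - x k" and ?d = "x (Suc k) - x k"
    let ?P = "((u + \<xi> k + matvec (V k) lm + inner (Lk k) lm *\<^sub>R (xb k - x k),
           blinfun_apply A0 (p - x k) + inner (Lk k) lm *\<^sub>R (x k - xb k),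
           (\<chi> i. lm $ i *\<^sub>R (xb k - x k)), (\<chi> i. lm $ i * ((norm (xb k - x k))\<^sup>2 / 2)), xb k - p), (2 * c) *\<^sub>R ?d)"
    have "?P \<in> frechet_subdiff (Phi_c \<phi> f0 h0 f h c) ((xb k, x k, V k, Lk k, \<xi> k), ?d)"
    proof (rule Phi_c_subgradient[OF Phi_le(3)[OF k(2)] _ p(1) _ _ A0 A])
      show "\<phi> (xb k) + inner u (z - xb k) \<le> \<phi> z" for z using u by (simp add: kkt_def)
      show "0 \<le> lm $ i" for i using lm(1) by (simp add: multiplier_def nonneg_def)
      show "lm $ i * T_aff f h (x k) (xb k) (x k) (V k) (Lk k) i = 0" for i
        using lm(1) unfolding T_aff_self[where g = g and i = i and f = f and h = h and s = "x k", OF x_dc] by (simp add: multiplier_def)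
    qed
    then have mem: "?P \<in> limiting_subdiff (Phi_c \<phi> f0 h0 f h c) ((xb k, x k, V k, Lk k, \<xi> k), ?d)"
      by (rule frechet_imp_limiting)
    have xx: "norm ?xx \<le> K1 * e k" "norm (x k - xb k) \<le> K1 * e k"
      using K1(2)[of k] by (auto simp: norm_minus_commute)
    have lmi: "\<bar>lm $ i\<bar> \<le> B" for i using component_le_norm_cart[of lm i] lm(2) by linarith
    \<comment> \<open>The multiplier equation collapses this block to minus \<open>Qk k\<close>
      applied to \<open>xb k - x k\<close>; without that cancellation it would not be small.\<close>
    have n1: "norm (u + \<xi> k + matvec (V k) lm + inner (Lk k) lm *\<^sub>R ?xx) \<le> R * K1 * e k"
    proof -
      have "u + \<xi> k + matvec (V k) lm + inner (Lk k) lm *\<^sub>R ?xx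
          = u + \<xi> k + (matvec (V k) lm + inner (Lk k) lm *\<^sub>R ?xx)" by simp
      also have "\<dots> = - blinfun_apply (Qk k) ?xx"
        using lm(1) unfolding multiplier_def by (elim conjE) (simp only:, simp)
      finally have "norm (u + \<xi> k + matvec (V k) lm + inner (Lk k) lm *\<^sub>R ?xx) \<le> R * norm ?xx"
        using R(4)[of k ?xx] by (simp only: norm_minus_cancel)
      also have "\<dots> \<le> R * (K1 * e k)" using xx R(1) by (intro mult_left_mono)
      finally show ?thesis by simp
    qed
    have n2: "norm (blinfun_apply A0 (p - x k) + inner (Lk k) lm *\<^sub>R (x k - xb k)) \<le> (norm A0 * K2 + R * B * K1) * e k"
    proof -
      have "norm (blinfun_apply A0 (p - x k)) \<le> norm A0 * norm (p - x k)" by (rule norm_blinfun)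
      also have "\<dots> \<le> norm A0 * (K2 * e k)" using p(2) by (intro mult_left_mono) (auto simp: norm_minus_commute)
      finally have 1: "norm (blinfun_apply A0 (p - x k)) \<le> norm A0 * (K2 * e k)" .
      have "\<bar>inner (Lk k) lm\<bar> \<le> norm (Lk k) * norm lm" by (rule Cauchy_Schwarz_ineq2)
      also have "\<dots> \<le> R * B" using R(1,3) lm(2) by (intro mult_mono) auto
      finally have "\<bar>inner (Lk k) lm\<bar> * norm (x k - xb k) \<le> (R * B) * (K1 * e k)"
        using xx R(1) B(1) by (intro mult_mono) auto
      then have 2: "norm (inner (Lk k) lm *\<^sub>R (x k - xb k)) \<le> R * B * (K1 * e k)" by simp
      show ?thesis using norm_add_rule_thm[OF 1 2] by (simp add: algebra_simps)
    qed
    have n3: "norm (\<chi> i. lm $ i *\<^sub>R ?xx) \<le> m * (B * K1) * e k"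
    proof -
      have "norm ((\<chi> i. lm $ i *\<^sub>R ?xx) $ i) \<le> B * (K1 * e k)" for i
        using lmi[of i] xx B(1) by (simp add: mult_mono)
      from norm_vec_le_sum[OF this] show ?thesis by (simp add: m_def mult.assoc)
    qed
    have n4: "norm (\<chi> i. lm $ i * ((norm ?xx)\<^sup>2 / 2)) \<le> m * (B * (R * K1)) * e k"
    proof -
      have sq: "(norm ?xx)\<^sup>2 / 2 \<le> R * (K1 * e k)"
      proof -
        have "(norm ?xx)\<^sup>2 \<le> R * (K1 * e k)" unfolding power2_eq_square
          using xx R(1) R(2)[of k] by (intro mult_mono) auto
        moreover have "0 \<le> (norm ?xx)\<^sup>2" by simp
        ultimately show ?thesis by linarith
      qed
      have "norm ((\<chi> i. lm $ i * ((norm ?xx)\<^sup>2 / 2)) $ i) \<le> B * (R * (K1 * e k))" for i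
      proof -
        have "\<bar>lm $ i\<bar> * ((norm ?xx)\<^sup>2 / 2) \<le> B * (R * (K1 * e k))"
          using lmi[of i] sq B(1) by (intro mult_mono) auto
        then show ?thesis by (simp add: abs_mult)
      qed
      from norm_vec_le_sum[OF this] show ?thesis by (simp add: m_def mult.assoc)
    qed
    have n5: "norm (xb k - p) \<le> (K1 + K2) * e k"
      using norm_triangle_ineq[of "xb k - x k" "x k - p"] xx(1) p(2) by (simp add: distrib_right)
    have n6: "norm ((2 * c) *\<^sub>R ?d) \<le> 2 * c * a * e k"
      using step_le[of k] c_pos by (simp add: a_def)
    have "norm ?P \<le> (R * K1 * e k + ((norm A0 * K2 + R * B * K1) * e k + (m * (B * K1) * e k + (m * (B * (R * K1)) * e k + (K1 + K2) * e k)))) + 2 * c * a * e k"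
      by (intro norm_Pair_le_add n1 n2 n3 n4 n5 n6)
    also have "\<dots> = K * e k" by (simp only: K_def distrib_right)
    finally show "\<exists>P \<in> limiting_subdiff (Phi_c \<phi> f0 h0 f h c) ((xb k, x k, V k, Lk k, \<xi> k), ?d). norm P \<le> K * e k"
      using mem by blast
  qed
qed

section \<open>Convergence\<close>

text \<open>Freezing the conjugate maximizer of the limit point gives continuous minorants, so the
  feasibility of the potential and its upper bound by \<open>Fr\<close> pass to the limit. For the
  lower bound the candidate is \<open>S\<close> itself: since \<open>X = S\<close>, the minorant
  equals the objective there, which is \<open>Fs\<close> by continuity.\<close>

lemma cluster_value:
  assumes "w \<in> cluster_points (\<lambda>k. ((xb k, x k, V k, Lk k, \<xi> k), x (Suc k) - x k))"
  shows "Phi_c \<phi> f0 h0 f h c w = ereal Fs"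
proof -
  obtain X S W l \<Xi> d where w: "w = ((X, S, W, l, \<Xi>), d)" by (metis prod.exhaust)
  obtain r where r: "strict_mono r"
    and lim: "((\<lambda>k. ((xb k, x k, V k, Lk k, \<xi> k), x (Suc k) - x k)) \<circ> r) \<longlonglongrightarrow> w"
    using assms unfolding cluster_points_def by blast
  have sub: "(\<lambda>k. z (r k)) \<longlonglongrightarrow> a" if "z \<longlonglongrightarrow> a" for z :: "nat \<Rightarrow> 'z::topological_space" and a
    using LIMSEQ_subseq_LIMSEQ[OF that r] by (simp add: o_def)
  have lim1: "(\<lambda>k. ((xb (r k), x (r k), V (r k), Lk (r k), \<xi> (r k)), x (Suc (r k)) - x (r k))) \<longlonglongrightarrow> ((X, S, W, l, \<Xi>), d)"
    using lim by (simp add: o_def w)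
  note lim2 = tendsto_fst[OF lim1, simplified]
  note lim3 = tendsto_snd[OF lim2, simplified]
  note lim4 = tendsto_snd[OF lim3, simplified]
  note lim5 = tendsto_snd[OF lim4, simplified]
  have lx: "(\<lambda>k. xb (r k)) \<longlonglongrightarrow> X" using tendsto_fst[OF lim2] by simp
  have ls: "(\<lambda>k. x (r k)) \<longlonglongrightarrow> S" using tendsto_fst[OF lim3] by simp
  have lv: "(\<lambda>k. V (r k)) \<longlonglongrightarrow> W" using tendsto_fst[OF lim4] by simp
  have ll: "(\<lambda>k. Lk (r k)) \<longlonglongrightarrow> l" using tendsto_fst[OF lim5] by simp
  have lxi: "(\<lambda>k. \<xi> (r k)) \<longlonglongrightarrow> \<Xi>" using tendsto_snd[OF lim5] by simp
  have "d = 0"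
    using LIMSEQ_unique[OF tendsto_snd[OF lim1, simplified] sub[OF step_tendsto]] .
  have "X - S = 0"
    using LIMSEQ_unique[OF tendsto_diff[OF lx ls] sub[OF xb_x_tendsto]] .
  then have XS: "X = S" by simp
  have l0: "l \<in> nonneg"
    unfolding nonneg_def
  proof (intro CollectI allI)
    fix i
    have "(\<lambda>k. Lk (r k) $ i) \<longlonglongrightarrow> l $ i" by (intro tendsto_intros ll)
    moreover have "0 \<le> Lk k $ i" for k using Lk_nonneg[of k] by (simp add: nonneg_def)
    ultimately show "0 \<le> l $ i" by (intro LIMSEQ_le_const) auto
  qed
  have large: "r k \<ge> khat" if "k \<ge> khat" for k using seq_suble[OF r, of k] that by linarith
  have T: "Tfun f h X S W l i \<le> 0" for i
  proof -
    obtain p where p: "fconj (h i) (- (W $ i) + grad (f i) S) = ereal (inner (- (W $ i) + grad (f i) S) p - h i p)"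
      using strongly_convex_fconj[OF hsc(2)[rule_format, of i]] by metis
    have "T_aff f h p (xb (r k)) (x (r k)) (V (r k)) (Lk (r k)) i \<le> 0" if "k \<ge> khat" for k
    proof -
      have "ereal (T_aff f h p (xb (r k)) (x (r k)) (V (r k)) (Lk (r k)) i) \<le> 0"
        using T_aff_le Phi_finiteD(2)[OF Phi_le(3)[OF large[OF that]]] order_trans by blast
      then show ?thesis by simp
    qed
    moreover have "(\<lambda>k. T_aff f h p (xb (r k)) (x (r k)) (V (r k)) (Lk (r k)) i) \<longlonglongrightarrow> T_aff f h p X S W l i"
      by (intro T_aff_tendsto lx ls lv ll) (use fq in blast)
    ultimately have "T_aff f h p X S W l i \<le> 0" by (intro LIMSEQ_le_const2) auto
    then show ?thesis using p by (simp add: Tfun_def T_aff_def)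
  qed
  have Phi: "Phi \<phi> f0 h0 f h (X, S, W, l, \<Xi>) = ereal (\<phi> X) + T0fun f0 h0 X S \<Xi>"
    using l0 T by (rule Phi_feasible)
  obtain p where p: "fconj h0 (- \<Xi> + grad f0 S) = ereal (inner (- \<Xi> + grad f0 S) p - h0 p)"
    using strongly_convex_fconj[OF hsc(1)] by metis
  have upper: "\<phi> X + T0_aff f0 h0 p X S \<Xi> \<le> Fs"
  proof (rule LIMSEQ_le)
    show "(\<lambda>k. \<phi> (xb (r k)) + T0_aff f0 h0 p (xb (r k)) (x (r k)) (\<xi> (r k))) \<longlonglongrightarrow> \<phi> X + T0_aff f0 h0 p X S \<Xi>"
      by (intro tendsto_add isCont_tendsto_compose[OF phi_cont] T0_aff_tendsto fq(1) lx ls lxi)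
    show "(\<lambda>k. Fr (r k)) \<longlonglongrightarrow> Fs" by (rule sub[OF Fr_tendsto])
    show "\<exists>N. \<forall>k\<ge>N. \<phi> (xb (r k)) + T0_aff f0 h0 p (xb (r k)) (x (r k)) (\<xi> (r k)) \<le> Fr (r k)"
    proof (intro exI allI impI)
      fix k assume "khat \<le> k"
      then have "ereal (\<phi> (xb (r k)) + T0_aff f0 h0 p (xb (r k)) (x (r k)) (\<xi> (r k))) \<le> ereal (Fr (r k))"
        using Phi_lower Phi_le(1)[OF large] order_trans by blast
      then show "\<phi> (xb (r k)) + T0_aff f0 h0 p (xb (r k)) (x (r k)) (\<xi> (r k)) \<le> Fr (r k)" by simp
    qed
  qed
  have "(\<lambda>k. Fr (r k)) \<longlonglongrightarrow> f0 S - h0 S + \<phi> S"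
  proof -
    obtain A b c where f0: "\<And>s. f0 s = inner s (blinfun_apply A s) / 2 + inner b s + c"
      using strongly_convex_quadratic_grad[OF fq(1)] by metis
    have "(\<lambda>k. f0 (x (r k))) \<longlonglongrightarrow> f0 S"
      unfolding f0 by (intro tendsto_intros ls) simp
    then show ?thesis
      unfolding Fr_def by (intro tendsto_add tendsto_diff isCont_tendsto_compose[OF phi_cont]
          isCont_tendsto_compose[OF strongly_convex_continuous[OF hsc(1)]] ls)
  qed
  then have "Fs = f0 S - h0 S + \<phi> S" using LIMSEQ_unique sub[OF Fr_tendsto] by blast
  then have lower: "ereal Fs \<le> Phi \<phi> f0 h0 f h (X, S, W, l, \<Xi>)"
    using Phi_lower[of \<phi> X f0 h0 S S \<Xi> f h W l] by (simp add: T0_aff_self XS add.commute)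
  have "Phi \<phi> f0 h0 f h (X, S, W, l, \<Xi>) = ereal (\<phi> X + T0_aff f0 h0 p X S \<Xi>)"
    unfolding Phi T0_aff_eq[OF p] by simp
  with upper lower show ?thesis by (simp add: Phi_c_def w \<open>d = 0\<close>)
qed

lemma summable_e: "summable e"
proof -
  define wk where "wk k = ((xb k, x k, V k, Lk k, \<xi> k), x (Suc k) - x k)" for k
  let ?H = "Phi_c \<phi> f0 h0 f h c"
  have "\<exists>\<delta> \<epsilon> \<psi>. KL_gauge ?H p Fs \<delta> \<epsilon> \<psi>" if "p \<in> cluster_points wk" for p
    using KL cluster_value[of p] that unfolding wk_def[abs_def] by (intro KL_at_gauge) blast+
  then obtain \<delta> \<epsilon> \<psi> where q: "\<And>p. p \<in> cluster_points wk \<Longrightarrow> KL_gauge ?H p Fs (\<delta> p) (\<epsilon> p) (\<psi> p)"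
    by metis
  have q1: "\<delta> p > 0" "\<epsilon> p > 0" "\<And>t. 0 \<le> t \<Longrightarrow> t < \<epsilon> p \<Longrightarrow> \<psi> p t \<ge> 0"
      "\<And>s t. 0 \<le> t \<Longrightarrow> t \<le> s \<Longrightarrow> s < \<epsilon> p \<Longrightarrow> \<psi> p t \<le> \<psi> p s"
      "\<And>w P r s t. w \<in> ball p (\<delta> p) \<Longrightarrow> P \<in> limiting_subdiff ?H w \<Longrightarrow> ?H w = ereal (Fs + r) \<Longrightarrow> r < \<epsilon> p \<Longrightarrow>
       0 \<le> t \<Longrightarrow> t \<le> s \<Longrightarrow> 0 < s \<Longrightarrow> s \<le> r \<Longrightarrow> s - t \<le> norm P * (\<psi> p s - \<psi> p t)"
    if "p \<in> cluster_points wk" for p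
    using q[OF that] unfolding KL_gauge_def by blast+
  have "bounded (range wk)" unfolding wk_def[abs_def] by (rule bounded_w)
  from cluster_points_finite_cover[OF this, of "\<lambda>p. ball p (\<delta> p)"] q1(1)
  obtain I N1 where I: "finite I" "I \<subseteq> cluster_points wk" "\<And>k. k \<ge> N1 \<Longrightarrow> \<exists>p\<in>I. wk k \<in> ball p (\<delta> p)"
    by (metis centre_in_ball open_ball)
  obtain K N2 where K: "K \<ge> 0" "N2 \<ge> khat"
    "\<And>k. k \<ge> N2 \<Longrightarrow> \<exists>P \<in> limiting_subdiff ?H (wk k). norm P \<le> K * e k"
    unfolding wk_def using subgradient_rate by metis
  \<comment> \<open>The inserted 1 keeps the set nonempty irrespective of \<open>I\<close>.\<close>
  define \<epsilon>m where "\<epsilon>m = Min (insert 1 (\<epsilon> ` I))"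
  have em: "\<epsilon>m > 0" "\<And>p. p \<in> I \<Longrightarrow> \<epsilon>m \<le> \<epsilon> p"
    using I q1(2) by (auto simp: \<epsilon>m_def Min_gr_iff)
  have "(\<lambda>k. Fr k + c * (norm (x (Suc k) - x k))\<^sup>2) \<longlonglongrightarrow> Fs + c * (norm (0::'a))\<^sup>2"
    by (intro tendsto_intros Fr_tendsto step_tendsto)
  then have "\<forall>\<^sub>F k in sequentially. Fr k + c * (norm (x (Suc k) - x k))\<^sup>2 < Fs + \<epsilon>m"
    by (rule order_tendstoD) (use em in simp)
  then obtain N3 where N3: "\<And>k. k \<ge> N3 \<Longrightarrow> Fr k + c * (norm (x (Suc k) - x k))\<^sup>2 < Fs + \<epsilon>m"
    unfolding eventually_sequentially by blast
  define N where "N = max N1 (max N2 N3)"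
  \<comment> \<open>Evaluated at index \<open>Suc k\<close>, the highest level guaranteed to lie
    below the potential at \<open>wk k\<close>. Summing over \<open>I\<close> makes the sequence
    independent of the neighbourhood that \<open>wk k\<close> visits; all summands are monotone, so
    the decrease of one is at most that of the sum.\<close>
  define \<Psi> where "\<Psi> k = (\<Sum>p\<in>I. \<psi> p (Fr (Suc k) - Fs))" for k
  have Fre: "0 \<le> Fr (Suc k) - Fs" "Fr (Suc k) - Fs < \<epsilon> p" if "k \<ge> N" "p \<in> I" for k p
  proof -
    show "0 \<le> Fr (Suc k) - Fs" using Fs_le[of "Suc k"] by simp
    have "0 \<le> c * (norm (x (Suc k) - x k))\<^sup>2" using c_pos by simp
    then show "Fr (Suc k) - Fs < \<epsilon> p"
      using N3[of k] that em(2)[of p] Fr_le[of k] by (simp add: N_def)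
  qed
  have I': "p \<in> cluster_points wk" if "p \<in> I" for p using I that by blast
  have dec: "0 \<le> \<psi> p (Fr (Suc k) - Fs) - \<psi> p (Fr (Suc (Suc k)) - Fs)" if "k \<ge> N" "p \<in> I" for k p
    using q1(4)[OF I'[OF that(2)], of "Fr (Suc (Suc k)) - Fs" "Fr (Suc k) - Fs"] Fre[OF that] Fs_le[of "Suc (Suc k)"]
      Fr_le[of "Suc k"] by simp
  have main: "(e (Suc k))\<^sup>2 \<le> e k * (K * (\<Psi> k - \<Psi> (Suc k)))" if k: "k \<ge> N" for k
  proof (cases "Fr (Suc k) = Fs")
    \<comment> \<open>At the limit level the gauge is silent because it requires
      \<open>0 < s\<close>; but then all later values equal \<open>Fs\<close> and
      \<open>e (Suc k)\<close> vanishes.\<close>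
    case True
    then have "(e (Suc k))\<^sup>2 \<le> 0" using Fs_le[of "Suc (Suc k)"] by (simp add: e_sq)
    moreover have "0 \<le> \<Psi> k - \<Psi> (Suc k)"
      unfolding \<Psi>_def sum_subtractf[symmetric] by (intro sum_nonneg dec k)
    then have "0 \<le> e k * (K * (\<Psi> k - \<Psi> (Suc k)))" using e_ge[of k] K(1) by simp
    ultimately show ?thesis by linarith
  next
    case False
    have kN: "k \<ge> N1" "k \<ge> N2" "k \<ge> N3" using k by (auto simp: N_def)
    then have kh: "k \<ge> khat" using K(2) by simp
    obtain p where p: "p \<in> I" "wk k \<in> ball p (\<delta> p)" using I(3)[OF kN(1)] by blast
    obtain P where P: "P \<in> limiting_subdiff ?H (wk k)" "norm P \<le> K * e k" using K(3)[OF kN(2)] by blast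
    obtain v where v: "Phi \<phi> f0 h0 f h (xb k, x k, V k, Lk k, \<xi> k) = ereal v"
      "Fr (Suc k) - c * (norm (x (Suc k) - x k))\<^sup>2 \<le> v" "v \<le> Fr k"
      using Phi_le(1,2)[OF kh] by (cases "Phi \<phi> f0 h0 f h (xb k, x k, V k, Lk k, \<xi> k)") auto
    \<comment> \<open>The quadratic term of the potential cancels the loss in the lower half of the
      sandwich, so \<open>r\<close> is at least \<open>Fr (Suc k) - Fs\<close>; the upper half keeps
      \<open>r\<close> below the gauge radius.\<close>
    define r where "r = v + c * (norm (x (Suc k) - x k))\<^sup>2 - Fs"
    have Hr: "?H (wk k) = ereal (Fs + r)" by (simp add: Phi_c_def wk_def v(1) r_def)
    have "r < \<epsilon> p" using N3[OF kN(3)] v(3) em(2)[OF p(1)] by (simp add: r_def)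
    moreover have "Fr (Suc k) - Fs \<le> r" using v(2) by (simp add: r_def)
    moreover have "0 < Fr (Suc k) - Fs" using False Fs_le[of "Suc k"] by simp
    moreover have "0 \<le> Fr (Suc (Suc k)) - Fs" using Fs_le[of "Suc (Suc k)"] by simp
    moreover have "Fr (Suc (Suc k)) - Fs \<le> Fr (Suc k) - Fs" using Fr_le[of "Suc k"] by simp
    ultimately have "(Fr (Suc k) - Fs) - (Fr (Suc (Suc k)) - Fs)
        \<le> norm P * (\<psi> p (Fr (Suc k) - Fs) - \<psi> p (Fr (Suc (Suc k)) - Fs))"
      using q1(5)[OF I'[OF p(1)] p(2) P(1) Hr] by blast
    also have "\<dots> \<le> (K * e k) * (\<Psi> k - \<Psi> (Suc k))"
    proof (rule mult_mono[OF P(2)])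
      show "\<psi> p (Fr (Suc k) - Fs) - \<psi> p (Fr (Suc (Suc k)) - Fs) \<le> \<Psi> k - \<Psi> (Suc k)"
        unfolding \<Psi>_def sum_subtractf[symmetric] using p(1) I(1) dec[OF k] by (intro member_le_sum) auto
    qed (use dec[OF k p(1)] K(1) e_ge[of k] in auto)
    finally show ?thesis by (simp add: e_sq algebra_simps)
  qed
  have "e (Suc k) \<le> e k / 2 + (K / 2 * \<Psi> k - K / 2 * \<Psi> (Suc k))" if k: "k \<ge> N" for k
  proof -
    define a where "a = K * (\<Psi> k - \<Psi> (Suc k))"
    have "0 \<le> \<Psi> k - \<Psi> (Suc k)"
      unfolding \<Psi>_def sum_subtractf[symmetric] by (intro sum_nonneg dec k)
    then have a: "a \<ge> 0" using K(1) by (simp add: a_def)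
    have "0 \<le> (e k - a)\<^sup>2" by simp
    then have "e k * a \<le> ((e k + a) / 2)\<^sup>2" by (simp add: power2_eq_square field_simps)
    then have "(e (Suc k))\<^sup>2 \<le> ((e k + a) / 2)\<^sup>2" using main[OF k] by (simp add: a_def)
    then have "e (Suc k) \<le> (e k + a) / 2" by (rule power2_le_imp_le) (use a e_ge[of k] in simp)
    then show ?thesis by (simp add: a_def field_simps)
  qed
  moreover have "0 \<le> K / 2 * \<Psi> k" if "k \<ge> N" for k
    using K(1) Fre[OF that] q1(3)[OF I'] by (auto simp: \<Psi>_def intro!: mult_nonneg_nonneg sum_nonneg)
  ultimately show ?thesis using summable_of_halving_telescope[of e N "\<lambda>k. K / 2 * \<Psi> k"] e_ge by blast
qed

lemma summable_steps: "summable (\<lambda>k. norm (x (Suc k) - x k))"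
proof (rule summable_comparison_test')
  show "summable (\<lambda>k. sqrt (2 / \<alpha>) * e k)" by (rule summable_mult[OF summable_e])
  show "norm (norm (x (Suc k) - x k)) \<le> sqrt (2 / \<alpha>) * e k" if "k \<ge> 0" for k
    using step_le[of k] by simp
qed

lemma x_converges: obtains xs where "x \<longlonglongrightarrow> xs"
proof -
  have "summable (\<lambda>k. x (Suc k) - x k)" by (rule summable_norm_cancel[OF summable_steps])
  then have "(\<lambda>n. \<Sum>k<n. x (Suc k) - x k) \<longlonglongrightarrow> (\<Sum>k. x (Suc k) - x k)" by (rule summable_LIMSEQ)
  then have "(\<lambda>n. x n - x 0) \<longlonglongrightarrow> (\<Sum>k. x (Suc k) - x k)" by (simp add: sum_lessThan_telescope)
  then have "(\<lambda>n. (x n - x 0) + x 0) \<longlonglongrightarrow> (\<Sum>k. x (Suc k) - x k) + x 0" by (intro tendsto_intros)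
  then show ?thesis using that by simp
qed

text \<open>Along a subsequence the bounded optimality data of \<open>xb k\<close> converge. As
  \<open>xb k - x k\<close> tends to 0, the curvature terms vanish and the constraint models tend to
  \<open>g\<close> at the limit, so the subproblem conditions become stationarity.\<close>

lemma limit_stationary:
  assumes xs: "x \<longlonglongrightarrow> xs"
  shows "xs \<in> stationary_set g0 g \<phi>"
proof -
  obtain R where R: "\<And>k. norm (\<xi> k) \<le> R" "\<And>k. norm (V k) \<le> R" "\<And>k. norm (Lk k) \<le> R"
    "\<And>k d. norm (blinfun_apply (Qk k) d) \<le> R * norm d" using data_bounds by metis
  obtain B N where B: "\<And>k. k \<ge> N \<Longrightarrow> \<exists>u lm. kkt k u \<and> norm u \<le> B \<and> multiplier k u lm \<and> norm lm \<le> B"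
    using bounded_multipliers by metis
  then have "\<forall>k. \<exists>u lm. kkt (k + N) u \<and> norm u \<le> B \<and> multiplier (k + N) u lm \<and> norm lm \<le> B"
    by simp
  then obtain u lm where u: "\<And>k. kkt (k + N) (u k)" "\<And>k. norm (u k) \<le> B"
    and lm: "\<And>k. multiplier (k + N) (u k) (lm k)" "\<And>k. norm (lm k) \<le> B" by metis
  \<comment> \<open>The shift by \<open>N\<close> skips the indices without a guaranteed bounded
    multiplier. \<open>Qk\<close> is left out: it acts on a null sequence and is uniformly bounded,
    so its limit never matters.\<close>
  define q where "q k = (\<xi> (k + N), V (k + N), Lk (k + N), u k, lm k)" for k
  have "norm (q k) \<le> R + (R + (R + (B + B)))" for k
    unfolding q_def by (intro norm_Pair_le_add R u lm)
  then have "bounded (range q)" unfolding bounded_iff by blast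
  then obtain l r where r: "strict_mono r" and l: "(q \<circ> r) \<longlonglongrightarrow> l"
    using bounded_imp_convergent_subsequence by blast
  define n where "n k = r k + N" for k
  obtain \<Xi> W l' us ls where lq: "l = (\<Xi>, W, l', us, ls)" by (metis prod.exhaust)
  have lim1: "(\<lambda>k. (\<xi> (n k), V (n k), Lk (n k), u (r k), lm (r k))) \<longlonglongrightarrow> (\<Xi>, W, l', us, ls)"
    using l by (simp add: o_def q_def lq n_def)
  note lim2 = tendsto_snd[OF lim1, simplified]
  note lim3 = tendsto_snd[OF lim2, simplified]
  note lim4 = tendsto_snd[OF lim3, simplified]
  have lxi: "(\<lambda>k. \<xi> (n k)) \<longlonglongrightarrow> \<Xi>" using tendsto_fst[OF lim1] by simp
  have lV: "(\<lambda>k. V (n k)) \<longlonglongrightarrow> W" using tendsto_fst[OF lim2] by simp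
  have lL: "(\<lambda>k. Lk (n k)) \<longlonglongrightarrow> l'" using tendsto_fst[OF lim3] by simp
  have lu: "(\<lambda>k. u (r k)) \<longlonglongrightarrow> us" using tendsto_fst[OF lim4] by simp
  have llm: "(\<lambda>k. lm (r k)) \<longlonglongrightarrow> ls" using tendsto_snd[OF lim4] by simp
  have nm: "strict_mono n" using r by (simp add: strict_mono_def n_def)
  have lx: "(\<lambda>k. x (n k)) \<longlonglongrightarrow> xs" using LIMSEQ_subseq_LIMSEQ[OF xs nm] by (simp add: o_def)
  have ld: "(\<lambda>k. xb (n k) - x (n k)) \<longlonglongrightarrow> 0" using LIMSEQ_subseq_LIMSEQ[OF xb_x_tendsto nm] by (simp add: o_def)
  have lxb: "(\<lambda>k. xb (n k)) \<longlonglongrightarrow> xs" using tendsto_add[OF ld lx] by simp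
  have feas: "xs \<in> feas g" using closed_sequentially[OF closed_feas _ xs] x_feas by blast
  then have xO: "xs \<in> Oset" using Gamma_sub by blast
  have a: "\<Xi> \<in> limiting_subdiff g0 xs"
  proof (rule limiting_subdiff_closed[OF lx _ _ _ lxi])
    have "isCont (\<lambda>w. real_of_ereal (g0 w)) xs" using g0_lip xO by (intro loc_lipschitz_isCont) blast
    then have "(\<lambda>k. real_of_ereal (g0 (x (n k)))) \<longlonglongrightarrow> real_of_ereal (g0 xs)"
      using lx by (rule isCont_tendsto_compose)
    then have "(\<lambda>k. ereal (real_of_ereal (g0 (x (n k))))) \<longlonglongrightarrow> ereal (real_of_ereal (g0 xs))" by simp
    then show "(\<lambda>k. g0 (x (n k))) \<longlonglongrightarrow> g0 xs"
      by (simp only: g0_real[OF x_O, symmetric] g0_real[OF xO, symmetric])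
    show "\<bar>g0 xs\<bar> \<noteq> \<infinity>" using bspec[OF g0_finite xO] spec[OF g0_proper, of xs] by (cases "g0 xs") simp_all
    show "\<xi> (n k) \<in> limiting_subdiff g0 (x (n k))" for k using xi_sub by blast
  qed
  have b: "us \<in> limiting_subdiff (\<lambda>y. ereal (\<phi> y)) xs"
    unfolding limiting_subdiff_convex[OF phi_convex]
  proof
    fix z
    have "(\<lambda>k. \<phi> (xb (n k)) + inner (u (r k)) (z - xb (n k))) \<longlonglongrightarrow> \<phi> xs + inner us (z - xs)"
      by (intro tendsto_intros isCont_tendsto_compose[OF phi_cont] lxb lu)
    moreover have "\<phi> (xb (n k)) + inner (u (r k)) (z - xb (n k)) \<le> \<phi> z" for k
      using u(1)[of "r k"] by (simp add: kkt_def n_def)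
    ultimately show "\<phi> xs + inner us (z - xs) \<le> \<phi> z" by (intro LIMSEQ_le_const2) auto
  qed
  have cW: "W $ i \<in> limiting_subdiff (\<lambda>y. ereal (g i y)) xs" for i
  proof (rule limiting_subdiff_closed[OF lx])
    show "(\<lambda>k. ereal (g i (x (n k)))) \<longlonglongrightarrow> ereal (g i xs)"
      using isCont_tendsto_compose[OF g_cont lx] by simp
    show "V (n k) $ i \<in> limiting_subdiff (\<lambda>y. ereal (g i y)) (x (n k))" for k using V_sub by blast
    show "(\<lambda>k. V (n k) $ i) \<longlonglongrightarrow> W $ i" by (intro tendsto_intros lV)
  qed simp
  have mult: "multiplier (n k) (u (r k)) (lm (r k))" for k using lm(1)[of "r k"] by (simp add: n_def)
  have z: "ls \<in> normal_cone nonpos (gvec g xs)"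
    unfolding normal_cone_nonpos
  proof (intro conjI allI)
    show "gvec g xs \<in> nonpos" using feas by (simp add: feas_def)
    have "0 \<le> ls $ i" for i
    proof (rule LIMSEQ_le_const)
      show "(\<lambda>k. lm (r k) $ i) \<longlonglongrightarrow> ls $ i" by (intro tendsto_intros llm)
      show "\<exists>N. \<forall>k\<ge>N. 0 \<le> lm (r k) $ i" using mult by (auto simp: multiplier_def nonneg_def)
    qed
    then show "ls \<in> nonneg" by (simp add: nonneg_def)
    fix i
    have "(\<lambda>k. lm (r k) $ i * Gfun g (xb (n k)) (x (n k)) (V (n k)) (Lk (n k)) $ i)
        \<longlonglongrightarrow> ls $ i * (g i xs + inner (W $ i) 0 + (norm (0::'a))\<^sup>2 / 2 * l' $ i)"
      unfolding Gfun_def vec_lambda_beta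
      by (intro tendsto_intros llm isCont_tendsto_compose[OF g_cont] lx ld lV lL) simp
    moreover have "lm (r k) $ i * Gfun g (xb (n k)) (x (n k)) (V (n k)) (Lk (n k)) $ i = 0" for k
      using mult by (simp add: multiplier_def)
    ultimately have "(\<lambda>k. 0) \<longlonglongrightarrow> ls $ i * g i xs" by simp
    then show "ls $ i * gvec g xs $ i = 0" by (simp add: LIMSEQ_const_iff gvec_def)
  qed
  have "\<Xi> + us + matvec W ls = 0"
  proof -
    have "(\<lambda>k. blinfun_apply (Qk (n k)) (xb (n k) - x (n k))) \<longlonglongrightarrow> 0"
    proof (rule Lim_null_comparison)
      show "\<forall>\<^sub>F k in sequentially. norm (blinfun_apply (Qk (n k)) (xb (n k) - x (n k))) \<le> R * norm (xb (n k) - x (n k))"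
        using R(4) by simp
      show "(\<lambda>k. R * norm (xb (n k) - x (n k))) \<longlonglongrightarrow> 0"
        using tendsto_mult_right_zero[OF tendsto_norm_zero[OF ld]] by simp
    qed
    then have "(\<lambda>k. (matvec (V (n k)) (lm (r k)) + inner (Lk (n k)) (lm (r k)) *\<^sub>R (xb (n k) - x (n k)))
        + (\<xi> (n k) + blinfun_apply (Qk (n k)) (xb (n k) - x (n k)) + u (r k)))
      \<longlonglongrightarrow> (matvec W ls + inner l' ls *\<^sub>R 0) + (\<Xi> + 0 + us)"
      unfolding matvec_def by (intro tendsto_intros lV llm lL ld lxi lu)
    moreover have "(matvec (V (n k)) (lm (r k)) + inner (Lk (n k)) (lm (r k)) *\<^sub>R (xb (n k) - x (n k)))
        + (\<xi> (n k) + blinfun_apply (Qk (n k)) (xb (n k) - x (n k)) + u (r k)) = 0" for k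
      using mult[of k] unfolding multiplier_def by (metis add.left_inverse)
    ultimately have "(\<lambda>k. 0) \<longlonglongrightarrow> matvec W ls + (\<Xi> + us)" by simp
    then show ?thesis by (simp add: LIMSEQ_const_iff add.commute)
  qed
  then show ?thesis
    unfolding stationary_set_def matvec_def using feas a b z cW
    by (intro CollectI conjI bexI[of _ \<Xi>] bexI[of _ us] bexI[of _ ls] exI[of _ "\<lambda>i. W $ i"]) auto
qed

lemma convergence:
  "summable (\<lambda>k. norm (x (Suc k) - x k)) \<and>
   (\<exists>xs. x \<longlonglongrightarrow> xs \<and> xs \<in> cluster_points x) \<and>
   cluster_points x \<subseteq> stationary_set g0 g \<phi>"
proof (intro conjI summable_steps)
  obtain xs where xs: "x \<longlonglongrightarrow> xs" by (rule x_converges)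
  have "xs \<in> cluster_points x"
    unfolding cluster_points_def using xs by (auto intro!: exI[of _ id] strict_monoI)
  with xs show "\<exists>xs. x \<longlonglongrightarrow> xs \<and> xs \<in> cluster_points x" by blast
  show "cluster_points x \<subseteq> stationary_set g0 g \<phi>"
  proof
    fix p assume "p \<in> cluster_points x"
    then obtain r where "strict_mono r" "(x \<circ> r) \<longlonglongrightarrow> p" unfolding cluster_points_def by blast
    then have "p = xs" using LIMSEQ_subseq_LIMSEQ[OF xs] LIMSEQ_unique by blast
    then show "p \<in> stationary_set g0 g \<phi>" using limit_stationary[OF xs] by simp
  qed
qed

end

theorem theorem4p2:
  fixes g0 :: "'a::euclidean_space \<Rightarrow> ereal"
    and g :: "'m::finite \<Rightarrow> 'a \<Rightarrow> real"
    and \<phi> :: "'a \<Rightarrow> real"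
    and Oset :: "'a set"
    and \<mu>min \<mu>max Lmin Lmax M \<beta>C \<beta>S \<alpha> \<tau> :: real
    and x \<xi> :: "nat \<Rightarrow> 'a"
    and V :: "nat \<Rightarrow> ('a^'m)"
    and jk :: "nat \<Rightarrow> nat"
    and \<mu> :: "nat \<Rightarrow> nat \<Rightarrow> real"
    and Q :: "nat \<Rightarrow> nat \<Rightarrow> ('a \<Rightarrow>\<^sub>L 'a)"
    and L :: "nat \<Rightarrow> nat \<Rightarrow> (real^'m)"
    and xbar y v :: "nat \<Rightarrow> nat \<Rightarrow> 'a"
    and lam :: "nat \<Rightarrow> nat \<Rightarrow> (real^'m)"
    and D :: "'a set"
    and f0 h0 :: "'a \<Rightarrow> real"
    and f h :: "'m \<Rightarrow> 'a \<Rightarrow> real"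
    and c :: real and khat :: nat
  \<comment> \<open>Assumption 1 (standing)\<close>
  assumes O_open: "open Oset" and O_convex: "convex Oset"
    and Gamma_sub: "feas g \<subseteq> Oset" and Gamma_ne: "feas g \<noteq> {}"
    and g0_proper: "\<forall>z. g0 z \<noteq> -\<infinity>"
    and g0_finite: "\<forall>z\<in>Oset. g0 z \<noteq> \<infinity>"
    and g0_lip: "\<forall>z\<in>Oset. loc_lipschitz_at (\<lambda>w. real_of_ereal (g0 w)) z"
    and g0_uC2: "\<forall>z\<in>Oset. upper_C2_at (\<lambda>w. real_of_ereal (g0 w)) z"
    and g_lip: "\<forall>i z. loc_lipschitz_at (g i) z"
    and g_uC2: "\<forall>i z. upper_C2_at (g i) z"
    and phi_convex: "convex_on UNIV \<phi>"
    and F_bdd: "\<exists>b. \<forall>z\<in>feas g. Fobj g0 g \<phi> z \<ge> ereal b"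
  \<comment> \<open>Parameters of iMBA\<close>
    and par: "0 < \<mu>min" "\<mu>min \<le> \<mu>max" "0 < Lmin" "Lmin \<le> Lmax" "M > 0" "\<beta>C > 0" "\<beta>S > 0"
      "\<alpha> > 0" "\<tau> > 1"
  \<comment> \<open>The sequences are generated by iMBA\<close>
    and x0: "x 0 \<in> feas g"
    and xi_sub: "\<forall>k. \<xi> k \<in> limiting_subdiff g0 (x k)"
    and V_sub: "\<forall>k i. V k $ i \<in> limiting_subdiff (\<lambda>z. ereal (g i z)) (x k)"
    and mu0: "\<forall>k. \<mu>min \<le> \<mu> k 0 \<and> \<mu> k 0 \<le> \<mu>max"
    and L0: "\<forall>k i. Lmin \<le> L k 0 $ i \<and> L k 0 $ i \<le> Lmax"
    and Q_sa: "\<forall>k j. j \<le> jk k \<longrightarrow> self_adjoint (Q k j) \<and>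
        (\<forall>d. \<mu> k j * (norm d)\<^sup>2 \<le> inner d (blinfun_apply (Q k j) d) \<and>
             inner d (blinfun_apply (Q k j) d) \<le> (\<mu> k j + M) * (norm d)\<^sup>2)"
    and xbar_min: "\<forall>k j. j \<le> jk k \<longrightarrow>
        Gfun g (xbar k j) (x k) (V k) (L k j) \<in> nonpos \<and>
        (\<forall>z. Gfun g z (x k) (V k) (L k j) \<in> nonpos \<longrightarrow>
           Fmodel g0 \<phi> (x k) (\<xi> k) (Q k j) (xbar k j) \<le> Fmodel g0 \<phi> (x k) (\<xi> k) (Q k j) z)"
    and inexact: "\<forall>k j. j \<le> jk k \<longrightarrow>
        v k j \<in> limiting_subdiff (\<lambda>z. ereal (\<phi> z)) (y k j) \<and> lam k j \<in> nonneg \<and>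
        Fmodel g0 \<phi> (x k) (\<xi> k) (Q k j) (y k j) \<le> Fmodel g0 \<phi> (x k) (\<xi> k) (Q k j) (x k) \<and>
        max 0 (- inner (lam k j) (Gfun g (y k j) (x k) (V k) (L k j)))
          + pos_part_inf_norm (Gfun g (y k j) (x k) (V k) (L k j))
          \<le> \<beta>C / 2 * (norm (y k j - x k))\<^sup>2 \<and>
        norm (\<xi> k + blinfun_apply (Q k j) (y k j - x k) + v k j + matvec (V k) (lam k j)
              + inner (L k j) (lam k j) *\<^sub>R (y k j - x k))
          \<le> \<beta>S * norm (y k j - x k)"
    and accept: "\<forall>k. gvec g (y k (jk k)) \<in> nonpos \<and>
        Fobj g0 g \<phi> (y k (jk k)) \<le> Fobj g0 g \<phi> (x k) - ereal (\<alpha> / 2 * (norm (y k (jk k) - x k))\<^sup>2)"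
    and reject: "\<forall>k j. j < jk k \<longrightarrow>
        \<not> (gvec g (y k j) \<in> nonpos \<and>
           Fobj g0 g \<phi> (y k j) \<le> Fobj g0 g \<phi> (x k) - ereal (\<alpha> / 2 * (norm (y k j - x k))\<^sup>2)) \<and>
        (gvec g (y k j) \<notin> nonpos \<longrightarrow> L k (Suc j) = \<tau> *\<^sub>R L k j \<and> \<mu> k (Suc j) = \<mu> k j) \<and>
        (gvec g (y k j) \<in> nonpos \<longrightarrow> L k (Suc j) = L k j \<and> \<mu> k (Suc j) = \<tau> * \<mu> k j)"
    and x_next: "\<forall>k. x (Suc k) = y k (jk k)"
  \<comment> \<open>Assumption 2\<close>
    and A2: "\<forall>k j. j \<le> jk k \<longrightarrow> (\<exists>\<kappa> \<delta>. \<delta> > 0 \<and> (\<forall>z\<in>ball (xbar k j) \<delta>.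
        infdist z {w. Gfun g w (x k) (V k) (L k j) \<in> nonpos}
          \<le> \<kappa> * infdist 0 {Gfun g z (x k) (V k) (L k j) - q | q. q \<in> nonpos}))"
  \<comment> \<open>Assumption 3\<close>
    and A3: "bounded (range x)"
  \<comment> \<open>Assumption 4\<close>
    and A4: "\<forall>p \<in> cluster_points (\<lambda>k. ((x k, L k (jk k), V k, \<xi> k, Q k (jk k)), xbar k (jk k))).
        partial_BMP g (fst p) (snd p)"
  \<comment> \<open>The DC decomposition on D\<close>
    and D: "compact D" "convex D" "D \<subseteq> Oset" "range x \<subseteq> D"
    and dc0: "\<forall>z\<in>D. g0 z = ereal (f0 z - h0 z)"
    and dc: "\<forall>i. \<forall>z\<in>D. g i z = f i z - h i z"
    and fq: "strongly_convex_quadratic f0" "\<forall>i. strongly_convex_quadratic (f i)"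
    and hsc: "strongly_convex h0" "\<forall>i. strongly_convex (h i)"
  \<comment> \<open>The sandwich constants\<close>
    and c_pos: "c > 0"
    and sandwich: "\<forall>k\<ge>khat.
        Fobj g0 g \<phi> (x (Suc k)) - ereal (c * (norm (x (Suc k) - x k))\<^sup>2)
          \<le> Phi \<phi> f0 h0 f h (xbar k (jk k), x k, V k, L k (jk k), \<xi> k) \<and>
        Phi \<phi> f0 h0 f h (xbar k (jk k), x k, V k, L k (jk k), \<xi> k) \<le> Fobj g0 g \<phi> (x k)"
  \<comment> \<open>KL property at every cluster point of w^k\<close>
    and KL: "\<forall>w\<in>cluster_points (\<lambda>k. ((xbar k (jk k), x k, V k, L k (jk k), \<xi> k), x (Suc k) - x k)).
        KL_at (Phi_c \<phi> f0 h0 f h c) w"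
  shows "summable (\<lambda>k. norm (x (Suc k) - x k)) \<and>
         (\<exists>xs. x \<longlonglongrightarrow> xs \<and> xs \<in> cluster_points x) \<and>
         cluster_points x \<subseteq> stationary_set g0 g \<phi>"
proof -
  interpret imba g0 g \<phi> Oset \<mu>min \<mu>max Lmin Lmax M \<beta>C \<beta>S \<alpha> \<tau> x \<xi> V jk \<mu> Q L xbar y v lam D f0 h0 f h c khat
    by unfold_locales (fact O_open Gamma_sub g0_proper g0_finite g0_lip g0_uC2 g_lip g_uC2 phi_convex F_bdd par
        x0 xi_sub V_sub mu0 L0 Q_sa xbar_min inexact accept reject x_next A3 A4 D(4) dc0 dc fq hsc c_pos sandwich KL)+
  show ?thesis by (rule convergence)
qed

end
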